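(* Let $p$ be a prime, $\mathbf{F}$ a field of characteristic $p$, and $m\ge 1$. Then the set $$\mathcal{B}' = \{x_i,\ N(y_i) \mid 1\le i\le m\}\ \cup\ \{u_{ij}\mid 1\le i<j\le m\}\ \cup\ \{\operatorname{Tr}(y^E)\mid E=(e_1,\dots,e_m),\ 0\le e_i\le p-1 \text{ for all } i,\ |E|>2(p-1)\}$$ is both a minimal algebra generating set and a SAGBI basis for the ring of invariants $\mathbf{F}[m\,V_2]^{C_p}$.
   Context: $\mathbf{F}[m\,V_2]=\mathbf{F}[x_1,y_1,\dots,x_m,y_m]$, and the cyclic group $C_p=\langle\sigma\rangle$ of order $p$ acts on it by the $\mathbf{F}$-algebra automorphisms determined by $\sigma(x_i)=x_i$, $\sigma(y_i)=y_i+x_i$ for $1\le i\le m$ (so $V_2$ is the 2-dimensional indecomposable representation of $C_p$ and $m\,V_2$ is the direct sum of $m$ copies of it). For $f\in\mathbf{F}[m\,V_2]$, $\operatorname{Tr}(f)=\sum_{\tau\in C_p}\tau(f)$ and $N(f)=\prod_{\tau\in C_p}\tau(f)$; thus $N(y_i)=y_i^p-x_i^{p-1}y_i$. Also $u_{ij}=x_iy_j-x_jy_i$, $y^E=y_1^{e_1}\cdots y_m^{e_m}$ and $|E|=e_1+\dots+e_m$. Term order: graded reverse lexicographic order on $\mathbf{F}[m\,V_2]$ with $y_1>x_1>y_2>x_2>\dots>y_m>x_m$. $\operatorname{LM}(f)$ denotes the lead monomial of $f\neq0$ (a power product of variables, without coefficient). A subset $B$ of a graded subalgebra $S$ of the polynomial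 ring is a SAGBI basis for $S$ if for every nonzero homogeneous $f\in S$ (of any degree) $\operatorname{LM}(f)$ can be written as a finite product $\prod_{g\in B}\operatorname{LM}(g)^{e_g}$ with non-negative integers $e_g$. A minimal algebra generating set is a set generating the algebra, no proper subset of which generates it. *)

theory Defs
  imports "HOL.Hull" "HOL-Library.Poly_Mapping" "HOL-Computational_Algebra.Primes"
begin

section \<open>Polynomials in the variables \<open>x\<^sub>i, y\<^sub>i\<close>\<close>

datatype var = X nat | Y nat

type_synonym mon = "var \<Rightarrow>\<^sub>0 nat"
type_synonym 'a mpoly = "mon \<Rightarrow>\<^sub>0 'a"

definition const :: "'a \<Rightarrow> 'a::field mpoly" where
  "const c = Poly_Mapping.single 0 c"

definition var_poly :: "var \<Rightarrow> 'a::field mpoly" where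
  "var_poly v = Poly_Mapping.single (Poly_Mapping.single v 1) 1"

abbreviation xv :: "nat \<Rightarrow> 'a::field mpoly" where "xv i \<equiv> var_poly (X i)"
abbreviation yv :: "nat \<Rightarrow> 'a::field mpoly" where "yv i \<equiv> var_poly (Y i)"

text \<open>The type \<^typ>\<open>'a mpoly\<close> has variables \<open>x\<^sub>i, y\<^sub>i\<close> for all natural numbers \<open>i\<close>;
  \<open>F[m V\<^sub>2]\<close> is the subring of polynomials involving only those with \<open>1 \<le> i \<le> m\<close>.\<close>

definition F_mV2 :: "nat \<Rightarrow> 'a::field mpoly set" where
  "F_mV2 m = {f. \<forall>t\<in>Poly_Mapping.keys f. Poly_Mapping.keys t \<subseteq> X ` {1..m} \<union> Y ` {1..m}}"


section \<open>The action of the cyclic group\<close>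

text \<open>\<open>subst s\<close> is the \<open>F\<close>-algebra endomorphism sending each variable \<open>v\<close> to \<open>s v\<close>.\<close>

definition subst :: "(var \<Rightarrow> 'a::field mpoly) \<Rightarrow> 'a mpoly \<Rightarrow> 'a mpoly" where
  "subst s f = (\<Sum>t\<in>Poly_Mapping.keys f. const (Poly_Mapping.lookup f t) *
                  (\<Prod>v\<in>Poly_Mapping.keys t. s v ^ Poly_Mapping.lookup t v))"

definition \<sigma> :: "'a::field mpoly \<Rightarrow> 'a mpoly" where
  "\<sigma> = subst (\<lambda>v. case v of X i \<Rightarrow> xv i | Y i \<Rightarrow> yv i + xv i)"

text \<open>The elements of \<open>C\<^sub>p = \<langle>\<sigma>\<rangle>\<close> are \<open>\<sigma>\<^sup>k\<close> for \<open>k < p\<close>.\<close>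

definition Tr :: "nat \<Rightarrow> 'a::field mpoly \<Rightarrow> 'a mpoly" where
  "Tr p f = (\<Sum>k<p. (\<sigma> ^^ k) f)"

definition N :: "nat \<Rightarrow> 'a::field mpoly \<Rightarrow> 'a mpoly" where
  "N p f = (\<Prod>k<p. (\<sigma> ^^ k) f)"

definition invariants :: "nat \<Rightarrow> nat \<Rightarrow> 'a::field mpoly set" where
  "invariants p m = {f \<in> F_mV2 m. \<forall>k<p. (\<sigma> ^^ k) f = f}"

definition u :: "nat \<Rightarrow> nat \<Rightarrow> 'a::field mpoly" where
  "u i j = xv i * yv j - xv j * yv i"

definition y_pow :: "nat \<Rightarrow> (nat \<Rightarrow> nat) \<Rightarrow> 'a::field mpoly" where
  "y_pow m E = (\<Prod>i = 1..m. yv i ^ E i)"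


section \<open>Generating sets\<close>

definition subalgebra :: "'a::field mpoly set \<Rightarrow> bool" where
  "subalgebra A \<longleftrightarrow> range const \<subseteq> A \<and> (\<forall>f\<in>A. \<forall>g\<in>A. f + g \<in> A \<and> f * g \<in> A)"

definition generated_algebra :: "'a::field mpoly set \<Rightarrow> 'a mpoly set" where
  "generated_algebra B = subalgebra hull B"

definition minimal_generating_set :: "'a::field mpoly set \<Rightarrow> 'a mpoly set \<Rightarrow> bool" where
  "minimal_generating_set B S \<longleftrightarrow>
     generated_algebra B = S \<and> (\<forall>C. C \<subset> B \<longrightarrow> generated_algebra C \<noteq> S)"


section \<open>Term order and SAGBI bases\<close>

definition mon_degree :: "mon \<Rightarrow> nat" where
  "mon_degree t = (\<Sum>v\<in>Poly_Mapping.keys t. Poly_Mapping.lookup t v)"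

text \<open>Smaller position means larger variable: \<open>y\<^sub>1 > x\<^sub>1 > y\<^sub>2 > x\<^sub>2 > \<dots>\<close>\<close>

fun position :: "var \<Rightarrow> nat" where
  "position (Y i) = 2 * i"
| "position (X i) = 2 * i + 1"

text \<open>Graded reverse lexicographic order: in equal degrees, the monomial with the larger exponent
  at the smallest variable where the two differ is the smaller one.\<close>

definition grevlex_less :: "mon \<Rightarrow> mon \<Rightarrow> bool" where
  "grevlex_less s t \<longleftrightarrow> mon_degree s < mon_degree t \<or>
     mon_degree s = mon_degree t \<and>
     (\<exists>v. Poly_Mapping.lookup s v > Poly_Mapping.lookup t v \<and>
        (\<forall>w. position w > position v \<longrightarrow> Poly_Mapping.lookup s w = Poly_Mapping.lookup t w))"

text \<open>The lead monomial as a power product in the polynomial ring; meaningful only for \<open>f \<noteq> 0\<close>.\<close>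

definition LM :: "'a::field mpoly \<Rightarrow> 'a mpoly" where
  "LM f = Poly_Mapping.single
     (THE t. t \<in> Poly_Mapping.keys f \<and>
        (\<forall>s\<in>Poly_Mapping.keys f. s \<noteq> t \<longrightarrow> grevlex_less s t)) 1"

definition homogeneous :: "'a::field mpoly \<Rightarrow> bool" where
  "homogeneous f \<longleftrightarrow> (\<exists>d. \<forall>t\<in>Poly_Mapping.keys f. mon_degree t = d)"

text \<open>A zero element of \<open>B\<close> has no lead monomial, so it may not occur in the products.\<close>

definition SAGBI_basis :: "'a::field mpoly set \<Rightarrow> 'a mpoly set \<Rightarrow> bool" where
  "SAGBI_basis B S \<longleftrightarrow> B \<subseteq> S \<and>
     (\<forall>f\<in>S. f \<noteq> 0 \<and> homogeneous f \<longrightarrow>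
        (\<exists>A e. finite A \<and> A \<subseteq> B - {0} \<and> LM f = (\<Prod>g\<in>A. LM g ^ e g)))"

end

theory Submission
  imports Defs "HOL-Computational_Algebra.Polynomial" "HOL-Library.FuncSet"
begin

text \<open>The polynomials of multidegree \<open>E\<close> (degree \<open>E i\<close> in the pair \<open>x\<^sub>i, y\<^sub>i\<close>) form the
  representation \<open>\<Otimes>\<^sub>i V\<^bsub>E i + 1\<^esub>\<close>. Let all \<open>E i < p\<close> and let \<open>f\<close> be an invariant of multidegree
  \<open>E\<close> involving only \<open>y\<^sub>1, \<dots>, y\<^sub>r\<close>, of degree \<open>B\<close> in \<open>y\<^sub>r\<close>. Its top coefficient \<open>w\<close> with respect to
  \<open>y\<^sub>r\<close> is an invariant in fewer variables, it determines the remaining exponents of \<open>LM f\<close>, and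
  comparing the actions of \<open>\<sigma>\<close> on \<open>y\<^sub>r\<close> and on \<open>y\<^sub>1, \<dots>, y\<^bsub>r-1\<^esub>\<close> shows that \<open>w\<close> lies in the image of
  \<open>(\<sigma> - 1)\<^sup>B\<close>. Induction on \<open>r\<close>, keeping track of the largest \<open>k\<close> such that \<open>f\<close> lies in the image of
  \<open>(\<sigma> - 1)\<^sup>k\<close>, bounds the \<open>y\<close>-exponents of \<open>LM f\<close> by a ballot condition truncated at \<open>p - 1\<close>, and
  the monomials satisfying it are products of lead monomials of the \<open>x\<^sub>i\<close>, \<open>u\<^bsub>ij\<^esub>\<close> and \<open>Tr(y\<^sup>E)\<close>.
  Division by \<open>N(y\<^sub>i)\<close> reduces the case \<open>E i \<ge> p\<close> to smaller degrees. This gives the SAGBI property,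
  and generation follows by subduction. For minimality, each generator has a monomial outside a
  submonoid that contains all monomials of the other generators.\<close>

section \<open>Polynomials as poly mappings\<close>

text \<open>Invariance alone puts w into the image of a B-th power, which bounds B but gives no hold
  on the next variable. So the depth k of f must be passed on to w. Let delta = sigma - 1, let sigma
  = sigma' sigma_r with sigma' acting on the earlier y's, and delta' = sigma' - 1. Then delta =
  delta' + U, where U = sigma' (sigma_r - 1) commutes with delta' and U^(E_r + 1) = 0. A Lagrange
  relation among the operators delta'^(n-d) delta^d, at well chosen d, puts w into the image of
  delta'^(k + 2B - E_r) when E_r <= k + B < p. If a is the exponent of x_r in the lead monomial and
  l the level before r, then E_r = a + B and induction gives k + B - a <= l, that is k <= l + a - B:
  factors x raise the level, factors y lower it. The cap p - 1 comes from delta^p = 0. The bound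
  2(p-1) arises as follows: a trace has only monomials of x-degree at least p - 1, and a monomial
  that breaks the ballot condition after the cap is reached keeps more than p - 1 factors y when its
  surplus factors x are divided out.\<close>

abbreviation lookup where "lookup \<equiv> Poly_Mapping.lookup"
abbreviation keys where "keys \<equiv> Poly_Mapping.keys"
abbreviation single where "single \<equiv> Poly_Mapping.single"

text \<open>Exponents are natural numbers, so nothing cancels.\<close>

lemma keys_add_eq: "keys (s + t) = keys s \<union> keys t" for s t :: mon
  by (auto simp: in_keys_iff lookup_add)

lemma eq_sum_single: "f = (\<Sum>t\<in>keys f. single t (lookup f t))"
proof (rule poly_mapping_eqI)
  fix s
  have "lookup (\<Sum>t\<in>keys f. single t (lookup f t)) s
      = (\<Sum>t\<in>keys f. if t = s then lookup f t else 0)"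
    by (simp add: lookup_sum lookup_single when_def)
  then show "lookup f s = lookup (\<Sum>t\<in>keys f. single t (lookup f t)) s"
    by (simp add: in_keys_iff)
qed

lemma mpoly_induct [case_names single add]:
  fixes f :: "'a::field mpoly"
  assumes "\<And>t c. P (single t c)" and "\<And>f g. P f \<Longrightarrow> P g \<Longrightarrow> P (f + g)"
  shows "P f"
proof -
  have "P (\<Sum>t\<in>A. single t (lookup f t))" if "finite A" for A
    using that
  proof induction
    case empty
    show ?case using assms(1)[of 0 0] by simp
  qed (simp add: assms)
  from this[of "keys f"] show ?thesis by (simp flip: eq_sum_single)
qed

lemma mon_induct [case_names zero add]:
  fixes t :: mon
  assumes "P 0" and step: "\<And>t v. P t \<Longrightarrow> P (t + single v 1)"
  shows "P t"
proof -
  have add: "P s \<Longrightarrow> P (s + single v n)" for s v n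
  proof (induction n)
    case (Suc n)
    have "s + single v (Suc n) = (s + single v n) + single v 1"
      by (simp add: add.assoc flip: single_add)
    then show ?case using step Suc by metis
  qed simp
  have "P (\<Sum>v\<in>A. single v (lookup t v))" if "finite A" for A
    using that
  proof induction
    case (insert v A)
    then show ?case using add by (metis sum.insert add.commute)
  qed (simp add: assms(1))
  from this[of "keys t"] show ?thesis by (simp flip: eq_sum_single)
qed

lemma const_0 [simp]: "const 0 = 0" and const_1 [simp]: "const 1 = 1"
  and const_add: "const (a + b) = const a + const b"
  and const_mult: "const (a * b) = const a * const b"
  and const_uminus: "const (- a) = - const a"
  by (simp_all add: const_def single_add mult_single single_uminus)

lemma const_times_single [simp]: "const c * single t d = single t (c * d)"
  by (simp add: const_def mult_single)

lemma lookup_const_times [simp]: "lookup (const c * f) t = c * lookup f t"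
  by (induction f rule: mpoly_induct)
    (simp_all add: lookup_single distrib_left lookup_add when_def)

lemma const_of_nat: "const (of_nat n) = of_nat n"
  by (simp add: const_def)

lemma of_nat_times_single: "of_nat n * single t d = single t (of_nat n * d)"
  for t :: mon and d :: "'a::field"
  by (simp only: const_times_single flip: const_of_nat)

lemma CHAR_mpoly: "of_nat CHAR('a) = (0 :: 'a::field mpoly)"
  by (simp only: of_nat_CHAR const_0 flip: const_of_nat)

lemma var_poly_power: "(var_poly v :: 'a::field mpoly) ^ n = single (single v n) 1"
  by (induction n) (simp_all add: var_poly_def mult_single flip: single_add)

lemma single_eq_times: "single (t + s) c = single t c * single s (1::'a::field)"
  by (simp add: mult_single)


section \<open>Algebra endomorphisms and substitution\<close>

locale alg_hom =
  fixes \<phi> :: "'a::field mpoly \<Rightarrow> 'a mpoly"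
  assumes add: "\<phi> (f + g) = \<phi> f + \<phi> g"
    and mult: "\<phi> (f * g) = \<phi> f * \<phi> g"
    and const [simp]: "\<phi> (const c) = const c"
begin

lemma zero [simp]: "\<phi> 0 = 0" and one [simp]: "\<phi> 1 = 1"
  using const[of 0] const[of 1] by simp_all

lemma uminus: "\<phi> (- f) = - \<phi> f"
  using mult[of "const (- 1)" f] const[of "- 1"] by (simp add: const_uminus)

lemma diff: "\<phi> (f - g) = \<phi> f - \<phi> g"
  using add[of f "- g"] by (simp add: uminus)

lemma sum: "\<phi> (sum h A) = (\<Sum>a\<in>A. \<phi> (h a))"
  by (induction A rule: infinite_finite_induct) (simp_all add: add)

lemma prod: "\<phi> (prod h A) = (\<Prod>a\<in>A. \<phi> (h a))"
  by (induction A rule: infinite_finite_induct) (simp_all add: mult)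

lemma power: "\<phi> (f ^ n) = \<phi> f ^ n"
  by (induction n) (simp_all add: mult)

lemma of_nat [simp]: "\<phi> (of_nat n) = of_nat n"
  using const[of "of_nat n"] by (simp only: const_of_nat)

end

lemma alg_hom_eqI:
  fixes \<phi> \<psi> :: "'a::field mpoly \<Rightarrow> 'a mpoly"
  assumes "alg_hom \<phi>" "alg_hom \<psi>" and var: "\<And>v. \<phi> (var_poly v) = \<psi> (var_poly v)"
  shows "\<phi> f = \<psi> f"
proof -
  interpret \<phi>: alg_hom \<phi> by fact
  interpret \<psi>: alg_hom \<psi> by fact
  have mon: "\<phi> (single t 1) = \<psi> (single t 1)" for t
  proof (induction t rule: mon_induct)
    case (add t v)
    then show ?case
      using var[of v] by (simp add: single_eq_times \<phi>.mult \<psi>.mult var_poly_def)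
  qed simp
  show ?thesis
  proof (induction f rule: mpoly_induct)
    case (single t c)
    have "single t c = const c * single t 1" by simp
    then show ?case by (simp only: \<phi>.mult \<psi>.mult \<phi>.const \<psi>.const mon)
  qed (simp add: \<phi>.add \<psi>.add)
qed

lemma alg_hom_comp: "alg_hom \<phi> \<Longrightarrow> alg_hom \<psi> \<Longrightarrow> alg_hom (\<lambda>f. \<phi> (\<psi> f))"
  by (simp add: alg_hom_def)

lemma alg_hom_id: "alg_hom (\<lambda>f. f)"
  by (simp add: alg_hom_def)

lemma subst_eq_sum:
  assumes "finite A" "keys f \<subseteq> A"
  shows "subst s f = (\<Sum>t\<in>A. const (lookup f t) * (\<Prod>v\<in>keys t. s v ^ lookup t v))"
  unfolding subst_def using assms
  by (intro sum.mono_neutral_left) (auto simp: in_keys_iff)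

lemma subst_add: "subst s (f + g) = subst s f + subst s g"
proof -
  let ?A = "keys f \<union> keys g"
  have "keys (f + g) \<subseteq> ?A" by (rule keys_add)
  then show ?thesis
    by (simp add: subst_eq_sum[of ?A] lookup_add const_add distrib_right sum.distrib)
qed

lemma subst_single:
  "subst s (single t c) = const c * (\<Prod>v\<in>keys t. s v ^ lookup t v)"
  by (simp add: subst_def)

lemma prod_keys_add:
  fixes s :: "var \<Rightarrow> 'a::field mpoly" and a b :: mon
  shows "(\<Prod>v\<in>keys (a + b). s v ^ lookup (a + b) v)
       = (\<Prod>v\<in>keys a. s v ^ lookup a v) * (\<Prod>v\<in>keys b. s v ^ lookup b v)"
proof -
  have *: "(\<Prod>v\<in>keys t. s v ^ lookup t v) = (\<Prod>v\<in>keys (a + b). s v ^ lookup t v)"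
    if "keys t \<subseteq> keys (a + b)" for t
    using that by (intro prod.mono_neutral_left) (auto simp: in_keys_iff)
  show ?thesis
    by (subst (2 3) *) (simp_all add: keys_add_eq lookup_add power_add prod.distrib)
qed

lemma subst_mult: "subst s (f * g) = subst s f * subst s g"
proof (induction f rule: mpoly_induct)
  case (single t c)
  show ?case
    by (induction g rule: mpoly_induct)
      (simp_all add: mult_single subst_single prod_keys_add const_mult subst_add algebra_simps)
qed (simp add: distrib_right subst_add)

lemma alg_hom_subst: "alg_hom (subst s)"
  by unfold_locales (simp_all add: subst_add subst_mult const_def subst_single mult_single)

interpretation subst: alg_hom "subst s" for s
  by (rule alg_hom_subst)

lemma subst_var [simp]: "subst s (var_poly v) = s v"
  by (simp add: var_poly_def subst_single)

lemma subst_cong: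
  assumes "\<And>t v. t \<in> keys f \<Longrightarrow> v \<in> keys t \<Longrightarrow> s v = s' v"
  shows "subst s f = subst s' f"
  unfolding subst_def using assms by (intro sum.cong prod.cong arg_cong2[of _ _ _ _ times]) auto

lemma subst_id: "subst var_poly f = f"
  by (rule alg_hom_eqI[OF alg_hom_subst alg_hom_id]) simp


section \<open>Shifts\<close>

text \<open>Every index has its own parameter because the proof compares sigma with its restrictions
  to some of the y_i. These restrictions and the powers of sigma are all shifts, and shifts
  commute.\<close>

definition shift :: "(nat \<Rightarrow> 'a) \<Rightarrow> 'a::field mpoly \<Rightarrow> 'a mpoly" where
  "shift c = subst (\<lambda>v. case v of X i \<Rightarrow> xv i | Y i \<Rightarrow> yv i + const (c i) * xv i)"

interpretation shift: alg_hom "shift c" for c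
  unfolding shift_def by (rule alg_hom_subst)

lemma shift_var [simp]: "shift c (xv i) = xv i" "shift c (yv i) = yv i + const (c i) * xv i"
  by (simp_all add: shift_def)

lemma shift_shift: "shift c (shift d f) = shift (\<lambda>i. c i + d i) f"
proof (rule alg_hom_eqI[where \<phi> = "\<lambda>f. shift c (shift d f)"])
  show "shift c (shift d (var_poly v)) = shift (\<lambda>i. c i + d i) (var_poly v)" for v
    by (cases v) (simp_all add: shift.add shift.mult const_add algebra_simps)
qed (rule alg_hom_comp[OF shift.alg_hom_axioms shift.alg_hom_axioms] shift.alg_hom_axioms)+

lemma shift_commute: "shift c (shift d f) = shift d (shift c f)"
  by (simp add: shift_shift add.commute)

lemma shift_0 [simp]: "shift (\<lambda>_. 0) f = f"
proof (rule alg_hom_eqI[where \<psi> = "\<lambda>f. f"])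
  show "shift (\<lambda>_. 0) (var_poly v) = var_poly v" for v :: var
    by (cases v) simp_all
qed (rule shift.alg_hom_axioms alg_hom_id)+

lemma shift_funpow: "(shift c ^^ k) f = shift (\<lambda>i. of_nat k * c i) f"
  by (induction k) (simp_all add: shift_shift distrib_right)

lemma \<sigma>_eq_shift: "\<sigma> = shift (\<lambda>_. 1)"
  by (auto simp: \<sigma>_def shift_def intro!: arg_cong[of _ _ subst] split: var.splits)

interpretation \<sigma>: alg_hom \<sigma>
  unfolding \<sigma>_eq_shift by (rule shift.alg_hom_axioms)

lemma \<sigma>_funpow: "(\<sigma> ^^ k) f = shift (\<lambda>_. of_nat k) f"
  by (simp add: \<sigma>_eq_shift shift_funpow)

lemma \<sigma>_funpow_CHAR: "(\<sigma> ^^ CHAR('a)) f = (f :: 'a::field mpoly)"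
  by (simp add: \<sigma>_funpow)


section \<open>Subalgebras cut out by monomials\<close>

lemma subalgebra_const: "subalgebra A \<Longrightarrow> const c \<in> A"
  and subalgebra_add: "subalgebra A \<Longrightarrow> f \<in> A \<Longrightarrow> g \<in> A \<Longrightarrow> f + g \<in> A"
  and subalgebra_mult: "subalgebra A \<Longrightarrow> f \<in> A \<Longrightarrow> g \<in> A \<Longrightarrow> f * g \<in> A"
  by (auto simp: subalgebra_def)

lemma subalgebra_0: "subalgebra A \<Longrightarrow> 0 \<in> A" and subalgebra_1: "subalgebra A \<Longrightarrow> 1 \<in> A"
  using subalgebra_const[of A 0] subalgebra_const[of A 1] by simp_all

lemma subalgebra_diff:
  assumes "subalgebra A" "f \<in> A" "g \<in> A"
  shows "f - g \<in> A"
proof -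
  have "f + const (- 1) * g \<in> A"
    using assms by (intro subalgebra_add subalgebra_mult subalgebra_const)
  then show ?thesis by (simp add: const_uminus)
qed

lemma subalgebra_sum: "subalgebra A \<Longrightarrow> (\<And>i. i \<in> I \<Longrightarrow> h i \<in> A) \<Longrightarrow> sum h I \<in> A"
  by (induction I rule: infinite_finite_induct) (auto intro: subalgebra_0 subalgebra_add)

lemma subalgebra_prod: "subalgebra A \<Longrightarrow> (\<And>i. i \<in> I \<Longrightarrow> h i \<in> A) \<Longrightarrow> prod h I \<in> A"
  by (induction I rule: infinite_finite_induct) (auto intro: subalgebra_1 subalgebra_mult)

lemma subalgebra_power: "subalgebra A \<Longrightarrow> f \<in> A \<Longrightarrow> f ^ n \<in> A"
  by (induction n) (auto intro: subalgebra_1 subalgebra_mult)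

text \<open>Serves twice: with \<open>G\<close> the monomials in given variables it yields
  polynomial subrings, and with other submonoids it separates one generator from the rest.\<close>

lemma subalgebra_keys:
  fixes G :: "mon set"
  assumes "0 \<in> G" and "\<And>s t. s \<in> G \<Longrightarrow> t \<in> G \<Longrightarrow> s + t \<in> G"
  shows "subalgebra {f :: 'a::field mpoly. keys f \<subseteq> G}"
  unfolding subalgebra_def
proof (intro conjI ballI)
  show "range const \<subseteq> {f :: 'a mpoly. keys f \<subseteq> G}"
    using assms(1) by (auto simp: const_def split: if_splits)
  fix f g :: "'a mpoly" assume "f \<in> {f. keys f \<subseteq> G}" "g \<in> {f. keys f \<subseteq> G}"
  then show "f + g \<in> {f. keys f \<subseteq> G}" "f * g \<in> {f. keys f \<subseteq> G}"
    using keys_add[of f g] by (auto dest!: subsetD[OF keys_mult] intro: assms(2))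
qed

definition polys_in :: "var set \<Rightarrow> 'a::field mpoly set" where
  "polys_in W = {f. \<forall>t\<in>keys f. keys t \<subseteq> W}"

lemma polys_in_eq: "polys_in W = {f. keys f \<subseteq> {t. keys t \<subseteq> W}}"
  by (auto simp: polys_in_def)

lemma subalgebra_polys_in: "subalgebra (polys_in W)"
  unfolding polys_in_eq by (rule subalgebra_keys) (auto simp: keys_add_eq)

lemma F_mV2_eq: "F_mV2 m = polys_in (X ` {1..m} \<union> Y ` {1..m})"
  by (simp add: F_mV2_def polys_in_def)

lemma subalgebra_F_mV2: "subalgebra (F_mV2 m)"
  by (simp add: F_mV2_eq subalgebra_polys_in)

lemma var_poly_in_polys_in [simp]: "var_poly v \<in> (polys_in W :: 'a::field mpoly set) \<longleftrightarrow> v \<in> W"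
  by (simp add: polys_in_def var_poly_def)

lemma subst_in_subalgebra:
  assumes "subalgebra A" "f \<in> polys_in W" "\<And>v. v \<in> W \<Longrightarrow> s v \<in> A"
  shows "subst s f \<in> A"
  unfolding subst_def using assms
  by (intro subalgebra_sum subalgebra_mult subalgebra_prod subalgebra_power subalgebra_const)
    (auto simp: polys_in_def)

lemma shift_in_polys_in:
  assumes "f \<in> polys_in W" "\<And>j. Y j \<in> W \<Longrightarrow> X j \<in> W"
  shows "shift c f \<in> polys_in W"
  unfolding shift_def
proof (rule subst_in_subalgebra[OF subalgebra_polys_in assms(1)])
  fix v assume "v \<in> W"
  then show "(case v of X i \<Rightarrow> xv i | Y i \<Rightarrow> yv i + const (c i) * xv i) \<in> polys_in W"
    by (cases v) (auto intro!: subalgebra_add subalgebra_mult subalgebra_polys_in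
        subalgebra_const assms(2))
qed

lemma shift_in_F_mV2: "f \<in> F_mV2 m \<Longrightarrow> shift c f \<in> F_mV2 m"
  unfolding F_mV2_eq by (rule shift_in_polys_in) auto


section \<open>Multidegrees\<close>

definition mdeg :: "mon \<Rightarrow> nat \<Rightarrow> nat" where
  "mdeg t i = lookup t (X i) + lookup t (Y i)"

definition mhom :: "(nat \<Rightarrow> nat) \<Rightarrow> 'a::field mpoly set" where
  "mhom E = {f. \<forall>t\<in>keys f. mdeg t = E}"

lemma mdeg_0 [simp]: "mdeg 0 = (\<lambda>_. 0)"
  by (auto simp: mdeg_def)

lemma mdeg_add: "mdeg (s + t) = (\<lambda>i. mdeg s i + mdeg t i)"
  by (auto simp: mdeg_def lookup_add)

lemma mdeg_single: "mdeg (single (X i) n) = (\<lambda>j. if j = i then n else 0)"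
    "mdeg (single (Y i) n) = (\<lambda>j. if j = i then n else 0)"
  by (auto simp: mdeg_def lookup_single when_def)

lemma mhom_0 [simp]: "0 \<in> mhom E"
  by (simp add: mhom_def)

lemma mhom_add: "f \<in> mhom E \<Longrightarrow> g \<in> mhom E \<Longrightarrow> f + g \<in> mhom E"
  using keys_add[of f g] by (auto simp: mhom_def)

lemma mhom_uminus: "f \<in> mhom E \<Longrightarrow> - f \<in> mhom E"
  by (simp add: mhom_def in_keys_iff)

lemma mhom_diff: "f \<in> mhom E \<Longrightarrow> g \<in> mhom E \<Longrightarrow> f - g \<in> mhom E"
  using mhom_add[of f E "- g"] by (simp add: mhom_uminus)

lemma mhom_sum: "(\<And>i. i \<in> I \<Longrightarrow> h i \<in> mhom E) \<Longrightarrow> sum h I \<in> mhom E"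
  by (induction I rule: infinite_finite_induct) (auto intro: mhom_add)

lemma mhom_mult: "f \<in> mhom E \<Longrightarrow> g \<in> mhom E' \<Longrightarrow> f * g \<in> mhom (\<lambda>i. E i + E' i)"
  using keys_mult[of f g] by (fastforce simp: mhom_def mdeg_add)

lemma mhom_1 [simp]: "1 \<in> mhom (\<lambda>_. 0)"
  by (auto simp: mhom_def)

lemma mhom_const [simp]: "const c \<in> mhom (\<lambda>_. 0)"
  by (auto simp: mhom_def const_def)

lemma mhom_const_mult: "f \<in> mhom E \<Longrightarrow> const c * f \<in> mhom E"
  using mhom_mult[OF mhom_const, of f E c] by simp

lemma mhom_prod:
  "(\<And>i. i \<in> I \<Longrightarrow> h i \<in> mhom (D i)) \<Longrightarrow> prod h I \<in> mhom (\<lambda>j. \<Sum>i\<in>I. D i j)"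
  by (induction I rule: infinite_finite_induct) (auto intro: mhom_mult)

lemma mhom_single: "single t c \<in> mhom (mdeg t)"
  by (simp add: mhom_def)

lemma mhom_var: "var_poly v \<in> mhom (mdeg (single v 1))"
  by (simp add: var_poly_def mhom_single)

text \<open>Both terms of y_i + c x_i have the multidegree of y_i, so the substitution respects
  multidegrees and the study of invariants can proceed one multidegree at a time.\<close>

lemma mhom_shift_single: "shift c (single t a) \<in> mhom (mdeg t)"
proof -
  have "shift c (single t 1) \<in> mhom (mdeg t)"
  proof (induction t rule: mon_induct)
    case (add t v)
    have "shift c (var_poly v) \<in> mhom (mdeg (single v 1))"
    proof (cases v)
      case (X i)
      then show ?thesis by (simp only: shift_var mhom_var)
    next
      case (Y i)
      have "xv i \<in> mhom (mdeg (single (Y i) 1))"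
        using mhom_var[of "X i"] by (simp add: mdeg_single)
      then show ?thesis
        unfolding Y shift_var by (intro mhom_add mhom_var mhom_const_mult)
    qed
    then show ?case
      using mhom_mult[OF add] by (simp add: single_eq_times shift.mult mdeg_add var_poly_def)
  qed simp
  then have "const a * shift c (single t 1) \<in> mhom (mdeg t)" by (rule mhom_const_mult)
  moreover have "const a * shift c (single t 1) = shift c (const a * single t 1)"
    by (simp only: shift.mult shift.const)
  ultimately show ?thesis by simp
qed

lemma mhom_shift:
  assumes "f \<in> mhom E" shows "shift c f \<in> mhom E"
proof -
  have "shift c (\<Sum>t\<in>keys f. single t (lookup f t)) \<in> mhom E"
    unfolding shift.sum
  proof (rule mhom_sum)
    fix t assume "t \<in> keys f"
    then have "mdeg t = E" using assms by (simp add: mhom_def)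
    then show "shift c (single t (lookup f t)) \<in> mhom E" using mhom_shift_single by blast
  qed
  then show ?thesis by (simp flip: eq_sum_single)
qed

section \<open>Linear operators\<close>

locale linear_op =
  fixes F :: "'a::field mpoly \<Rightarrow> 'a mpoly"
  assumes add: "F (f + g) = F f + F g"
    and scale: "F (const c * f) = const c * F f"
begin

lemma zero [simp]: "F 0 = 0"
  using scale[of 0 0] by simp

lemma sum: "F (sum h A) = (\<Sum>a\<in>A. F (h a))"
  by (induction A rule: infinite_finite_induct) (simp_all add: add)

lemma of_nat_mult: "F (of_nat n * f) = of_nat n * F f"
  by (simp only: scale flip: const_of_nat)

lemma uminus: "F (- f) = - F f"
  using scale[of "- 1" f] by (simp add: const_uminus)

lemma diff: "F (f - g) = F f - F g"
  using add[of f "- g"] by (simp add: uminus)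

lemma linear_op_funpow: "linear_op (F ^^ n)"
proof (induction n)
  case (Suc n)
  then interpret F': linear_op "F ^^ n" .
  show ?case by unfold_locales (simp_all add: F'.add F'.scale add scale)
qed (simp add: linear_op_def)

end

lemma (in alg_hom) linear_op: "linear_op \<phi>"
  by unfold_locales (simp_all add: add mult)

lemma linear_op_diff: "linear_op F \<Longrightarrow> linear_op G \<Longrightarrow> linear_op (\<lambda>f. F f - G f)"
  by (simp add: linear_op_def algebra_simps)

lemma linear_op_comp: "linear_op F \<Longrightarrow> linear_op G \<Longrightarrow> linear_op (\<lambda>f. F (G f))"
  by (simp add: linear_op_def)

lemma linear_op_id: "linear_op (\<lambda>f. f)"
  by (simp add: linear_op_def)

lemma linear_op_uminus: "linear_op uminus"
  by (simp add: linear_op_def)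

section \<open>Binomial expansion and Lagrange relations for powers of commuting operators\<close>

lemma funpow_commute:
  assumes "\<And>f. F (G f) = G (F f)"
  shows "(F ^^ i) ((G ^^ j) f) = (G ^^ j) ((F ^^ i) f)"
proof -
  have 1: "F ((G ^^ j) g) = (G ^^ j) (F g)" for g
    by (induction j) (simp_all add: assms)
  show ?thesis
    by (induction i) (simp_all add: 1)
qed

text \<open>The binomial theorem for commuting operators. It is applied to the splitting of
  \<open>delta (Suc r)\<close> into \<open>delta r\<close> and a part acting on y_r, and to
  \<open>delta r\<close> as a shift minus the identity.\<close>

lemma op_binomial:
  fixes D \<Delta> U :: "'a::field mpoly \<Rightarrow> 'a mpoly"
  assumes "linear_op \<Delta>" "linear_op U"
    and D: "\<And>f. D f = \<Delta> f + U f" and comm: "\<And>f. \<Delta> (U f) = U (\<Delta> f)"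
  shows "(D ^^ d) f = (\<Sum>j\<le>d. of_nat (d choose j) * (\<Delta> ^^ (d - j)) ((U ^^ j) f))"
proof (induction d)
  case (Suc d)
  interpret \<Delta>: linear_op \<Delta> by fact
  interpret U: linear_op U by fact
  define A where "A i j = (\<Delta> ^^ i) ((U ^^ j) f)" for i j
  have \<Delta>A: "\<Delta> (A i j) = A (Suc i) j" for i j by (simp add: A_def)
  have UA: "U (A i j) = A i (Suc j)" for i j
    using funpow_commute[of \<Delta> U, OF comm, where j = 1 and i = i] by (simp add: A_def)
  have IH: "(D ^^ d) f = (\<Sum>j\<le>d. of_nat (d choose j) * A (d - j) j)"
    using Suc by (simp add: A_def)
  have "(D ^^ Suc d) f = (\<Sum>j\<le>d. of_nat (d choose j) * A (Suc (d - j)) j)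
      + (\<Sum>j\<le>d. of_nat (d choose j) * A (d - j) (Suc j))"
    by (simp add: IH D \<Delta>.sum U.sum \<Delta>.of_nat_mult U.of_nat_mult \<Delta>A UA)
  also have "(\<Sum>j\<le>d. of_nat (d choose j) * A (Suc (d - j)) j)
      = (\<Sum>j\<le>Suc d. of_nat (d choose j) * A (Suc d - j) j)"
    by (simp add: Suc_diff_le binomial_eq_0)
  also have "\<dots> = A (Suc d) 0 + (\<Sum>j\<le>d. of_nat (d choose Suc j) * A (d - j) (Suc j))"
    by (subst sum.atMost_Suc_shift) (simp add: binomial_eq_0)
  also have "\<dots> + (\<Sum>j\<le>d. of_nat (d choose j) * A (d - j) (Suc j))
      = A (Suc d) 0 + (\<Sum>j\<le>d. of_nat (Suc d choose Suc j) * A (d - j) (Suc j))"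
    by (simp add: distrib_right sum.distrib add_ac)
  also have "\<dots> = (\<Sum>j\<le>Suc d. of_nat (Suc d choose j) * A (Suc d - j) j)"
    by (subst sum.atMost_Suc_shift) simp
  finally show ?case by (simp only: A_def)
qed simp

text \<open>By its degree, \<open>q\<close> equals its own interpolation polynomial on
  \<open>S\<close>; the sum is the coefficient of that polynomial in degree card S - 1, which
  exceeds the degree of \<open>q\<close>.\<close>

lemma lagrange_sum_eq_0:
  fixes S :: "'a::field set"
  assumes "finite S" "degree q + 1 < card S"
  shows "(\<Sum>d\<in>S. poly q d / (\<Prod>d'\<in>S - {d}. d - d')) = 0"
proof -
  define c where "c d = poly q d / (\<Prod>d'\<in>S - {d}. d - d')" for d
  define b where "b d = (\<Prod>d'\<in>S - {d}. [:- d', 1:])" for d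
  define L where "L = (\<Sum>d\<in>S. smult (c d) (b d))"
  have deg_b: "degree (b d) = card S - 1" if "d \<in> S" for d
    unfolding b_def using assms(1) that by (subst degree_prod_eq_sum_degree) auto
  have lead_b: "coeff (b d) (card S - 1) = 1" if "d \<in> S" for d
    using lead_coeff_prod[of "\<lambda>d'. [:- d', 1:]" "S - {d}"] deg_b[OF that] by (simp add: b_def)
  have "degree L \<le> card S - 1"
    unfolding L_def using deg_b assms(1)
    by (intro degree_sum_le) (auto intro: order_trans[OF degree_smult_le])
  moreover have "card S > 0" using assms(2) by simp
  ultimately have "card S > degree L" by linarith
  have "poly L s = poly q s" if s: "s \<in> S" for s
  proof -
    have *: "poly (b d) s = 0" if "d \<in> S" "d \<noteq> s" for d
      using that s assms(1) by (auto simp: b_def poly_prod)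
    have "poly L s = c s * poly (b s) s"
      unfolding L_def poly_sum using assms(1) s * by (subst sum.remove[of _ s]) auto
    also have "poly (b s) s = (\<Prod>d'\<in>S - {s}. s - d')" by (simp add: b_def poly_prod)
    also have "c s * \<dots> = poly q s" using assms(1) by (simp add: c_def)
    finally show ?thesis .
  qed
  then have "L = q"
    using \<open>card S > degree L\<close> assms(2) by (intro poly_eqI_degree[of S]) auto
  then have "coeff L (card S - 1) = 0"
    using assms(2) by (simp add: coeff_eq_0)
  moreover have "coeff L (card S - 1) = (\<Sum>d\<in>S. c d)"
    unfolding L_def coeff_sum by (intro sum.cong refl) (simp only: coeff_smult lead_b mult_1_right)
  ultimately show ?thesis by (simp add: c_def)
qed

lemma Suc_times_binomial_Suc: "Suc j * (d choose Suc j) = (d - j) * (d choose j)"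
proof (cases d)
  case (Suc n)
  then show ?thesis
    using binomial_absorb_comp[of d j] by (simp only: Suc_times_binomial Suc diff_Suc_1)
qed simp

text \<open>Exhibits d choose j, up to the factor j!, as a polynomial of degree j in d, which is
  what interpolation can annihilate.\<close>

lemma falling_factorial_eq:
  "(\<Prod>i<j. of_nat d - of_nat i) = (of_nat (fact j * (d choose j)) :: 'a::comm_ring_1)"
proof (induction j)
  case (Suc j)
  have "(of_nat (d choose j) * (of_nat d - of_nat j) :: 'a) = of_nat ((d - j) * (d choose j))"
    by (cases "j \<le> d") (auto simp: of_nat_diff binomial_eq_0 algebra_simps)
  also have "\<dots> = of_nat (Suc j * (d choose Suc j))"
    by (simp only: Suc_times_binomial_Suc)
  finally show ?case by (simp add: Suc algebra_simps)
qed simp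

lemma of_nat_fact_neq_0:
  assumes "prime CHAR('a::field)" "n < CHAR('a)"
  shows "of_nat (fact n) \<noteq> (0 :: 'a)"
  using assms by (simp add: of_nat_eq_0_iff_char_dvd prime_dvd_fact_iff not_le del: of_nat_fact)

text \<open>Keeps the interpolation nodes distinct in the field.\<close>

lemma of_nat_inj_on_CHAR: "inj_on (of_nat :: nat \<Rightarrow> 'a::field) {..<CHAR('a)}"
proof (rule linorder_inj_onI')
  fix i j assume "i \<in> {..<CHAR('a)}" "j \<in> {..<CHAR('a)}" "i < j"
  then have "\<not> CHAR('a) dvd j - i" by (simp add: nat_dvd_not_less)
  then have "of_nat (j - i) \<noteq> (0 :: 'a)" by (simp only: of_nat_eq_0_iff_char_dvd not_False_eq_True)
  then show "of_nat i \<noteq> (of_nat j :: 'a)" using \<open>i < j\<close> by (simp add: of_nat_diff)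
qed

text \<open>The coefficients are the Lagrange coefficients: they annihilate all polynomials of
  degree at most \<open>e\<close> in \<open>d\<close>, in particular the binomial coefficients \<open>d choose j\<close>, \<open>j \<le> e\<close>.\<close>

lemma op_relation:
  fixes D \<Delta> U :: "'a::field mpoly \<Rightarrow> 'a mpoly"
  assumes lin: "linear_op \<Delta>" "linear_op U"
    and D: "\<And>f. D f = \<Delta> f + U f" and comm: "\<And>f. \<Delta> (U f) = U (\<Delta> f)"
    and nil: "\<And>j. j > e \<Longrightarrow> (U ^^ j) h = 0"
    and p: "prime CHAR('a)" and S: "S \<subseteq> {..<CHAR('a)}" "e + 1 < card S"
    and n: "\<And>d. d \<in> S \<Longrightarrow> d \<le> n"
  shows "\<exists>c. (\<forall>d\<in>S. c d \<noteq> 0) \<and> (\<Sum>d\<in>S. const (c d) * (\<Delta> ^^ (n - d)) ((D ^^ d) h)) = 0"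
proof -
  have fin: "finite S" using S(1) finite_subset by blast
  have inj: "inj_on (of_nat :: nat \<Rightarrow> 'a) S" using of_nat_inj_on_CHAR S(1) by (rule inj_on_subset)
  \<comment> \<open>At least e + 2 nodes fit below p, so every j! with j <= e is invertible.\<close>
  have "e < CHAR('a)" using S card_mono[OF _ S(1)] by simp
  define c :: "nat \<Rightarrow> 'a" where "c d = 1 / (\<Prod>d'\<in>of_nat ` S - {of_nat d}. of_nat d - d')" for d
  have c: "c d \<noteq> 0" for d using fin by (simp add: c_def)
  have ann: "(\<Sum>d\<in>S. c d * of_nat (d choose j)) = 0" if "j \<le> e" for j
  proof -
    define q :: "'a poly" where "q = (\<Prod>i<j. [:- of_nat i, 1:])"
    have "degree q \<le> j"
      unfolding q_def by (rule order_trans[OF degree_prod_sum_le]) auto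
    then have "degree q + 1 < card (of_nat ` S :: 'a set)"
      using S(2) that by (simp add: card_image[OF inj])
    from lagrange_sum_eq_0[OF _ this] have "(\<Sum>d\<in>S. c d * poly q (of_nat d)) = 0"
      using fin by (simp add: sum.reindex[OF inj] c_def)
    moreover have "poly q (of_nat d) = of_nat (fact j) * of_nat (d choose j)" for d
      using falling_factorial_eq[of d j, where 'a = 'a] by (simp add: q_def poly_prod)
    ultimately have "of_nat (fact j) * (\<Sum>d\<in>S. c d * of_nat (d choose j)) = 0"
      by (simp add: sum_distrib_left mult_ac del: of_nat_fact)
    then show ?thesis
      using of_nat_fact_neq_0[OF p, of j] that \<open>e < CHAR('a)\<close> by (simp del: of_nat_fact)
  qed
  \<comment> \<open>The missing power of \<open>\<Delta>\<close> brings all d to the same operators,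
    so that d survives only in binomial coefficients, which \<open>ann\<close> kills. Terms with j >
    d vanish by the binomial coefficient and those with j > e by \<open>nil\<close>; hence the
    truncated n - j does no harm.\<close>
  have termwise: "(\<Delta> ^^ (n - d)) ((D ^^ d) h)
      = (\<Sum>j\<le>e. of_nat (d choose j) * (\<Delta> ^^ (n - j)) ((U ^^ j) h))" if "d \<in> S" for d
  proof -
    interpret \<Delta>p: linear_op "\<Delta> ^^ (n - d)" using lin(1) by (rule linear_op.linear_op_funpow)
    have "(\<Delta> ^^ (n - d)) ((D ^^ d) h)
        = (\<Sum>j\<le>d. of_nat (d choose j) * (\<Delta> ^^ (n - d)) ((\<Delta> ^^ (d - j)) ((U ^^ j) h)))"
      by (simp only: op_binomial[of \<Delta> U D, OF lin D comm] \<Delta>p.sum \<Delta>p.of_nat_mult)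
    also have "\<dots> = (\<Sum>j\<le>d. of_nat (d choose j) * (\<Delta> ^^ (n - j)) ((U ^^ j) h))"
    proof (intro sum.cong refl)
      fix j assume "j \<in> {..d}"
      then have "n - j = (n - d) + (d - j)" using n[OF that] by simp
      then show "of_nat (d choose j) * (\<Delta> ^^ (n - d)) ((\<Delta> ^^ (d - j)) ((U ^^ j) h))
          = of_nat (d choose j) * (\<Delta> ^^ (n - j)) ((U ^^ j) h)"
        by (simp only: funpow_add o_apply)
    qed
    also have "\<dots> = (\<Sum>j\<le>max d e. of_nat (d choose j) * (\<Delta> ^^ (n - j)) ((U ^^ j) h))"
      by (intro sum.mono_neutral_left) (auto simp: binomial_eq_0)
    also have "\<dots> = (\<Sum>j\<le>e. of_nat (d choose j) * (\<Delta> ^^ (n - j)) ((U ^^ j) h))"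
    proof (intro sum.mono_neutral_right ballI)
      fix j assume j: "j \<in> {..max d e} - {..e}"
      interpret \<Delta>p: linear_op "\<Delta> ^^ (n - j)"
        using lin(1) by (rule linear_op.linear_op_funpow)
      show "of_nat (d choose j) * (\<Delta> ^^ (n - j)) ((U ^^ j) h) = 0"
        using nil j by simp
    qed auto
    finally show ?thesis .
  qed
  have "(\<Sum>d\<in>S. const (c d) * (\<Delta> ^^ (n - d)) ((D ^^ d) h))
      = (\<Sum>d\<in>S. \<Sum>j\<le>e. const (c d * of_nat (d choose j)) * (\<Delta> ^^ (n - j)) ((U ^^ j) h))"
    by (intro sum.cong refl)
      (simp add: termwise sum_distrib_left const_mult const_of_nat mult.assoc)
  also have "\<dots> = (\<Sum>j\<le>e. const (\<Sum>d\<in>S. c d * of_nat (d choose j)) * (\<Delta> ^^ (n - j)) ((U ^^ j) h))"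
  proof -
    have const_sum: "const (sum g S) = (\<Sum>d\<in>S. const (g d))" for g :: "nat \<Rightarrow> 'a"
      by (induction S rule: infinite_finite_induct) (simp_all add: const_add)
    show ?thesis by (subst sum.swap) (simp add: const_sum sum_distrib_right)
  qed
  also have "\<dots> = 0" by (simp add: ann)
  finally show ?thesis using c by blast
qed


section \<open>The difference operators\<close>

definition ydiff :: "nat \<Rightarrow> 'a::field mpoly \<Rightarrow> 'a mpoly" where
  "ydiff r f = shift (\<lambda>i. if i = r then 1 else 0) f - f"

definition delta :: "nat \<Rightarrow> 'a::field mpoly \<Rightarrow> 'a mpoly" where
  "delta r f = shift (\<lambda>i. if i < r then 1 else 0) f - f"

text \<open>A projection onto the polynomials free of y_r. It commutes with \<open>delta r\<close>,
  which does not touch y_r, and so moves preimages under powers of \<open>delta r\<close> into that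
  subring.\<close>

definition ydrop :: "nat \<Rightarrow> 'a::field mpoly \<Rightarrow> 'a mpoly" where
  "ydrop r = subst (\<lambda>v. if v = Y r then 0 else var_poly v)"

interpretation ydiff: linear_op "ydiff r" for r
  unfolding ydiff_def by (intro linear_op_diff linear_op_id shift.linear_op)

interpretation delta: linear_op "delta r" for r
  unfolding delta_def by (intro linear_op_diff linear_op_id shift.linear_op)

interpretation ydrop: alg_hom "ydrop r" for r
  unfolding ydrop_def by (rule subst.alg_hom_axioms)

lemma shift_delta: "shift c (delta r f) = delta r (shift c f)"
  by (simp add: delta_def shift.diff shift_commute)

lemma shift_ydiff: "shift c (ydiff r f) = ydiff r (shift c f)"
  by (simp add: ydiff_def shift.diff shift_commute)

lemma delta_ydiff: "delta s (ydiff r f) = ydiff r (delta s f)"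
  by (simp add: ydiff_def shift_delta delta.diff)

text \<open>The identity a b - 1 = (a - 1) + a (b - 1), with a the shift of the y_i for i < r and b
  the shift of y_r.\<close>

lemma delta_Suc:
  "delta (Suc r) f = delta r f + shift (\<lambda>i. if i < r then 1 else 0) (ydiff r f)"
proof -
  have *: "(\<lambda>i. (if i < r then 1 else 0) + (if i = r then 1 else 0 :: 'a))
      = (\<lambda>i. if i < Suc r then 1 else 0)" by auto
  show ?thesis by (simp add: delta_def ydiff_def shift.diff shift_shift *)
qed

lemma ydrop_shift:
  assumes "c r = 0" shows "ydrop r (shift c f) = shift c (ydrop r f)"
proof (rule alg_hom_eqI[where \<phi> = "\<lambda>f. ydrop r (shift c f)" and \<psi> = "\<lambda>f. shift c (ydrop r f)"])
  show "ydrop r (shift c (var_poly v)) = shift c (ydrop r (var_poly v))" for v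
  proof (cases v)
    case (Y i)
    then show ?thesis
      by (cases "i = r") (simp_all add: assms ydrop.add ydrop.mult, simp_all add: ydrop_def)
  qed (simp add: ydrop_def)
qed (rule alg_hom_comp[OF ydrop.alg_hom_axioms shift.alg_hom_axioms]
          alg_hom_comp[OF shift.alg_hom_axioms ydrop.alg_hom_axioms])+

lemma ydrop_delta: "ydrop r (delta r f) = delta r (ydrop r f)"
  by (simp add: delta_def ydrop.diff ydrop_shift)

lemma shift_cong:
  assumes "\<And>t j. t \<in> keys f \<Longrightarrow> Y j \<in> keys t \<Longrightarrow> c j = d j"
  shows "shift c f = shift d f"
  unfolding shift_def using assms by (intro subst_cong) (auto split: var.splits)

lemma shift_ident: "(\<And>t j. t \<in> keys f \<Longrightarrow> Y j \<in> keys t \<Longrightarrow> c j = 0) \<Longrightarrow> shift c f = f"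
  using shift_cong[of f c "\<lambda>_. 0"] by simp

section \<open>Iterated differences in one variable and the top coefficient\<close>

lemma ydiff_funpow_mult:
  assumes "shift (\<lambda>i. if i = r then 1 else 0) g = g"
  shows "(ydiff r ^^ n) (g * f) = g * (ydiff r ^^ n) f"
proof (induction n)
  case (Suc n)
  then show ?case using assms by (simp add: ydiff_def shift.mult algebra_simps)
qed simp

text \<open>A difference with step x_r lowers the degree in y_r by at least one, and the leading
  factors n, n - 1, ... accumulate to n!.\<close>

lemma ydiff_funpow_power:
  "b \<le> n \<Longrightarrow>
    (ydiff r ^^ n) (yv r ^ b) = (if b = n then of_nat (fact n) * xv r ^ n else 0 :: 'a::field mpoly)"
proof (induction n arbitrary: b)
  case (Suc n)
  have x: "shift (\<lambda>i. if i = r then 1 else 0) (of_nat k * xv r ^ j) = (of_nat k * xv r ^ j :: 'a mpoly)"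
    for k j
    by (simp add: shift.mult shift.power)
  have step: "ydiff r (yv r ^ b) = (\<Sum>k<b. (of_nat (b choose k) * xv r ^ (b - k)) * yv r ^ k :: 'a mpoly)"
  proof -
    have "ydiff r (yv r ^ b) = ((yv r + xv r) ^ b - yv r ^ b :: 'a mpoly)"
      by (simp add: ydiff_def shift.power)
    also have "(yv r + xv r :: 'a mpoly) ^ b
        = (\<Sum>k<b. of_nat (b choose k) * yv r ^ k * xv r ^ (b - k)) + yv r ^ b"
      by (simp add: binomial_ring lessThan_Suc_atMost[symmetric])
    finally show ?thesis by (simp add: mult_ac)
  qed
  have "(ydiff r ^^ Suc n) (yv r ^ b)
      = (ydiff r ^^ n) (\<Sum>k<b. (of_nat (b choose k) * xv r ^ (b - k)) * yv r ^ k :: 'a mpoly)"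
    by (simp only: funpow_Suc_right o_apply step)
  also have "\<dots> = (\<Sum>k<b. (of_nat (b choose k) * xv r ^ (b - k)) * (ydiff r ^^ n) (yv r ^ k))"
    by (simp only: linear_op.sum[OF ydiff.linear_op_funpow] ydiff_funpow_mult[OF x])
  also have "\<dots> = (\<Sum>k<b. if k = n
      then (of_nat (b choose k) * xv r ^ (b - k)) * (of_nat (fact n) * xv r ^ n) else 0)"
    using Suc.prems by (intro sum.cong refl) (auto simp: Suc.IH)
  also have "\<dots> = (if b = Suc n then of_nat (fact (Suc n)) * xv r ^ Suc n else 0)"
    using Suc.prems by (auto simp: algebra_simps)
  finally show ?case .
qed simp

text \<open>The effect of the b-th difference on a monomial with y_r-exponent b. Trading y_r^b for
  x_r^b, instead of just removing it, preserves the multidegree. The truncated subtraction is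
  faithful only for y_r-exponent at least b.\<close>

definition y_to_x :: "nat \<Rightarrow> nat \<Rightarrow> mon \<Rightarrow> mon" where
  "y_to_x r b t = t - single (Y r) b + single (X r) b"

lemma ydiff_funpow_single:
  fixes c :: "'a::field"
  assumes "lookup t (Y r) \<le> b"
  shows "(ydiff r ^^ b) (single t c)
    = (if lookup t (Y r) = b then single (y_to_x r b t) (of_nat (fact b) * c) else 0)"
proof -
  define n where "n = lookup t (Y r)"
  define t' where "t' = t - single (Y r) n"
  have t: "t = t' + single (Y r) n"
    by (rule poly_mapping_eqI) (auto simp: t'_def n_def lookup_add lookup_minus lookup_single when_def)
  have "Y r \<notin> keys t'"
    by (simp add: in_keys_iff t'_def n_def lookup_minus)
  then have inv: "shift (\<lambda>i. if i = r then 1 else 0) (single t' c) = single t' c"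
    by (intro shift_ident) (auto split: if_splits)
  have "(ydiff r ^^ b) (single t c) = single t' c * (ydiff r ^^ b) (yv r ^ n)"
    by (simp only: t single_eq_times ydiff_funpow_mult[OF inv] var_poly_power)
  also have "(ydiff r ^^ b) (yv r ^ n) = (if n = b then of_nat (fact b) * xv r ^ b else 0 :: 'a mpoly)"
    using assms by (intro ydiff_funpow_power) (simp add: n_def)
  also have "single t' c * \<dots>
      = (if n = b then single (t' + single (X r) b) (of_nat (fact b) * c) else 0)"
    by (simp add: var_poly_power of_nat_times_single mult_single mult.commute del: of_nat_fact)
  finally show ?thesis by (auto simp: n_def y_to_x_def t'_def)
qed

lemma ydiff_funpow:
  assumes "\<And>t. t \<in> keys f \<Longrightarrow> lookup t (Y r) \<le> b"
  shows "(ydiff r ^^ b) f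
    = (\<Sum>t\<in>{t\<in>keys f. lookup t (Y r) = b}. single (y_to_x r b t) (of_nat (fact b) * lookup f t))"
proof -
  have "(ydiff r ^^ b) f = (\<Sum>t\<in>keys f. (ydiff r ^^ b) (single t (lookup f t)))"
    by (subst eq_sum_single[of f]) (rule linear_op.sum[OF ydiff.linear_op_funpow])
  also have "\<dots> = (\<Sum>t\<in>keys f. if lookup t (Y r) = b
      then single (y_to_x r b t) (of_nat (fact b) * lookup f t) else 0)"
    using assms by (intro sum.cong refl) (simp add: ydiff_funpow_single)
  finally show ?thesis by (simp add: sum.inter_filter)
qed

lemma y_to_x_inj:
  assumes "lookup s (Y r) = b" "lookup t (Y r) = b" "y_to_x r b s = y_to_x r b t"
  shows "s = t"
proof (rule poly_mapping_eqI)
  fix v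
  have "lookup (y_to_x r b s) v = lookup (y_to_x r b t) v" using assms(3) by simp
  then show "lookup s v = lookup t v"
    using assms(1,2) by (cases "v = Y r")
      (auto simp: y_to_x_def lookup_add lookup_minus lookup_single when_def split: if_splits)
qed

text \<open>No top term is lost: distinct monomials have distinct images by
  \<open>y_to_x_inj\<close>, and b! is nonzero for b < p.\<close>

lemma keys_ydiff_funpow:
  assumes "prime CHAR('a)" "b < CHAR('a)" and f: "\<And>t. t \<in> keys f \<Longrightarrow> lookup t (Y r) \<le> b"
  shows "keys ((ydiff r ^^ b) (f :: 'a::field mpoly))
    = y_to_x r b ` {t\<in>keys f. lookup t (Y r) = b}"
proof -
  let ?T = "{t\<in>keys f. lookup t (Y r) = b}"
  have eq: "(ydiff r ^^ b) f = (\<Sum>t\<in>?T. single (y_to_x r b t) (of_nat (fact b) * lookup f t))"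
    using f by (rule ydiff_funpow)
  have inj: "inj_on (y_to_x r b) ?T" by (auto intro!: inj_onI dest: y_to_x_inj)
  have look: "lookup ((ydiff r ^^ b) f) (y_to_x r b t) = of_nat (fact b) * lookup f t" if "t \<in> ?T" for t
  proof -
    have "lookup ((ydiff r ^^ b) f) (y_to_x r b t)
        = (\<Sum>s\<in>?T. if s = t then of_nat (fact b) * lookup f s else 0)"
      unfolding eq lookup_sum using that inj
      by (intro sum.cong refl) (auto simp: lookup_single when_def inj_on_eq_iff)
    then show ?thesis using that by simp
  qed
  show ?thesis
  proof
    show "keys ((ydiff r ^^ b) f) \<subseteq> y_to_x r b ` ?T"
      unfolding eq by (rule order_trans[OF keys_sum]) auto
    show "y_to_x r b ` ?T \<subseteq> keys ((ydiff r ^^ b) f)"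
      using look of_nat_fact_neq_0[OF assms(1,2)] by (auto simp: in_keys_iff simp del: of_nat_fact)
  qed
qed

lemma ydiff_funpow_eq_0:
  assumes "\<And>t. t \<in> keys f \<Longrightarrow> lookup t (Y r) < b"
  shows "(ydiff r ^^ b) f = 0"
  using assms by (subst ydiff_funpow) (auto intro!: sum.neutral less_imp_le)

text \<open>In characteristic p, (S - 1)^p = S^p - 1, and S^p shifts by p = 0.\<close>

lemma delta_funpow_CHAR:
  assumes p: "prime CHAR('a)"
  shows "(delta r ^^ CHAR('a)) f = (0 :: 'a::field mpoly)"
proof -
  define p where "p = CHAR('a)"
  define S where "S = shift (\<lambda>i. if i < r then 1 else 0 :: 'a)"
  have [simp]: "of_nat p = (0 :: 'a mpoly)" "of_nat p = (0 :: 'a)"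
    by (simp_all add: CHAR_mpoly p_def)
  have "(delta r ^^ p) f = (\<Sum>j\<le>p. of_nat (p choose j) * (uminus ^^ (p - j)) ((S ^^ j) f))"
  proof (rule op_binomial)
    show "linear_op S" unfolding S_def by (rule shift.linear_op)
    show "delta r f = - f + S f" for f by (simp add: delta_def S_def)
    show "- S f = S (- f)" for f by (simp add: S_def shift.uminus)
  qed (rule linear_op_uminus)
  also have "\<dots> = (\<Sum>j\<in>{0, p}. of_nat (p choose j) * (uminus ^^ (p - j)) ((S ^^ j) f))"
  proof (intro sum.mono_neutral_right ballI)
    fix j assume "j \<in> {..p} - {0, p}"
    then have "p dvd (p choose j)"
      using p by (intro dvd_choose_prime) (auto simp: p_def)
    then have "of_nat (p choose j) = (0 :: 'a mpoly)" by (auto simp: dvd_def)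
    then show "of_nat (p choose j) * (uminus ^^ (p - j)) ((S ^^ j) f) = 0" by simp
  qed auto
  also have "\<dots> = (uminus ^^ p) f + f"
    using p by (simp add: p_def prime_gt_0_nat S_def shift_funpow)
  also have "\<dots> = 0"
  proof (cases "even p")
    \<comment> \<open>For p = 2 the sign does not cancel the two terms, but 2 f = 0.\<close>
    case True
    then have "p = 2"
      using primes_dvd_imp_eq[OF two_is_prime_nat p] by (simp add: p_def)
    have "(uminus ^^ p) f + f = of_nat p * f"
      unfolding \<open>p = 2\<close> by (simp add: numeral_2_eq_2 distrib_right)
    then show ?thesis by simp
  next
    case False
    have "(uminus ^^ n) f = (if even n then f else - f)" for n by (induction n) auto
    then show ?thesis using False by simp
  qed
  finally show ?thesis by (simp add: p_def)
qed


section \<open>The submodules of fixed multidegree involving only the first y-variables\<close>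

text \<open>All x_i stay allowed, also for i >= r: trading y_r for x_r lowers r without leaving the
  multidegree, so a single \<open>E\<close> serves the whole induction.\<close>

definition mhom_below :: "(nat \<Rightarrow> nat) \<Rightarrow> nat \<Rightarrow> 'a::field mpoly set" where
  "mhom_below E r = mhom E \<inter> polys_in (range X \<union> Y ` {..<r})"

lemma mhom_below_iff:
  "f \<in> mhom_below E r \<longleftrightarrow> (\<forall>t\<in>keys f. mdeg t = E \<and> (\<forall>j\<ge>r. lookup t (Y j) = 0))"
proof -
  have "keys t \<subseteq> range X \<union> Y ` {..<r} \<longleftrightarrow> (\<forall>j\<ge>r. Y j \<notin> keys t)" for t :: mon
  proof
    assume *: "\<forall>j\<ge>r. Y j \<notin> keys t"
    show "keys t \<subseteq> range X \<union> Y ` {..<r}"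
    proof
      fix v assume "v \<in> keys t"
      with * have "j < r" if "v = Y j" for j using that not_le by blast
      then show "v \<in> range X \<union> Y ` {..<r}" by (cases v) auto
    qed
  qed auto
  then show ?thesis by (auto simp: mhom_below_def mhom_def polys_in_def in_keys_iff)
qed

lemma shift_in_mhom_below: "f \<in> mhom_below E r \<Longrightarrow> shift c f \<in> mhom_below E r"
  unfolding mhom_below_def by (auto intro!: mhom_shift shift_in_polys_in)

lemma mhom_below_diff: "f \<in> mhom_below E r \<Longrightarrow> g \<in> mhom_below E r \<Longrightarrow> f - g \<in> mhom_below E r"
  unfolding mhom_below_def by (auto intro!: mhom_diff subalgebra_diff subalgebra_polys_in)

lemma mhom_below_const_mult: "f \<in> mhom_below E r \<Longrightarrow> const c * f \<in> mhom_below E r"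
  unfolding mhom_below_def
  by (auto intro!: mhom_const_mult subalgebra_mult subalgebra_const subalgebra_polys_in)

lemma mhom_below_sum: "(\<And>i. i \<in> I \<Longrightarrow> h i \<in> mhom_below E r) \<Longrightarrow> sum h I \<in> mhom_below E r"
  unfolding mhom_below_def by (auto intro!: mhom_sum subalgebra_sum subalgebra_polys_in)

lemma delta_funpow_in_mhom_below:
  "f \<in> mhom_below E r \<Longrightarrow> (delta s ^^ n) f \<in> mhom_below E r"
  by (induction n) (auto simp: delta_def intro!: mhom_below_diff shift_in_mhom_below)

lemma ydrop_eq_self: "f \<in> mhom_below E r \<Longrightarrow> ydrop r f = f"
  unfolding ydrop_def
  by (subst subst_cong[where s' = var_poly]) (auto simp: subst_id mhom_below_iff in_keys_iff)

lemma ydrop_single: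
  fixes c :: "'a::field"
  shows "ydrop r (single t c) = (if lookup t (Y r) = 0 then single t c else 0)"
proof (cases "lookup t (Y r) = 0")
  case True
  then have "ydrop r (single t c) = subst var_poly (single t c)"
    unfolding ydrop_def by (intro subst_cong) (auto simp: in_keys_iff split: if_splits)
  with True show ?thesis by (simp add: subst_id)
next
  case False
  then have "(\<Prod>v\<in>keys t. (if v = Y r then 0 else var_poly v) ^ lookup t v) = (0 :: 'a mpoly)"
    by (intro prod_zero bexI[of _ "Y r"]) (auto simp: in_keys_iff zero_power)
  with False show ?thesis by (simp add: ydrop_def subst_single)
qed

lemma ydrop_in_mhom_below:
  assumes "f \<in> mhom_below E (Suc r)" shows "ydrop r f \<in> mhom_below E r"
proof -
  have "ydrop r f = (\<Sum>t\<in>keys f. ydrop r (single t (lookup f t)))"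
    by (subst eq_sum_single[of f]) (rule ydrop.sum)
  also have "\<dots> \<in> mhom_below E r"
  proof (rule mhom_below_sum)
    fix t assume "t \<in> keys f"
    then have *: "\<forall>j\<ge>Suc r. lookup t (Y j) = 0" "mdeg t = E"
      using assms by (auto simp: mhom_below_iff)
    have "\<forall>j\<ge>r. lookup t (Y j) = 0" if "lookup t (Y r) = 0"
      using *(1) that by (metis Suc_leI le_neq_implies_less)
    then show "ydrop r (single t (lookup f t)) \<in> mhom_below E r"
      using *(2) by (simp add: ydrop_single mhom_below_iff)
  qed
  finally show ?thesis .
qed

section \<open>The term order and lead monomials\<close>

lemma mon_degree_eq_sum:
  assumes "finite A" "keys t \<subseteq> A"
  shows "mon_degree t = (\<Sum>v\<in>A. lookup t v)"
  unfolding mon_degree_def using assms by (intro sum.mono_neutral_left) (auto simp: in_keys_iff)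

lemma mon_degree_add: "mon_degree (s + t) = mon_degree s + mon_degree t"
proof -
  let ?A = "keys s \<union> keys t"
  show ?thesis
    by (simp add: mon_degree_eq_sum[of ?A] keys_add_eq lookup_add sum.distrib)
qed

lemma mon_degree_0 [simp]: "mon_degree 0 = 0"
  by (simp add: mon_degree_def)

lemma mon_degree_single [simp]: "mon_degree (single v n) = n"
  by (simp add: mon_degree_def)

lemma mon_degree_eq_0_iff: "mon_degree t = 0 \<longleftrightarrow> t = 0"
  by (auto simp: mon_degree_def in_keys_iff intro: poly_mapping_eqI)

lemma mon_degree_eq_sum_mdeg:
  assumes "keys t \<subseteq> X ` I \<union> Y ` I" "finite I"
  shows "mon_degree t = (\<Sum>i\<in>I. mdeg t i)"
proof -
  have "mon_degree t = (\<Sum>v\<in>X ` I \<union> Y ` I. lookup t v)"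
    using assms by (intro mon_degree_eq_sum) auto
  also have "\<dots> = (\<Sum>v\<in>X ` I. lookup t v) + (\<Sum>v\<in>Y ` I. lookup t v)"
    using assms by (intro sum.union_disjoint) auto
  also have "\<dots> = (\<Sum>i\<in>I. mdeg t i)"
    by (simp add: sum.reindex inj_on_def mdeg_def sum.distrib)
  finally show ?thesis .
qed

lemma mon_degree_cong_mdeg:
  assumes "mdeg s = mdeg t" shows "mon_degree s = mon_degree t"
proof -
  define I where "I = (\<lambda>v. case v of X i \<Rightarrow> i | Y i \<Rightarrow> i) ` (keys s \<union> keys t)"
  have "keys s \<union> keys t \<subseteq> X ` I \<union> Y ` I"
  proof
    fix v assume v: "v \<in> keys s \<union> keys t"
    show "v \<in> X ` I \<union> Y ` I"
      using imageI[OF v, of "\<lambda>v. case v of X i \<Rightarrow> i | Y i \<Rightarrow> i"]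
      by (cases v) (simp_all flip: I_def)
  qed
  then show ?thesis
    using assms by (subst (1 2) mon_degree_eq_sum_mdeg[of _ I]) (auto simp: I_def)
qed

lemma position_inject: "position v = position w \<Longrightarrow> v = w"
  by (cases v; cases w) (simp_all, presburger+)

lemma grevlex_less_irrefl [simp]: "\<not> grevlex_less t t"
  by (auto simp: grevlex_less_def)

lemma grevlex_less_trans:
  assumes "grevlex_less s t" "grevlex_less t q"
  shows "grevlex_less s q"
proof (cases "mon_degree s = mon_degree t \<and> mon_degree t = mon_degree q")
  case True
  obtain v where v: "lookup s v > lookup t v"
    "\<And>x. position x > position v \<Longrightarrow> lookup s x = lookup t x"
    using assms(1) True by (auto simp: grevlex_less_def)
  obtain w where w: "lookup t w > lookup q w"
    "\<And>x. position x > position w \<Longrightarrow> lookup t x = lookup q x"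
    using assms(2) True by (auto simp: grevlex_less_def)
  consider "position v < position w" | "position w < position v" | "v = w"
    using position_inject by fastforce
  then have "\<exists>x. lookup s x > lookup q x \<and> (\<forall>y. position y > position x \<longrightarrow> lookup s y = lookup q y)"
  proof cases
    case 1
    then show ?thesis using v(2) w by (intro exI[of _ w]) auto
  next
    case 2
    then show ?thesis using w(2) v by (intro exI[of _ v]) auto
  next
    case 3
    then show ?thesis using v w by (intro exI[of _ v]) auto
  qed
  then show ?thesis using True by (auto simp: grevlex_less_def)
next
  case False
  then show ?thesis using assms by (auto simp: grevlex_less_def)
qed

lemma grevlex_less_asym: "grevlex_less s t \<Longrightarrow> \<not> grevlex_less t s"
  using grevlex_less_trans[of s t s] by auto

lemma grevlex_less_total:
  assumes "s \<noteq> t" shows "grevlex_less s t \<or> grevlex_less t s"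
proof (cases "mon_degree s = mon_degree t")
  case True
  define A where "A = {v. lookup s v \<noteq> lookup t v}"
  have "A \<subseteq> keys s \<union> keys t" by (auto simp: A_def in_keys_iff)
  then have fin: "finite A" by (rule finite_subset) simp
  have "A \<noteq> {}" using assms by (auto simp: A_def intro: poly_mapping_eqI)
  then have "Max (position ` A) \<in> position ` A" using fin by (intro Max_in) auto
  then obtain v where "v \<in> A" and v: "position v = Max (position ` A)" by (metis imageE)
  have "lookup s x = lookup t x" if "position x > position v" for x
  proof (rule ccontr)
    assume "lookup s x \<noteq> lookup t x"
    then have "position x \<le> Max (position ` A)" using fin by (intro Max_ge) (auto simp: A_def)
    then show False using that v by simp
  qed
  moreover have "lookup s v > lookup t v \<or> lookup t v > lookup s v"
    using \<open>v \<in> A\<close> by (auto simp: A_def)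
  ultimately show ?thesis using True unfolding grevlex_less_def by metis
qed (auto simp: grevlex_less_def)

lemma grevlex_less_add_iff [simp]: "grevlex_less (s + q) (t + q) \<longleftrightarrow> grevlex_less s t"
  by (simp add: grevlex_less_def mon_degree_add lookup_add)

lemma grevlex_less_add_mono:
  assumes "grevlex_less s t \<or> s = t" "grevlex_less s' t' \<or> s' = t'" "s \<noteq> t \<or> s' \<noteq> t'"
  shows "grevlex_less (s + s') (t + t')"
proof -
  have "grevlex_less (s + s') (t + s') \<or> s = t" using assms(1) by simp
  moreover have "grevlex_less (t + s') (t + t') \<or> s' = t'"
    using assms(2) by (simp add: add.commute[of t])
  ultimately show ?thesis
    using assms(3) grevlex_less_trans[of "s + s'" "t + s'" "t + t'"] by metis
qed

text \<open>Relational form of \<open>LM\<close>, which frees existence, uniqueness and products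
  from the description operator; \<open>LM_eq\<close> is the bridge.\<close>

definition is_lead :: "mon \<Rightarrow> 'a::field mpoly \<Rightarrow> bool" where
  "is_lead t f \<longleftrightarrow> t \<in> keys f \<and> (\<forall>s\<in>keys f. s \<noteq> t \<longrightarrow> grevlex_less s t)"

lemma is_lead_unique:
  assumes "is_lead s f" "is_lead t f" shows "s = t"
proof (rule ccontr)
  assume "s \<noteq> t"
  then have "grevlex_less s t" "grevlex_less t s" using assms by (auto simp: is_lead_def)
  then show False using grevlex_less_asym[of s t] by simp
qed

lemma is_lead_exists:
  assumes "f \<noteq> 0" obtains t where "is_lead t f"
proof -
  have "\<exists>t\<in>A. \<forall>s\<in>A. s \<noteq> t \<longrightarrow> grevlex_less s t" if "finite A" "A \<noteq> {}" for A
    using that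
  proof (induction rule: finite_ne_induct)
    case (insert x A)
    then obtain t where t: "t \<in> A" "\<forall>s\<in>A. s \<noteq> t \<longrightarrow> grevlex_less s t" by blast
    have "x \<noteq> t" using insert t by auto
    from grevlex_less_total[OF this] show ?case
    proof
      assume xt: "grevlex_less x t"
      show ?thesis using t xt by (intro bexI[of _ t]) auto
    next
      assume tx: "grevlex_less t x"
      then have "grevlex_less s x" if "s \<in> A" for s
        using t that grevlex_less_trans[of s t x] by (cases "s = t") auto
      then show ?thesis by (intro bexI[of _ x]) auto
    qed
  qed simp
  from this[of "keys f"] assms
  have "\<exists>t\<in>keys f. \<forall>s\<in>keys f. s \<noteq> t \<longrightarrow> grevlex_less s t" by simp
  then have "\<exists>t. is_lead t f" unfolding is_lead_def Bex_def .
  then show ?thesis using that by (elim exE)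
qed

lemma LM_eq:
  assumes "is_lead t f" shows "LM f = single t 1"
proof -
  have "(THE t. is_lead t f) = t" using assms is_lead_unique[OF _ assms] by (rule the_equality)
  then show ?thesis by (simp add: LM_def is_lead_def)
qed

lemma is_lead_neq_0: "is_lead t f \<Longrightarrow> f \<noteq> 0"
  by (auto simp: is_lead_def)

lemma is_lead_mult:
  assumes f: "is_lead t f" and g: "is_lead s g"
  shows "is_lead (t + s) (f * g)" and "lookup (f * g) (t + s) = lookup f t * lookup g s"
proof -
  have less: "grevlex_less (a + b) (t + s)" if "a \<in> keys f" "b \<in> keys g" "a \<noteq> t \<or> b \<noteq> s" for a b
    using that f g by (intro grevlex_less_add_mono) (auto simp: is_lead_def)
  have eq: "f * g = (\<Sum>a\<in>keys f. \<Sum>b\<in>keys g. single (a + b) (lookup f a * lookup g b))"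
    by (subst eq_sum_single[of f], subst eq_sum_single[of g])
      (simp add: sum_product mult_single)
  have "lookup (f * g) (t + s)
      = (\<Sum>a\<in>keys f. \<Sum>b\<in>keys g. if a = t \<and> b = s then lookup f a * lookup g b else 0)"
    unfolding eq lookup_sum
  proof (intro sum.cong refl)
    fix a b assume "a \<in> keys f" "b \<in> keys g"
    then have "a = t \<and> b = s" if "a + b = t + s" using less[of a b] that by auto
    then show "lookup (single (a + b) (lookup f a * lookup g b)) (t + s)
        = (if a = t \<and> b = s then lookup f a * lookup g b else 0)"
      by (auto simp: lookup_single when_def)
  qed
  also have "\<dots> = (\<Sum>a\<in>keys f. if a = t then lookup f a * lookup g s else 0)"
    using g by (intro sum.cong refl) (auto simp: is_lead_def)
  also have "\<dots> = lookup f t * lookup g s" using f by (simp add: is_lead_def)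
  finally show *: "lookup (f * g) (t + s) = lookup f t * lookup g s" .
  show "is_lead (t + s) (f * g)"
    unfolding is_lead_def
  proof (intro conjI ballI impI)
    show "t + s \<in> keys (f * g)" using * f g by (simp add: is_lead_def in_keys_iff)
    fix x assume "x \<in> keys (f * g)" "x \<noteq> t + s"
    then show "grevlex_less x (t + s)" using keys_mult[of f g] less by blast
  qed
qed

lemma is_lead_1: "is_lead 0 1"
  by (simp add: is_lead_def)

lemma is_lead_single: "c \<noteq> 0 \<Longrightarrow> is_lead t (single t c)"
  by (simp add: is_lead_def)

lemma is_lead_var: "is_lead (single v 1) (var_poly v)"
  by (simp add: var_poly_def is_lead_single)

lemma is_lead_sum_keys:
  assumes "is_lead t f" "t \<in> keys g" "keys g \<subseteq> keys f"
  shows "is_lead t g"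
  using assms unfolding is_lead_def by blast

text \<open>Beyond index r there are no y's, so the fixed multidegree fixes the x's there, and x_r
  is the smallest variable at which two monomials can differ. Less of x_r means larger in the order
  and, in fixed multidegree, more of y_r.\<close>

lemma mhom_below_lead_max:
  assumes f: "f \<in> mhom_below E (Suc r)" "is_lead t f" and s: "s \<in> keys f"
  shows "lookup s (Y r) \<le> lookup t (Y r)"
proof (rule ccontr)
  assume "\<not> ?thesis"
  then have *: "lookup s (Y r) > lookup t (Y r)" by simp
  have t: "t \<in> keys f" using f by (simp add: is_lead_def)
  have st: "mdeg s i = mdeg t i" for i using f(1) s t by (auto simp: mhom_below_iff)
  then have "mon_degree s = mon_degree t" by (intro mon_degree_cong_mdeg) auto
  moreover have "grevlex_less s t" using * f(2) s by (auto simp: is_lead_def)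
  ultimately obtain v where v: "lookup s v > lookup t v"
      "\<And>x. position x > position v \<Longrightarrow> lookup s x = lookup t x"
    by (auto simp: grevlex_less_def)
  have X: "lookup s (X r) < lookup t (X r)" using st[of r] * by (simp add: mdeg_def)
  have Y: "lookup s (Y j) = 0" "lookup t (Y j) = 0" if "Suc r \<le> j" for j
    using f(1) s t that by (auto simp: mhom_below_iff)
  then have above: "lookup s v = lookup t v" if "v = X j \<or> v = Y j" "Suc r \<le> j" for j v
    using that st[of j] by (auto simp: mdeg_def)
  have "\<not> position (X r) > position v" using X v(2) by force
  moreover have "v \<noteq> X r" using X v(1) by auto
  ultimately show False using v(1) above by (cases v) (fastforce simp: not_less)+
qed

lemma y_to_x_add: "lookup t (Y r) = b \<Longrightarrow> y_to_x r b t + single (Y r) b = t + single (X r) b"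
  by (rule poly_mapping_eqI)
    (auto simp: y_to_x_def lookup_add lookup_minus lookup_single when_def)

lemma lookup_y_to_x:
  "lookup (y_to_x r b t) v =
    (if v = Y r then lookup t v - b else if v = X r then lookup t v + b else lookup t v)"
  by (auto simp: y_to_x_def lookup_add lookup_minus lookup_single when_def)

lemma grevlex_less_y_to_x_iff:
  assumes "lookup s (Y r) = b" "lookup t (Y r) = b"
  shows "grevlex_less (y_to_x r b s) (y_to_x r b t) \<longleftrightarrow> grevlex_less s t"
  using grevlex_less_add_iff[of "y_to_x r b s" "single (Y r) b" "y_to_x r b t"]
  by (simp only: y_to_x_add[OF assms(1)] y_to_x_add[OF assms(2)] grevlex_less_add_iff)

text \<open>Among monomials of equal y_r-exponent \<open>y_to_x\<close> preserves the order, and no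
  top term is lost.\<close>

lemma is_lead_ydiff_funpow:
  fixes f :: "'a::field mpoly"
  assumes "prime CHAR('a)" "lookup t (Y r) < CHAR('a)"
    and f: "is_lead t f" "\<And>s. s \<in> keys f \<Longrightarrow> lookup s (Y r) \<le> lookup t (Y r)"
  shows "is_lead (y_to_x r (lookup t (Y r)) t) ((ydiff r ^^ lookup t (Y r)) f)"
proof -
  let ?b = "lookup t (Y r)"
  have "keys ((ydiff r ^^ ?b) f) = y_to_x r ?b ` {s\<in>keys f. lookup s (Y r) = ?b}"
    using assms(1,2) f(2) by (rule keys_ydiff_funpow)
  then show ?thesis
    using f(1) by (auto simp: is_lead_def grevlex_less_y_to_x_iff)
qed

section \<open>Lead monomials of invariants of small multidegree\<close>

text \<open>\<open>lev p t r + 1\<close> is the dimension of the indecomposable summand (projective summands all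
  counting as \<open>V\<^sub>p\<close>) of \<open>V\<^bsub>E\<^sub>0 + 1\<^esub> \<otimes> \<dots> \<otimes> V\<^bsub>E\<^sub>r\<^sub>-\<^sub>1 + 1\<^esub>\<close> whose socle has lead monomial \<open>t\<close>.\<close>

primrec lev :: "nat \<Rightarrow> mon \<Rightarrow> nat \<Rightarrow> nat" where
  "lev p t 0 = 0"
| "lev p t (Suc r) = (if p - 1 \<le> lev p t r + lookup t (X r) then p - 1
     else lev p t r + lookup t (X r) - lookup t (Y r))"

lemma lev_le: "0 < p \<Longrightarrow> lev p t r \<le> p - 1"
  by (induction r) auto

lemma lev_cong:
  assumes "\<And>i. i < r \<Longrightarrow> lookup s (X i) = lookup t (X i) \<and> lookup s (Y i) = lookup t (Y i)"
  shows "lev p s r = lev p t r"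
  using assms by (induction r) auto

text \<open>By \<open>delta_Suc\<close>, invariance says that \<open>delta r\<close> acts on f as
  minus the shift of the earlier y's after \<open>ydiff r\<close>. All these operators commute, so
  this can be iterated: differences in y_r are traded for differences in the earlier
  variables.\<close>

lemma delta_funpow_ydiff:
  assumes inv: "delta (Suc r) f = 0"
  shows "(delta r ^^ n) f
    = const ((- 1) ^ n) * (shift (\<lambda>i. if i < r then 1 else 0) ^^ n) ((ydiff r ^^ n) f)"
proof (induction n)
  case (Suc n)
  define S :: "'a mpoly \<Rightarrow> 'a mpoly" where "S = shift (\<lambda>i. if i < r then 1 else 0)"
  interpret S: alg_hom S unfolding S_def by (rule shift.alg_hom_axioms)
  have 1: "delta r ((S ^^ n) g) = (S ^^ n) (delta r g)" for g
    using funpow_commute[of "delta r" S 1 n] by (simp add: S_def shift_delta)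
  have 2: "delta r ((ydiff r ^^ n) g) = (ydiff r ^^ n) (delta r g)" for g
    using funpow_commute[of "delta r" "ydiff r" 1 n] by (simp add: delta_ydiff)
  have 3: "(ydiff r ^^ n) (S g) = S ((ydiff r ^^ n) g)" for g
    using funpow_commute[of S "ydiff r" 1 n] by (simp add: S_def shift_ydiff)
  have df: "delta r f = const (- 1) * S (ydiff r f)"
    using inv delta_Suc[of r f] by (simp add: S_def const_uminus eq_neg_iff_add_eq_0)
  have "(delta r ^^ Suc n) f = const ((- 1) ^ n) * delta r ((S ^^ n) ((ydiff r ^^ n) f))"
    using Suc by (simp add: S_def delta.scale)
  also have "\<dots> = const ((- 1) ^ n) * (S ^^ n) ((ydiff r ^^ n) (const (- 1) * S (ydiff r f)))"
    by (simp only: 1 2 df)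
  also have "\<dots> = const ((- 1) ^ n * (- 1)) * (S ^^ n) (S ((ydiff r ^^ n) (ydiff r f)))"
    by (simp only: linear_op.scale[OF linear_op.linear_op_funpow[OF S.linear_op]]
        linear_op.scale[OF ydiff.linear_op_funpow] 3 const_mult mult.assoc)
  also have "\<dots> = const ((- 1) ^ Suc n) * (S ^^ Suc n) ((ydiff r ^^ Suc n) f)"
    by (simp only: funpow_Suc_right o_apply power_Suc2)
  finally show ?case by (simp only: S_def)
qed simp

lemma ydrop_delta_funpow: "ydrop r ((delta r ^^ n) f) = (delta r ^^ n) (ydrop r f)"
  using funpow_commute[of "ydrop r" "delta r" 1 n f] by (simp add: ydrop_delta)

lemma keys_mhom_below_le:
  "f \<in> mhom_below E r \<Longrightarrow> t \<in> keys f \<Longrightarrow> lookup t (Y i) \<le> E i"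
  by (auto simp: mhom_below_iff mdeg_def)

text \<open>The operator \<open>delta (Suc r) - delta r\<close> is nilpotent of order \<open>E r + 1\<close>, so \<open>op_relation\<close>
  applies; \<open>S\<close> is chosen such that among the terms with \<open>d \<ge> k\<close> only \<open>d = k\<close> survives.\<close>

lemma delta_image:
  fixes f h :: "'a::field mpoly"
  assumes p: "prime CHAR('a)" and h: "h \<in> mhom_below E (Suc r)"
    and f: "f = (delta (Suc r) ^^ k) h" "delta (Suc r) f = 0"
    and B: "B \<le> E r" "E r \<le> k + B" "k + B < CHAR('a)"
  shows "\<exists>g\<in>mhom_below E (Suc r). (delta r ^^ B) f = (delta r ^^ (k + 2 * B - E r)) g"
proof (cases "E r = k + B")
  \<comment> \<open>Then k + 2 B - E r = B, so f is its own witness.\<close>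
  case True
  then show ?thesis
    using f h by (intro bexI[of _ f]) (auto intro!: delta_funpow_in_mhom_below)
next
  case False
  define e where "e = E r"
  have e: "B \<le> e" "e < k + B" using B False by (auto simp: e_def)
  define S :: "'a mpoly \<Rightarrow> 'a mpoly" where "S = shift (\<lambda>i. if i < r then 1 else 0)"
  define U where "U f = S (ydiff r f)" for f
  define D where "D = (delta (Suc r) :: 'a mpoly \<Rightarrow> 'a mpoly)"
  \<comment> \<open>On \<open>A1\<close> the exponent k + B - d is at least k + 2 B - e, the power
    to be factored out. The e - B + 1 nodes of \<open>A1\<close>, the node k and the B nodes of
    \<open>A2\<close> make e + 2, the least number that \<open>op_relation\<close> accepts.\<close>
  define A1 where "A1 = {..e - B}"
  define A2 where "A2 = {k + 1..k + B}"
  define A where "A = A1 \<union> insert k A2"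
  have disj: "A1 \<inter> insert k A2 = {}" using e by (auto simp: A1_def A2_def)
  have card: "card A = e + 2"
    unfolding A_def using disj e by (subst card_Un_disjoint) (auto simp: A1_def A2_def)
  have "\<exists>c. (\<forall>d\<in>A. c d \<noteq> 0)
      \<and> (\<Sum>d\<in>A. const (c d) * (delta r ^^ (k + B - d)) ((D ^^ d) h)) = 0"
  proof (rule op_relation[where \<Delta> = "delta r" and D = D and U = U and e = e and h = h
        and S = A and n = "k + B"])
    show "linear_op U"
      using linear_op_comp[OF shift.linear_op ydiff.linear_op_axioms] by (simp add: U_def[abs_def] S_def)
    show "D f = delta r f + U f" for f by (simp add: D_def U_def S_def delta_Suc)
    show "delta r (U f) = U (delta r f)" for f
      by (simp add: U_def S_def delta_ydiff flip: shift_delta)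
    show "(U ^^ j) h = 0" if "j > e" for j
    proof -
      have "(U ^^ j) g = (S ^^ j) ((ydiff r ^^ j) g)" for g
      proof (induction j)
        case (Suc j)
        have "ydiff r ((S ^^ j) x) = (S ^^ j) (ydiff r x)" for x
          using funpow_commute[of "ydiff r" S 1 j x] by (simp add: S_def shift_ydiff)
        with Suc show ?case by (simp add: U_def)
      qed simp
      moreover have "(ydiff r ^^ j) h = 0"
      proof (rule ydiff_funpow_eq_0)
        fix t assume "t \<in> keys h"
        then have "lookup t (Y r) \<le> E r" by (rule keys_mhom_below_le[OF h])
        then show "lookup t (Y r) < j" using that by (simp add: e_def)
      qed
      moreover have "(S ^^ j) 0 = 0"
        unfolding S_def by (rule linear_op.zero[OF linear_op.linear_op_funpow[OF shift.linear_op]])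
      ultimately show ?thesis by simp
    qed
    show "A \<subseteq> {..<CHAR('a)}" using B e by (auto simp: A_def A1_def A2_def)
    show "d \<le> k + B" if "d \<in> A" for d using that e by (auto simp: A_def A1_def A2_def)
  qed (use p card in \<open>auto intro: delta.linear_op_axioms\<close>)
  then obtain c where c: "c k \<noteq> 0"
    and sum: "(\<Sum>d\<in>A. const (c d) * (delta r ^^ (k + B - d)) ((D ^^ d) h)) = 0"
    by (auto simp: A_def)
  have A2: "(\<Sum>d\<in>A2. const (c d) * (delta r ^^ (k + B - d)) ((D ^^ d) h)) = 0"
  proof (rule sum.neutral, rule ballI)
    fix d assume "d \<in> A2"
    then have d: "d = (d - Suc k) + Suc k" by (simp add: A2_def)
    define i where "i = d - Suc k"
    note d = d[folded i_def]
    interpret Di: linear_op "D ^^ i" unfolding D_def by (rule delta.linear_op_funpow)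
    interpret dk: linear_op "delta r ^^ (k + B - d)" by (rule delta.linear_op_funpow)
    have "(D ^^ d) h = (D ^^ i) (D f)"
      by (simp only: d f(1) D_def funpow_add funpow.simps(2) o_apply)
    also have "D f = 0" using f(2) by (simp add: D_def)
    finally show "const (c d) * (delta r ^^ (k + B - d)) ((D ^^ d) h) = 0" by simp
  qed
  define M where "M = k + 2 * B - e"
  define g0 where "g0 = (\<Sum>d\<in>A1. const (c d) * (delta r ^^ (e - B - d)) ((D ^^ d) h))"
  interpret dM: linear_op "delta r ^^ M" by (rule delta.linear_op_funpow)
  have A1: "(\<Sum>d\<in>A1. const (c d) * (delta r ^^ (k + B - d)) ((D ^^ d) h)) = (delta r ^^ M) g0"
    unfolding g0_def dM.sum dM.scale
  proof (intro sum.cong refl)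
    fix d assume "d \<in> A1"
    then have "k + B - d = M + (e - B - d)" using e by (auto simp: A1_def M_def)
    then show "const (c d) * (delta r ^^ (k + B - d)) ((D ^^ d) h)
        = const (c d) * (delta r ^^ M) ((delta r ^^ (e - B - d)) ((D ^^ d) h))"
      by (simp add: funpow_add)
  qed
  have "0 = (delta r ^^ M) g0 + const (c k) * (delta r ^^ B) f"
    using sum unfolding A_def
    by (subst (asm) sum.union_disjoint) (use disj A1 A2 in \<open>auto simp: A1_def A2_def D_def f(1)\<close>)
  then have "const (c k) * (delta r ^^ B) f = - (delta r ^^ M) g0"
    by (simp add: eq_neg_iff_add_eq_0 add.commute)
  then have "const (1 / c k) * (const (c k) * (delta r ^^ B) f) = const (- 1 / c k) * (delta r ^^ M) g0"
    by (simp add: const_uminus)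
  moreover have "const (1 / c k) * (const (c k) * (delta r ^^ B) f) = (delta r ^^ B) f"
    using c by (simp add: mult.assoc[symmetric] flip: const_mult)
  ultimately have "(delta r ^^ B) f = (delta r ^^ M) (const (- 1 / c k) * g0)"
    by (simp add: dM.scale)
  moreover have "const (- 1 / c k) * g0 \<in> mhom_below E (Suc r)"
    unfolding g0_def D_def using h
    by (intro mhom_below_const_mult mhom_below_sum delta_funpow_in_mhom_below)
  ultimately show ?thesis by (auto simp: M_def e_def)
qed

text \<open>The two conclusions feed each other. The level bound for w at r, applied to the B-th
  power, bounds the exponent of y_r; applied to the deeper power from \<open>delta_image\<close>, it
  yields the level bound for f at r + 1.\<close>

theorem lead_level_bound:
  fixes f h :: "'a::field mpoly"
  assumes p: "prime CHAR('a)" and E: "\<And>i. E i \<le> CHAR('a) - 1"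
  shows "\<lbrakk>f \<in> mhom_below E r; h \<in> mhom_below E r; is_lead t f; delta r f = 0; f = (delta r ^^ k) h\<rbrakk>
    \<Longrightarrow> (\<forall>j<r. lookup t (Y j) \<le> lev CHAR('a) t j) \<and> k \<le> lev CHAR('a) t r"
proof (induction r arbitrary: f h t k)
  case 0
  have "delta 0 g = (0 :: 'a mpoly)" for g by (simp add: delta_def)
  then have "k = 0" using 0 is_lead_neq_0 by (cases k) auto
  then show ?case by simp
next
  case (Suc r)
  note f = Suc.prems(1) and h = Suc.prems(2) and t = Suc.prems(3) and inv = Suc.prems(4)
  define p where "p = CHAR('a)"
  have p1: "p > 1" using p prime_gt_1_nat unfolding p_def by blast
  define B where "B = lookup t (Y r)"
  have tE: "lookup t (X r) + B = E r"
    using f t by (auto simp: is_lead_def mhom_below_iff mdeg_def B_def)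
  have Er: "E r \<le> p - 1" using E by (simp add: p_def)
  have Bp: "B < CHAR('a)" using tE Er p1 by (simp add: p_def)
  \<comment> \<open>This is B! x_r^B times the coefficient of y_r^B in f.\<close>
  define w where "w = (ydiff r ^^ B) f"
  define t' where "t' = y_to_x r B t"
  have max: "lookup s (Y r) \<le> B" if "s \<in> keys f" for s
    using mhom_below_lead_max[OF f t that] by (simp add: B_def)
  have lead_w: "is_lead t' w"
    unfolding t'_def w_def B_def using p Bp t max by (intro is_lead_ydiff_funpow) (auto simp: B_def)
  have keys_w: "keys w = y_to_x r B ` {s\<in>keys f. lookup s (Y r) = B}"
    unfolding w_def using p Bp max by (rule keys_ydiff_funpow)
  have w: "w \<in> mhom_below E r"
    unfolding mhom_below_iff keys_w
  proof (intro ballI conjI allI impI)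
    fix s assume "s \<in> y_to_x r B ` {s\<in>keys f. lookup s (Y r) = B}"
    then obtain s0 where s0: "s0 \<in> keys f" "lookup s0 (Y r) = B" "s = y_to_x r B s0" by auto
    then have *: "mdeg s0 = E" "\<And>j. j \<ge> Suc r \<Longrightarrow> lookup s0 (Y j) = 0"
      using f by (auto simp: mhom_below_iff)
    show "mdeg s = E"
      using *(1) s0(2) unfolding fun_eq_iff mdeg_def s0(3) lookup_y_to_x by fastforce
    fix j assume "j \<ge> r"
    then show "lookup s (Y j) = 0"
      using *(2)[of j] s0 by (cases "j = r") (auto simp: lookup_y_to_x)
  qed
  define S :: "'a mpoly \<Rightarrow> 'a mpoly" where "S = shift (\<lambda>i. if i < r then 1 else 0)"
  have yw: "ydiff r w = 0"
    using w by (auto simp: ydiff_def mhom_below_iff in_keys_iff intro!: shift_ident)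
  have "delta (Suc r) w = (ydiff r ^^ B) (delta (Suc r) f)"
    using funpow_commute[of "delta (Suc r)" "ydiff r" 1 B f] by (simp add: w_def delta_ydiff)
  then have "delta (Suc r) w = 0"
    using inv linear_op.zero[OF ydiff.linear_op_funpow] by simp
  then have inv_w: "delta r w = 0" using yw by (simp add: delta_Suc)
  \<comment> \<open>So the powers of the shift in \<open>delta_funpow_ydiff\<close> disappear, and w
    is the B-th power of \<open>delta r\<close> at f up to sign.\<close>
  then have "S w = w" by (simp add: delta_def S_def)
  then have "(S ^^ n) w = w" for n by (induction n) auto
  then have "(delta r ^^ B) f = const ((- 1) ^ B) * w"
    using delta_funpow_ydiff[OF inv, of B] by (simp add: S_def w_def)
  then have "const ((- 1) ^ B) * (delta r ^^ B) f = w"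
    by (simp add: mult.assoc[symmetric] flip: const_mult power_mult_distrib)
  \<comment> \<open>A witness \<open>g\<close> may involve y_r; \<open>ydrop\<close> removes it and
    leaves w unchanged.\<close>
  then have image: "w = (delta r ^^ n) (ydrop r (const ((- 1) ^ B) * g))"
    if "(delta r ^^ B) f = (delta r ^^ n) g" for n g
    using that ydrop_eq_self[OF w]
    by (metis linear_op.scale[OF delta.linear_op_funpow] ydrop_delta_funpow)
  have IH: "(\<forall>j<r. lookup t' (Y j) \<le> lev p t' j) \<and> n \<le> lev p t' r"
    if "(delta r ^^ B) f = (delta r ^^ n) g" "g \<in> mhom_below E (Suc r)" for n g
    unfolding p_def using Suc.IH[OF w _ lead_w inv_w image[OF that(1)]] that(2)
    by (auto intro!: ydrop_in_mhom_below mhom_below_const_mult)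
  have lev_t': "lev p t' j = lev p t j" if "j \<le> r" for j
    using that by (intro lev_cong) (auto simp: t'_def lookup_y_to_x)
  define l where "l = lev p t r"
  have Y: "\<forall>j<r. lookup t (Y j) \<le> lev p t j" and Bl: "B \<le> l"
    using IH[OF refl f] lev_t' by (auto simp: t'_def lookup_y_to_x l_def)
  have kp: "k \<le> p - 1"
  proof (rule ccontr)
    assume "\<not> k \<le> p - 1"
    then obtain n where "k = p + n" using p1 by (metis le_add_diff_inverse not_less_eq_eq
          Suc_pred' less_trans zero_less_one not_le_imp_less Suc_leI less_imp_le_nat)
    then have "f = 0"
      using Suc.prems(5) delta_funpow_CHAR[OF p] by (simp add: funpow_add p_def)
    then show False using is_lead_neq_0[OF t] by simp
  qed
  have "k \<le> lev p t (Suc r)"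
  proof (cases "E r \<le> k + B")
    \<comment> \<open>Here k is below the exponent of x_r, and B <= l makes the uncapped level at
      least that exponent.\<close>
    case False
    then show ?thesis using kp Bl tE by (auto simp: l_def[symmetric] B_def[symmetric])
  next
    case True
    \<comment> \<open>\<open>delta_image\<close> needs k + B < p, so k is lowered first. If the
      minimum is p - 1 - B, the induction hypothesis says that p - 1 is at most l plus the exponent
      of x_r; then the level is capped and \<open>kp\<close> suffices.\<close>
    define k' where "k' = min k (p - 1 - B)"
    have k': "k' \<le> k" "B \<le> E r" "E r \<le> k' + B" "k' + B < CHAR('a)"
      using True tE Er p1 by (auto simp: k'_def p_def[symmetric])
    define h' where "h' = (delta (Suc r) ^^ (k - k')) h"
    have h': "h' \<in> mhom_below E (Suc r)"
      unfolding h'_def using h by (rule delta_funpow_in_mhom_below)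
    have "f = (delta (Suc r) ^^ k') h'"
      unfolding h'_def Suc.prems(5) using k'(1) by (simp flip: funpow_add o_apply[of "_ ^^ _"])
    from delta_image[OF p h' this inv k'(2-)]
    have "k' + 2 * B - E r \<le> l" using IH lev_t' by (auto simp: l_def)
    then show ?thesis
      using tE kp Er Bl k' by (auto simp: l_def[symmetric] B_def[symmetric] k'_def min_def split: if_splits)
  qed
  then show ?case using Y Bl by (auto simp: less_Suc_eq p_def[symmetric] l_def B_def)
qed

section \<open>Lead monomials of the generators\<close>

abbreviation vars :: "nat \<Rightarrow> var set" where "vars m \<equiv> X ` {1..m} \<union> Y ` {1..m}"

text \<open>Sums run over i < r while the variables start at index 1; for monomials in
  \<open>vars m\<close> index 0 contributes nothing and \<open>Suc m\<close> gives the total degree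
  in the x's or y's.\<close>

definition xsum :: "mon \<Rightarrow> nat \<Rightarrow> nat" where "xsum t r = (\<Sum>i<r. lookup t (X i))"
definition ysum :: "mon \<Rightarrow> nat \<Rightarrow> nat" where "ysum t r = (\<Sum>i<r. lookup t (Y i))"

lemma xsum_0 [simp]: "xsum t 0 = 0" and ysum_0 [simp]: "ysum t 0 = 0"
  and xsum_Suc: "xsum t (Suc r) = xsum t r + lookup t (X r)"
  and ysum_Suc: "ysum t (Suc r) = ysum t r + lookup t (Y r)"
  by (simp_all add: xsum_def ysum_def)

lemma xsum_add: "xsum (s + t) r = xsum s r + xsum t r"
  and ysum_add: "ysum (s + t) r = ysum s r + ysum t r"
  by (simp_all add: xsum_def ysum_def lookup_add sum.distrib)

lemma xsum_single: "xsum (single (X i) n) r = (if i < r then n else 0)" "xsum (single (Y i) n) r = 0"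
  and ysum_single: "ysum (single (Y i) n) r = (if i < r then n else 0)" "ysum (single (X i) n) r = 0"
  by (simp_all add: xsum_def ysum_def lookup_single when_def)

lemma xsum_mono: "r \<le> r' \<Longrightarrow> xsum t r \<le> xsum t r'"
  and ysum_mono: "r \<le> r' \<Longrightarrow> ysum t r \<le> ysum t r'"
  unfolding xsum_def ysum_def by (rule sum_mono2; auto)+

lemma sum_lessThan_Suc_eq: "(\<Sum>i<Suc m. f i) = f 0 + (\<Sum>i=1..m. f i)" for f :: "nat \<Rightarrow> nat"
  unfolding lessThan_Suc_atMost atMost_atLeast0 by (subst sum.atLeast_Suc_atMost) auto

lemma lookup_not_vars:
  assumes "keys t \<subseteq> vars m" "i \<notin> {1..m}"
  shows "lookup t (X i) = 0" "lookup t (Y i) = 0"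
proof -
  have "X i \<notin> vars m" "Y i \<notin> vars m" using assms(2) by auto
  then show "lookup t (X i) = 0" "lookup t (Y i) = 0"
    using assms(1) by (auto simp: in_keys_iff simp del: Un_iff)
qed

lemma xsum_eq: "keys t \<subseteq> vars m \<Longrightarrow> xsum t (Suc m) = (\<Sum>i=1..m. lookup t (X i))"
  and ysum_eq: "keys t \<subseteq> vars m \<Longrightarrow> ysum t (Suc m) = (\<Sum>i=1..m. lookup t (Y i))"
  unfolding xsum_def ysum_def sum_lessThan_Suc_eq by (simp_all add: lookup_not_vars[of t m 0])

lemma mon_degree_eq: "keys t \<subseteq> vars m \<Longrightarrow> mon_degree t = xsum t (Suc m) + ysum t (Suc m)"
  by (subst mon_degree_eq_sum_mdeg[of _ "{1..m}"]) (auto simp: mdeg_def sum.distrib xsum_eq ysum_eq)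

text \<open>Telescoping k^(n+1) from 0 to p = 0 expresses 0 as a combination of the power sums up to
  n. By induction only the n-th remains, with factor n + 1, which is nonzero because n + 1 <
  p.\<close>

lemma power_sum_eq_0:
  assumes p: "prime CHAR('a::field)"
  shows "n < CHAR('a) - 1 \<Longrightarrow> (\<Sum>k<CHAR('a). of_nat k ^ n) = (0 :: 'a)"
proof (induction n rule: less_induct)
  case (less n)
  let ?p = "CHAR('a)"
  define P where "P j = (\<Sum>k<?p. of_nat k ^ j :: 'a)" for j
  have "0 = (of_nat ?p ^ Suc n :: 'a)" by simp
  also have "\<dots> = (\<Sum>k<?p. of_nat (Suc k) ^ Suc n - of_nat k ^ Suc n)"
    by (subst sum_lessThan_telescope) simp
  also have "\<dots> = (\<Sum>k<?p. \<Sum>j\<le>n. of_nat (Suc n choose j) * of_nat k ^ j)"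
  proof (intro sum.cong refl)
    fix k
    have "(of_nat (Suc k) :: 'a) ^ Suc n = (of_nat k + 1) ^ Suc n" by (simp add: add.commute)
    also have "\<dots> = (\<Sum>j\<le>Suc n. of_nat (Suc n choose j) * of_nat k ^ j)"
      by (simp only: binomial_ring power_one mult_1_right)
    finally show "(of_nat (Suc k) :: 'a) ^ Suc n - of_nat k ^ Suc n
        = (\<Sum>j\<le>n. of_nat (Suc n choose j) * of_nat k ^ j)"
      by (simp del: binomial_Suc_Suc power_Suc of_nat_Suc) (simp add: binomial_n_n)
  qed
  also have "\<dots> = (\<Sum>j\<le>n. of_nat (Suc n choose j) * P j)"
    by (subst sum.swap) (simp add: P_def sum_distrib_left)
  also have "\<dots> = (\<Sum>j\<in>{n}. of_nat (Suc n choose j) * P j)"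
    using less unfolding P_def by (intro sum.mono_neutral_right) auto
  also have "\<dots> = of_nat (Suc n) * P n" by (simp only: sum.insert finite.emptyI sum.empty
        empty_iff not_False_eq_True add_0_right binomial_Suc_n)
  finally have "of_nat (Suc n) * P n = 0" by simp
  moreover have "of_nat (Suc n) \<noteq> (0 :: 'a)"
    using less.prems by (simp only: of_nat_eq_0_iff_char_dvd) (auto dest: dvd_imp_le)
  ultimately show ?case by (simp add: P_def del: of_nat_Suc)
qed

text \<open>By Fermat's little theorem the p - 1 nonzero summands all equal 1.\<close>

lemma power_sum_neq_0:
  assumes p: "prime CHAR('a::field)"
  shows "(\<Sum>k<CHAR('a). of_nat k ^ (CHAR('a) - 1)) \<noteq> (0 :: 'a)"
proof -
  let ?p = "CHAR('a)"
  have p1: "?p > 1" using p prime_gt_1_nat by blast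
  have frob: "of_nat k ^ ?p = (of_nat k :: 'a)" for k
  proof (induction k)
    case (Suc k)
    then show ?case using p1 by (simp add: freshmans_dream[OF p refl])
  qed (use p1 in \<open>simp add: power_0_left\<close>)
  have one: "of_nat k ^ (?p - 1) = (1 :: 'a)" if "0 < k" "k < ?p" for k
  proof -
    have "of_nat k \<noteq> (0 :: 'a)"
      using that by (auto simp: of_nat_eq_0_iff_char_dvd dest: dvd_imp_le)
    moreover have "of_nat k * of_nat k ^ (?p - 1) = (of_nat k :: 'a)"
      using frob[of k] p1 by (simp flip: power_Suc)
    ultimately show ?thesis by simp
  qed
  have "(\<Sum>k<?p. of_nat k ^ (?p - 1)) = (\<Sum>k\<in>{0<..<?p}. of_nat k ^ (?p - 1) :: 'a)"
    using p1 by (intro sum.mono_neutral_right) (auto simp: power_0_left)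
  also have "\<dots> = (\<Sum>k\<in>{0<..<?p}. 1)" using one by (intro sum.cong) auto
  also have "\<dots> = of_nat (?p - 1)" by simp
  also have "\<dots> \<noteq> 0"
    using p1 by (simp only: of_nat_eq_0_iff_char_dvd) (auto dest: dvd_imp_le)
  finally show ?thesis .
qed

section \<open>The monomials of the traces\<close>

definition xy_mon :: "nat \<Rightarrow> (nat \<Rightarrow> nat) \<Rightarrow> (nat \<Rightarrow> nat) \<Rightarrow> mon" where
  "xy_mon m E a = (\<Sum>i=1..m. single (X i) (a i) + single (Y i) (E i - a i))"

lemma lookup_xy_mon:
  "lookup (xy_mon m E a) (X i) = (if i \<in> {1..m} then a i else 0)"
  "lookup (xy_mon m E a) (Y i) = (if i \<in> {1..m} then E i - a i else 0)"
  by (simp_all add: xy_mon_def lookup_sum lookup_add lookup_single when_def)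

lemma prod_single: "(\<Prod>i\<in>I. single (h i) (c i)) = single (sum h I :: mon) (prod c I :: 'a::field)"
  by (induction I rule: infinite_finite_induct) (simp_all add: mult_single)

lemma single_sum: "single t (sum c I) = (\<Sum>i\<in>I. single t (c i))"
  by (induction I rule: infinite_finite_induct) (simp_all add: single_add)

text \<open>In the expansion of the product of the (y_i + k x_i)^(E i) the group element k enters
  only through k raised to the x-degree, so summing over the group turns coefficients into power
  sums.\<close>

lemma Tr_y_pow_eq:
  "Tr p (y_pow m E :: 'a::field mpoly) = (\<Sum>a\<in>PiE {1..m} (\<lambda>i. {..E i}).
    single (xy_mon m E a) ((\<Prod>i=1..m. of_nat (E i choose a i)) * (\<Sum>k<p. of_nat k ^ (\<Sum>i=1..m. a i))))"
proof -
  have "(yv i + const c * xv i) ^ n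
      = (\<Sum>a\<le>n. single (single (X i) a + single (Y i) (n - a)) (of_nat (n choose a) * c ^ a))"
    for i n and c :: 'a
  proof -
    have "(const c * xv i + yv i) ^ n
        = (\<Sum>a\<le>n. of_nat (n choose a) * (const c * xv i) ^ a * yv i ^ (n - a))"
      by (rule binomial_ring)
    also have "\<dots> = (\<Sum>a\<le>n. single (single (X i) a + single (Y i) (n - a)) (of_nat (n choose a) * c ^ a))"
    proof (intro sum.cong refl)
      fix a
      have "const c ^ a = const (c ^ a)" by (induction a) (simp_all add: const_mult)
      then show "of_nat (n choose a) * (const c * xv i) ^ a * yv i ^ (n - a)
          = single (single (X i) a + single (Y i) (n - a)) (of_nat (n choose a) * c ^ a)"
        by (simp add: power_mult_distrib var_poly_power mult_single of_nat_times_single mult.assoc)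
    qed
    finally show ?thesis by (simp add: add.commute)
  qed
  then have "Tr p (y_pow m E :: 'a mpoly)
      = (\<Sum>k<p. \<Prod>i=1..m. \<Sum>a\<le>E i. single (single (X i) a + single (Y i) (E i - a))
            (of_nat (E i choose a) * of_nat k ^ a))"
    by (simp add: Tr_def y_pow_def \<sigma>_funpow shift.prod shift.power)
  also have "\<dots> = (\<Sum>k<p. \<Sum>a\<in>PiE {1..m} (\<lambda>i. {..E i}).
      single (xy_mon m E a) ((\<Prod>i=1..m. of_nat (E i choose a i)) * of_nat k ^ (\<Sum>i=1..m. a i)))"
    by (subst prod_sum_PiE) (simp_all add: prod_single xy_mon_def prod.distrib power_sum)
  also have "\<dots> = (\<Sum>a\<in>PiE {1..m} (\<lambda>i. {..E i}). \<Sum>k<p.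
      single (xy_mon m E a) ((\<Prod>i=1..m. of_nat (E i choose a i)) * of_nat k ^ (\<Sum>i=1..m. a i)))"
    by (rule sum.swap)
  finally show ?thesis by (simp only: sum_distrib_left single_sum)
qed

text \<open>The bound on the x-degree reflects the vanishing of the power sums with exponent below p
  - 1.\<close>

lemma keys_Tr_y_pow:
  assumes p: "prime CHAR('a)" and t: "t \<in> keys (Tr CHAR('a) (y_pow m E :: 'a::field mpoly))"
  shows "keys t \<subseteq> vars m" and "\<And>i. i \<in> {1..m} \<Longrightarrow> mdeg t i = E i"
    and "CHAR('a) - 1 \<le> xsum t (Suc m)"
proof -
  have "t \<in> (\<Union>a\<in>PiE {1..m} (\<lambda>i. {..E i}).
      keys (single (xy_mon m E a) ((\<Prod>i=1..m. of_nat (E i choose a i))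
        * (\<Sum>k<CHAR('a). of_nat k ^ (\<Sum>i=1..m. a i) :: 'a))))"
    using t unfolding Tr_y_pow_eq by (rule subsetD[OF keys_sum])
  then obtain a where a: "a \<in> PiE {1..m} (\<lambda>i. {..E i})"
      "t \<in> keys (single (xy_mon m E a) ((\<Prod>i=1..m. of_nat (E i choose a i))
        * (\<Sum>k<CHAR('a). of_nat k ^ (\<Sum>i=1..m. a i) :: 'a)))"
    by (rule UN_E)
  then have t: "t = xy_mon m E a" and "(\<Sum>k<CHAR('a). of_nat k ^ (\<Sum>i=1..m. a i) :: 'a) \<noteq> 0"
    by (auto split: if_splits)
  then have ge: "CHAR('a) - 1 \<le> (\<Sum>i=1..m. a i)"
    using power_sum_eq_0[OF p] by (meson not_le)
  show *: "keys t \<subseteq> vars m"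
  proof
    fix v assume "v \<in> keys t"
    then show "v \<in> vars m"
      by (cases v) (auto simp: t in_keys_iff lookup_xy_mon split: if_splits)
  qed
  show "CHAR('a) - 1 \<le> xsum t (Suc m)"
    using ge unfolding xsum_eq[OF *] by (simp add: t lookup_xy_mon)
  show "mdeg t i = E i" if "i \<in> {1..m}" for i
    using a(1) that by (auto simp: mdeg_def t lookup_xy_mon PiE_def Pi_def)
qed

text \<open>At x-degree p - 1 the power sum is nonzero, and E i < p makes each binomial coefficient
  a divisor of (E i)!, which is prime to p.\<close>

lemma in_keys_Tr_y_pow:
  assumes p: "prime CHAR('a)" and E: "\<And>i. i \<in> {1..m} \<Longrightarrow> E i \<le> CHAR('a) - 1"
    and s: "keys s \<subseteq> vars m" "\<And>i. i \<in> {1..m} \<Longrightarrow> mdeg s i = E i" "xsum s (Suc m) = CHAR('a) - 1"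
  shows "s \<in> keys (Tr CHAR('a) (y_pow m E :: 'a::field mpoly))"
proof -
  let ?P = "PiE {1..m} (\<lambda>i. {..E i})"
  let ?c = "\<lambda>a. (\<Prod>i=1..m. of_nat (E i choose a i)) * (\<Sum>k<CHAR('a). of_nat k ^ (\<Sum>i=1..m. a i)) :: 'a"
  define a where "a = restrict (\<lambda>i. lookup s (X i)) {1..m}"
  have aP: "a \<in> ?P" using s(2) by (fastforce simp: a_def mdeg_def)
  have s_eq: "xy_mon m E a = s"
  proof (rule poly_mapping_eqI)
    fix v
    show "lookup (xy_mon m E a) v = lookup s v"
    proof (cases v)
      case (X i)
      then show ?thesis using lookup_not_vars[OF s(1), of i]
        by (cases "i \<in> {1..m}") (simp_all add: lookup_xy_mon a_def)
    next
      case (Y i)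
      then show ?thesis using lookup_not_vars[OF s(1), of i] s(2)[of i]
        by (cases "i \<in> {1..m}") (auto simp: lookup_xy_mon a_def mdeg_def)
    qed
  qed
  have uniq: "b = a" if "b \<in> ?P" "xy_mon m E b = s" for b
  proof (rule PiE_ext[OF that(1) aP])
    fix i assume "i \<in> {1..m}"
    then show "b i = a i"
      using that(2) lookup_xy_mon(1)[of m E b i] by (simp add: a_def)
  qed
  have "lookup (Tr CHAR('a) (y_pow m E :: 'a mpoly)) s = (\<Sum>b\<in>?P. if b = a then ?c b else 0)"
    unfolding Tr_y_pow_eq lookup_sum
  proof (intro sum.cong refl)
    fix b assume "b \<in> ?P"
    then have "xy_mon m E b = s \<longleftrightarrow> b = a" using uniq s_eq by blast
    then show "lookup (single (xy_mon m E b) (?c b)) s = (if b = a then ?c b else 0)"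
      by (simp only: lookup_single when_def)
  qed
  also have "\<dots> = ?c a"
    using aP by (simp add: finite_PiE)
  also have "(\<Sum>i=1..m. a i) = CHAR('a) - 1"
    using s(3) unfolding xsum_eq[OF s(1)] by (simp add: a_def)
  also have "(\<Prod>i=1..m. of_nat (E i choose a i)) * (\<Sum>k<CHAR('a). of_nat k ^ (CHAR('a) - 1)) \<noteq> (0 :: 'a)"
  proof -
    have "of_nat (E i choose a i) \<noteq> (0 :: 'a)" if i: "i \<in> {1..m}" for i
    proof -
      have "a i \<le> E i" using aP i by auto
      then have "(E i choose a i) dvd fact (E i)"
        using binomial_fact_lemma[of "a i" "E i"] dvd_triv_right[of "E i choose a i"] by metis
      moreover have "\<not> CHAR('a) dvd fact (E i)"
        using E[OF i] prime_dvd_fact_iff[OF p, of "E i"] prime_gt_0_nat[OF p] by simp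
      ultimately have "\<not> CHAR('a) dvd (E i choose a i)" using dvd_trans by blast
      then show ?thesis by (simp add: of_nat_eq_0_iff_char_dvd)
    qed
    then show ?thesis using power_sum_neq_0[OF p] by simp
  qed
  finally show ?thesis by (simp add: in_keys_iff)
qed

text \<open>The p - 1 factors x sit at the smallest possible indices, and \<open>R\<close> is where
  they run out. Among the monomials of the same multidegree with x-degree at least p - 1 this one is
  the largest.\<close>

definition Tr_lead :: "nat \<Rightarrow> nat \<Rightarrow> mon \<Rightarrow> bool" where
  "Tr_lead p m s \<longleftrightarrow> keys s \<subseteq> vars m \<and> (\<forall>i. mdeg s i \<le> p - 1) \<and> mon_degree s > 2 * (p - 1)
    \<and> xsum s (Suc m) = p - 1
    \<and> (\<exists>R. (\<forall>j<R. lookup s (Y j) = 0) \<and> (\<forall>j>R. lookup s (X j) = 0))"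

text \<open>If t were larger, then at the smallest variable where they differ s would have the
  larger exponent. In fixed multidegree this variable is some x_i, and i <= R. For j < R all of the
  degree in index j already lies in x_j, so no x-exponent of t exceeds that of s, and the x-degree
  of t falls below p - 1.\<close>

lemma is_lead_Tr:
  assumes p: "prime CHAR('a)" and s: "Tr_lead CHAR('a) m s"
  shows "is_lead s (Tr CHAR('a) (y_pow m (mdeg s) :: 'a::field mpoly))"
  unfolding is_lead_def
proof (intro conjI ballI impI)
  from s obtain R where R: "\<And>j. j < R \<Longrightarrow> lookup s (Y j) = 0" "\<And>j. j > R \<Longrightarrow> lookup s (X j) = 0"
    by (auto simp: Tr_lead_def)
  show "s \<in> keys (Tr CHAR('a) (y_pow m (mdeg s) :: 'a mpoly))"
    using s by (intro in_keys_Tr_y_pow[OF p]) (auto simp: Tr_lead_def)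
  fix t assume t: "t \<in> keys (Tr CHAR('a) (y_pow m (mdeg s) :: 'a mpoly))" "t \<noteq> s"
  note tk = keys_Tr_y_pow[OF p t(1)]
  have mdeg: "mdeg t i = mdeg s i" for i
  proof (cases "i \<in> {1..m}")
    case False
    then show ?thesis
      using lookup_not_vars[OF tk(1) False] lookup_not_vars[of s m i] s
      by (simp add: mdeg_def Tr_lead_def)
  qed (use tk(2) in auto)
  show "grevlex_less t s"
  proof (rule ccontr)
    assume "\<not> grevlex_less t s"
    then have "grevlex_less s t" using grevlex_less_total[OF t(2)] by simp
    moreover have "mon_degree s = mon_degree t" using mdeg by (intro mon_degree_cong_mdeg) auto
    ultimately obtain v where v: "lookup s v > lookup t v"
        "\<And>x. position x > position v \<Longrightarrow> lookup s x = lookup t x"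
      by (auto simp: grevlex_less_def)
    show False
    proof (cases v)
      case (Y i)
      then have "lookup s (X i) = lookup t (X i)" using v(2)[of "X i"] by simp
      then show False using v(1) mdeg[of i] by (simp add: mdeg_def Y)
    next
      case (X i)
      have "i \<le> R" using R(2)[of i] v(1) X by (cases "R < i") auto
      have le: "lookup t (X j) \<le> lookup s (X j)" for j
      proof (cases j i rule: linorder_cases)
        case less
        then show ?thesis using R(1)[of j] \<open>i \<le> R\<close> mdeg[of j] by (simp add: mdeg_def)
      next
        case greater
        then show ?thesis using v(2)[of "X j"] X by simp
      qed (use v X in auto)
      have "i \<in> {1..m}"
        using lookup_not_vars(1)[of s m i] s v(1) X by (auto simp: Tr_lead_def)
      then have "xsum t (Suc m) < xsum s (Suc m)"
        unfolding xsum_def using le v(1) X by (intro sum_strict_mono_ex1) auto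
      then show False using tk(3) s by (simp add: Tr_lead_def)
    qed
  qed
qed

section \<open>Lead monomials of the norms and of the u_ij\<close>

lemma single_X_neq_Y: "single (X i) (Suc 0) \<noteq> (single (Y i) (Suc 0) :: mon)"
proof
  assume "single (X i) (Suc 0) = (single (Y i) (Suc 0) :: mon)"
  then have "lookup (single (X i) (Suc 0) :: mon) (X i) = lookup (single (Y i) (Suc 0)) (X i)"
    by simp
  then show False by (simp add: lookup_single when_def)
qed

lemma lookup_y_plus_x:
  "lookup (yv i + const c * xv i :: 'a::field mpoly) (single (Y i) (Suc 0)) = 1"
  using single_X_neq_Y[of i] by (simp add: var_poly_def lookup_add lookup_single when_def)

lemma is_lead_y_plus_x:
  "is_lead (single (Y i) (Suc 0)) (yv i + const c * xv i :: 'a::field mpoly)"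
proof -
  have keys: "keys (yv i + const c * xv i :: 'a mpoly) \<subseteq> {single (Y i) (Suc 0), single (X i) (Suc 0)}"
    by (rule order_trans[OF keys_add]) (simp add: var_poly_def)
  have "grevlex_less (single (X i) (Suc 0)) (single (Y i) (Suc 0))"
    unfolding grevlex_less_def by (auto simp: lookup_single when_def intro!: exI[of _ "X i"])
  moreover have "single (Y i) (Suc 0) \<in> keys (yv i + const c * xv i :: 'a mpoly)"
    by (simp only: in_keys_iff lookup_y_plus_x one_neq_zero not_False_eq_True)
  ultimately show ?thesis using keys unfolding is_lead_def by blast
qed

lemma is_lead_prod:
  "(\<And>i. i \<in> I \<Longrightarrow> is_lead (h i) (f i)) \<Longrightarrow> is_lead (sum h I) (prod f I)"
  by (induction I rule: infinite_finite_induct) (auto intro: is_lead_1 is_lead_mult)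

lemma N_y_eq: "N p (yv i :: 'a::field mpoly) = (\<Prod>k<p. yv i + const (of_nat k) * xv i)"
  by (simp add: N_def \<sigma>_funpow)

lemma is_lead_N: "is_lead (single (Y i) p) (N p (yv i :: 'a::field mpoly))"
proof -
  have "(\<Sum>k<p. single (Y i) (Suc 0)) = (single (Y i) p :: mon)"
    by (induction p) (simp_all flip: single_add)
  moreover have "is_lead (\<Sum>k<p. single (Y i) (Suc 0)) (N p (yv i :: 'a mpoly))"
    unfolding N_y_eq by (rule is_lead_prod) (rule is_lead_y_plus_x)
  ultimately show ?thesis by simp
qed

lemma lookup_N_lead: "lookup (N p (yv i :: 'a::field mpoly)) (single (Y i) p) = 1"
proof (induction p)
  case (Suc p)
  have "N (Suc p) (yv i :: 'a mpoly) = N p (yv i) * (yv i + const (of_nat p) * xv i)"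
    by (simp add: N_y_eq)
  moreover have "single (Y i) (Suc p) = single (Y i) p + single (Y i) (Suc 0)"
    by (simp flip: single_add)
  ultimately show ?case
    using Suc by (simp only: is_lead_mult(2)[OF is_lead_N is_lead_y_plus_x] lookup_y_plus_x mult_1)
qed (simp add: N_def)

text \<open>The smallest variable present is x_j, and it occurs only in the other term.\<close>

lemma is_lead_u:
  assumes "i < j" shows "is_lead (single (X i) 1 + single (Y j) 1) (u i j :: 'a::field mpoly)"
proof -
  let ?s = "single (X j) 1 + single (Y i) 1 :: mon" and ?t = "single (X i) 1 + single (Y j) 1 :: mon"
  have u: "u i j = single ?t 1 - (single ?s 1 :: 'a mpoly)"
    by (simp add: u_def var_poly_def mult_single)
  have less: "grevlex_less ?s ?t"
    using assms unfolding grevlex_less_def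
    by (auto simp: mon_degree_add lookup_add lookup_single when_def intro!: exI[of _ "X j"])
  then have "?s \<noteq> ?t" by auto
  then have "keys (u i j :: 'a mpoly) = {?t, ?s}"
    unfolding u by (auto simp: in_keys_iff lookup_minus lookup_single when_def split: if_splits)
  then show ?thesis using less by (auto simp: is_lead_def)
qed

section \<open>The monoid generated by the lead monomials\<close>

text \<open>Purely combinatorial, so that membership is a statement about exponents alone;
  \<open>monomial_in_generators\<close> turns members back into products of generators.\<close>

inductive_set lead_monoid :: "nat \<Rightarrow> nat \<Rightarrow> mon set" for p m where
  zero: "0 \<in> lead_monoid p m"
| x: "t \<in> lead_monoid p m \<Longrightarrow> i \<in> {1..m} \<Longrightarrow> t + single (X i) 1 \<in> lead_monoid p m"
| u: "t \<in> lead_monoid p m \<Longrightarrow> 1 \<le> i \<Longrightarrow> i < j \<Longrightarrow> j \<le> m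
    \<Longrightarrow> t + (single (X i) 1 + single (Y j) 1) \<in> lead_monoid p m"
| N: "t \<in> lead_monoid p m \<Longrightarrow> i \<in> {1..m} \<Longrightarrow> t + single (Y i) p \<in> lead_monoid p m"
| Tr: "t \<in> lead_monoid p m \<Longrightarrow> Tr_lead p m s \<Longrightarrow> t + s \<in> lead_monoid p m"

lemma lead_monoid_x_power:
  assumes "t \<in> lead_monoid p m" "i \<in> {1..m}"
  shows "t + single (X i) n \<in> lead_monoid p m"
proof (induction n)
  case (Suc n)
  have "t + single (X i) (Suc n) = (t + single (X i) n) + single (X i) 1"
    by (simp add: add.assoc flip: single_add)
  then show ?case using lead_monoid.x[OF Suc assms(2)] by simp
qed (simp add: assms(1))

lemma lead_monoid_x_powers:
  assumes "t \<in> lead_monoid p m" "finite I" "I \<subseteq> {1..m}"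
  shows "t + (\<Sum>i\<in>I. single (X i) (n i)) \<in> lead_monoid p m"
  using assms(2,3)
proof (induction I rule: finite_induct)
  case (insert i I)
  have eq: "t + (\<Sum>j\<in>insert i I. single (X j) (n j)) = (t + (\<Sum>j\<in>I. single (X j) (n j))) + single (X i) (n i)"
    using insert by (simp add: add_ac)
  show ?case unfolding eq using insert by (intro lead_monoid_x_power) auto
qed (simp add: assms(1))

section \<open>Decomposing ballot monomials\<close>

lemma split_mon:
  assumes "lookup t v > 0" obtains t' where "t = t' + single v (1 :: nat)"
proof
  show "t = (t - single v 1) + single v 1"
    using assms by (intro poly_mapping_eqI) (auto simp: lookup_add lookup_minus lookup_single when_def)
qed

text \<open>The ballot condition provides an x_i before the first y_j, so the lead monomial of u_ij
  splits off. As j is minimal, partial y-sums ending before j are zero, and from j on both sides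
  drop by one. The condition is assumed only up to k, since after overflow it may fail
  later.\<close>

lemma strip_pair:
  assumes ballot: "\<And>r. r \<le> k \<Longrightarrow> ysum t (Suc r) \<le> xsum t r" and k: "lookup t (Y k) > 0"
  obtains t' i j where "t = t' + (single (X i) 1 + single (Y j) 1)" "i < j" "j \<le> k"
    "\<And>r. ysum t (Suc r) \<le> xsum t r \<Longrightarrow> ysum t' (Suc r) \<le> xsum t' r"
proof -
  define j where "j = (LEAST j. lookup t (Y j) > 0)"
  have j: "lookup t (Y j) > 0" "j \<le> k"
    unfolding j_def using k by (rule LeastI, rule Least_le)
  have less: "lookup t (Y i) = 0" if "i < j" for i
    using not_less_Least that unfolding j_def by blast
  have "xsum t j > 0" using ballot[OF j(2)] j(1) by (simp add: ysum_Suc)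
  then obtain i where i: "i < j" "lookup t (X i) > 0"
    unfolding xsum_def by (metis gr0I lessThan_iff less_numeral_extra(3) sum.neutral)
  obtain t0 where t0: "t = t0 + single (Y j) 1" using j(1) by (rule split_mon)
  have "lookup t0 (X i) > 0" using i(2) by (simp add: t0 lookup_add lookup_single when_def)
  then obtain t' where t': "t0 = t' + single (X i) 1" by (rule split_mon)
  have t: "t = t' + (single (X i) 1 + single (Y j) 1)" by (simp add: t0 t' add_ac)
  have "ysum t' (Suc r) \<le> xsum t' r" if r: "ysum t (Suc r) \<le> xsum t r" for r
  proof (cases "r < j")
    case True
    then have "ysum t (Suc r) = 0" using less by (simp add: ysum_def)
    then show ?thesis by (simp add: t ysum_add)
  next
    case False
    then show ?thesis using r i(1) by (simp add: t ysum_add xsum_add xsum_single ysum_single)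
  qed
  then show ?thesis using that[OF t i(1) j(2)] by blast
qed

lemma pair_in_vars:
  assumes "keys (t' + (single (X i) 1 + single (Y j) (1 :: nat))) \<subseteq> vars m"
  shows "keys t' \<subseteq> vars m" "1 \<le> i" "j \<le> m"
proof -
  have *: "keys t' \<union> {X i, Y j} \<subseteq> vars m" using assms by (simp add: keys_add_eq Un_assoc)
  then have "X i \<in> vars m" "Y j \<in> vars m" by blast+
  with * show "keys t' \<subseteq> vars m" "1 \<le> i" "j \<le> m" by auto
qed

lemma ballot_in_lead_monoid:
  "keys t \<subseteq> vars m \<Longrightarrow> (\<And>r. ysum t (Suc r) \<le> xsum t r) \<Longrightarrow> t \<in> lead_monoid p m"
proof (induction "mon_degree t" arbitrary: t rule: less_induct)
  case less
  show ?case
  proof (cases "\<exists>k. lookup t (Y k) > 0")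
    case True
    then obtain k where k: "lookup t (Y k) > 0" ..
    obtain t' i j where t: "t = t' + (single (X i) 1 + single (Y j) 1)" "i < j"
      and b: "\<And>r. ysum t (Suc r) \<le> xsum t r \<Longrightarrow> ysum t' (Suc r) \<le> xsum t' r"
      using strip_pair[OF less.prems(2) k] by metis
    have v: "keys t' \<subseteq> vars m" "1 \<le> i" "j \<le> m"
      using pair_in_vars less.prems(1) unfolding t(1) by blast+
    have "mon_degree t' < mon_degree t" by (simp add: t(1) mon_degree_add)
    then have "t' \<in> lead_monoid p m" using less.hyps v(1) b less.prems(2) by blast
    then show ?thesis unfolding t(1) using v t(2) by (intro lead_monoid.u)
  next
    case False
    have "t = 0 + (\<Sum>i=1..m. single (X i) (lookup t (X i)))"
    proof (rule poly_mapping_eqI)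
      fix v
      show "lookup t v = lookup (0 + (\<Sum>i=1..m. single (X i) (lookup t (X i)))) v"
      proof (cases v)
        case (X i)
        then show ?thesis using lookup_not_vars(1)[OF less.prems(1), of i]
          by (cases "i \<in> {1..m}") (auto simp: lookup_sum lookup_single when_def)
      next
        case (Y i)
        then show ?thesis using False by (simp add: lookup_sum lookup_single when_def)
      qed
    qed
    also have "\<dots> \<in> lead_monoid p m"
      by (intro lead_monoid_x_powers lead_monoid.zero) auto
    finally show ?thesis .
  qed
qed

text \<open>If the ballot condition fails, it fails after R, where already at least p - 1 factors x
  have occurred; hence there are more than p - 1 factors y. Dividing out the surplus x's leaves
  x-degree p - 1 and total degree above 2(p-1), the lead monomial of a trace.\<close>

lemma no_low_y_in_lead_monoid:
  assumes v: "keys t \<subseteq> vars m" and E: "\<And>i. mdeg t i \<le> p - 1"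
    and Y0: "ysum t R = 0"
    and R: "\<And>r. r \<le> R \<Longrightarrow> ysum t (Suc r) \<le> xsum t r"
      "xsum t R \<le> p - 1" "p - 1 \<le> xsum t (Suc R)"
  shows "t \<in> lead_monoid p m"
proof (cases "\<forall>r. ysum t (Suc r) \<le> xsum t r")
  case True
  then show ?thesis using v by (intro ballot_in_lead_monoid) auto
next
  case False
  then obtain r0 where r0: "ysum t (Suc r0) > xsum t r0" by (auto simp: not_le)
  then have "R < r0" using R(1)[of r0] by (cases "r0 \<le> R") auto
  have Y: "lookup t (Y i) = 0" if "i < R" for i using Y0 that by (simp add: ysum_def)
  have ygt: "ysum t (Suc r0) > p - 1"
    using r0 R(3) xsum_mono[of "Suc R" r0 t] \<open>R < r0\<close> by simp
  have yle: "ysum t r \<le> ysum t (Suc m)" for r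
  proof (cases "r \<le> Suc m")
    case False
    then have "ysum t r = ysum t (Suc m)"
      unfolding ysum_def using lookup_not_vars(2)[OF v] by (intro sum.mono_neutral_right) auto
    then show ?thesis by simp
  qed (rule ysum_mono)
  have "R \<le> m"
  proof (rule ccontr)
    assume "\<not> R \<le> m"
    then have "ysum t (Suc m) \<le> ysum t R" by (intro ysum_mono) simp
    then show False using Y0 yle[of "Suc r0"] ygt by simp
  qed
  \<comment> \<open>The surplus: at R everything beyond the total x-degree p - 1, after R
    everything.\<close>
  define n where "n i = (if i = R then lookup t (X R) - (p - 1 - xsum t R) else lookup t (X i))" for i
  \<comment> \<open>\<open>R\<close> may be 0, which is not the index of a variable.\<close>
  define I where "I = {R..m} \<inter> {1..m}"
  define q where "q = (\<Sum>i\<in>I. single (X i) (n i))"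
  define s where "s = t - q"
  have q: "lookup q (X i) = (if i \<in> I then n i else 0)" "lookup q (Y i) = 0" for i
    by (simp_all add: q_def lookup_sum lookup_single when_def I_def)
  have n: "n i \<le> lookup t (X i)" for i by (simp add: n_def)
  have t: "t = s + q"
  proof (rule poly_mapping_eqI)
    fix v show "lookup t v = lookup (s + q) v"
      by (cases v) (auto simp: s_def lookup_add lookup_minus q n)
  qed
  have sX: "lookup s (X i) = (if i < R then lookup t (X i) else if i = R then p - 1 - xsum t R else 0)" for i
  proof (cases "i \<in> I")
    case True
    then show ?thesis using R(2,3) by (auto simp: s_def lookup_minus q n_def I_def xsum_Suc)
  next
    case False
    then have "i < R \<or> i \<notin> {1..m}" by (auto simp: I_def)
    then show ?thesis
      using False lookup_not_vars(1)[OF v, of i] R(2,3) by (auto simp: s_def lookup_minus q xsum_Suc)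
  qed
  have sY: "lookup s (Y i) = lookup t (Y i)" for i by (simp add: s_def lookup_minus q)
  have "xsum s R = xsum t R" by (simp add: xsum_def sX)
  then have "xsum s (Suc R) = p - 1" using R(2) by (simp add: xsum_Suc sX)
  moreover have "xsum s (Suc m) = xsum s (Suc R)"
    unfolding xsum_def using \<open>R \<le> m\<close> by (intro sum.mono_neutral_right) (auto simp: sX)
  ultimately have xs: "xsum s (Suc m) = p - 1" by simp
  have ks: "keys s \<subseteq> vars m" using v unfolding t keys_add_eq by blast
  have "ysum s (Suc m) = ysum t (Suc m)" by (simp add: ysum_def sY)
  then have "mon_degree s > 2 * (p - 1)"
    using xs yle[of "Suc r0"] ygt by (simp add: mon_degree_eq[OF ks])
  moreover have "mdeg s i \<le> p - 1" for i
    using E[of i] by (simp add: t mdeg_add)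
  moreover have "\<forall>j<R. lookup s (Y j) = 0" "\<forall>j>R. lookup s (X j) = 0"
    using Y by (auto simp: sX sY)
  ultimately have "Tr_lead p m s" using ks xs unfolding Tr_lead_def by blast
  then have "s \<in> lead_monoid p m" using lead_monoid.Tr[OF lead_monoid.zero] by fastforce
  then show ?thesis unfolding t q_def by (intro lead_monoid_x_powers) (auto simp: I_def)
qed

text \<open>Each y before R is paired with an earlier x and stripped. This lowers the x- and y-sums
  at R by one each and keeps both inequalities, until no y before R is left.\<close>

lemma overflow_in_lead_monoid:
  assumes "keys t \<subseteq> vars m" and "\<And>i. mdeg t i \<le> p - 1"
    and "\<And>r. r \<le> R \<Longrightarrow> ysum t (Suc r) \<le> xsum t r"
    and "xsum t R \<le> p - 1 + ysum t R" "p - 1 + ysum t R \<le> xsum t (Suc R)"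
  shows "t \<in> lead_monoid p m"
  using assms
proof (induction "ysum t R" arbitrary: t rule: less_induct)
  case less
  show ?case
  proof (cases "ysum t R = 0")
    case True
    then show ?thesis using less.prems by (intro no_low_y_in_lead_monoid[of t m p R]) auto
  next
    case False
    then obtain k where k: "k < R" "lookup t (Y k) > 0"
      unfolding ysum_def by (metis gr0I lessThan_iff sum.neutral)
    have "ysum t (Suc r) \<le> xsum t r" if "r \<le> k" for r using less.prems(3) that k(1) by simp
    then obtain t' i j where t: "t = t' + (single (X i) 1 + single (Y j) 1)" "i < j" "j \<le> k"
      and b: "\<And>r. ysum t (Suc r) \<le> xsum t r \<Longrightarrow> ysum t' (Suc r) \<le> xsum t' r"
      using strip_pair[OF _ k(2)] by metis
    have v: "keys t' \<subseteq> vars m" "1 \<le> i" "j \<le> m"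
      using pair_in_vars less.prems(1) unfolding t(1) by blast+
    have s: "ysum t R = Suc (ysum t' R)" "xsum t R = Suc (xsum t' R)" "xsum t (Suc R) = Suc (xsum t' (Suc R))"
      using t(2,3) k(1) by (simp_all add: t(1) ysum_add xsum_add xsum_single ysum_single)
    have "t' \<in> lead_monoid p m"
    proof (rule less.hyps)
      show "mdeg t' l \<le> p - 1" for l using less.prems(2)[of l] by (simp add: t(1) mdeg_add)
    qed (use s v b less.prems in auto)
    then show ?thesis unfolding t(1) using v t(2) by (intro lead_monoid.u)
  qed
qed

text \<open>Until the cap is reached, the level is the x-sum minus the y-sum, so the chain condition
  is the ballot condition. The first capped index serves as \<open>R\<close> in
  \<open>overflow_in_lead_monoid\<close>.\<close>

lemma level_chain_in_lead_monoid:
  assumes v: "keys t \<subseteq> vars m" and E: "\<And>i. mdeg t i \<le> p - 1" and p: "p > 0"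
    and chain: "\<And>j. lookup t (Y j) \<le> lev p t j"
  shows "t \<in> lead_monoid p m"
proof -
  have lev: "lev p t r + ysum t r = xsum t r"
    if "\<And>j. j < r \<Longrightarrow> lev p t j + lookup t (X j) < p - 1" for r
    using that
  proof (induction r)
    case (Suc r)
    then have "lev p t r + ysum t r = xsum t r" "lev p t r + lookup t (X r) < p - 1" by auto
    then show ?case using chain[of r] by (simp add: xsum_Suc ysum_Suc)
  qed simp
  show ?thesis
  proof (cases "\<exists>R. p - 1 \<le> lev p t R + lookup t (X R)")
    case False
    then have "ysum t (Suc r) \<le> xsum t r" for r
      using lev[of r] chain[of r] by (simp add: ysum_Suc not_le)
    then show ?thesis using v by (intro ballot_in_lead_monoid)
  next
    case True
    define R where "R = (LEAST R. p - 1 \<le> lev p t R + lookup t (X R))"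
    have R: "p - 1 \<le> lev p t R + lookup t (X R)" unfolding R_def using True by (rule LeastI_ex)
    have less: "lev p t j + lookup t (X j) < p - 1" if "j < R" for j
      using not_less_Least that unfolding R_def by (metis not_le)
    have lev': "lev p t r + ysum t r = xsum t r" if "r \<le> R" for r using that less by (intro lev) auto
    show ?thesis
    proof (rule overflow_in_lead_monoid[OF v E])
      show "ysum t (Suc r) \<le> xsum t r" if "r \<le> R" for r
        using lev'[OF that] chain[of r] by (simp add: ysum_Suc)
      show "xsum t R \<le> p - 1 + ysum t R" using lev'[of R] lev_le[OF p, of t R] by simp
      show "p - 1 + ysum t R \<le> xsum t (Suc R)" using lev'[of R] R by (simp add: xsum_Suc)
    qed
  qed
qed

section \<open>Cancellation, division by norms and multihomogeneous components\<close>

lemma mpoly_mult_neq_0: "f \<noteq> 0 \<Longrightarrow> g \<noteq> 0 \<Longrightarrow> f * g \<noteq> 0" for f g :: "'a::field mpoly"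
  by (metis is_lead_exists is_lead_mult(1) is_lead_neq_0)

lemma is_lead_add_less:
  assumes "is_lead s g" "is_lead t h" "grevlex_less s t"
  shows "is_lead t (g + h)"
proof -
  have "t \<notin> keys g"
  proof
    assume "t \<in> keys g"
    then have "t = s \<or> grevlex_less t s" using assms(1) by (auto simp: is_lead_def)
    then show False using assms(3) grevlex_less_asym by auto
  qed
  then have "t \<in> keys (g + h)" using assms(2) by (auto simp: is_lead_def in_keys_iff lookup_add)
  moreover have "grevlex_less q t" if "q \<in> keys (g + h)" "q \<noteq> t" for q
  proof -
    have "q \<in> keys g \<or> q \<in> keys h" using that(1) keys_add[of g h] by blast
    then show ?thesis
    proof
      assume "q \<in> keys g"
      then have "q = s \<or> grevlex_less q s" using assms(1) by (auto simp: is_lead_def)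
      then show ?thesis using assms(3) grevlex_less_trans[of q s t] by auto
    next
      assume "q \<in> keys h"
      then show ?thesis using assms(2) that(2) by (simp add: is_lead_def)
    qed
  qed
  ultimately show ?thesis unfolding is_lead_def by simp
qed

lemma is_lead_add:
  assumes "is_lead s g" "is_lead s' h" "s \<noteq> s'" "is_lead t (g + h)"
  shows "t = s \<or> t = s'"
proof -
  have "is_lead s' (g + h) \<or> is_lead s (g + h)"
    using grevlex_less_total[OF assms(3)] is_lead_add_less[OF assms(1,2)]
      is_lead_add_less[OF assms(2,1)] by (auto simp: add.commute)
  then show ?thesis using is_lead_unique[OF assms(4)] by auto
qed

section \<open>Division with remainder by a norm\<close>

lemma mhom_N: "N p (yv i :: 'a::field mpoly) \<in> mhom (\<lambda>j. if j = i then p else 0)"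
proof -
  have "yv i + const c * xv i \<in> mhom (\<lambda>j. if j = i then 1 else 0)" for c :: 'a
    using mhom_var[of "Y i"] mhom_var[of "X i"] unfolding mdeg_single
    by (intro mhom_add mhom_const_mult)
  then have "N p (yv i :: 'a mpoly) \<in> mhom (\<lambda>j. \<Sum>k\<in>{..<p}. if j = i then 1 else 0)"
    unfolding N_y_eq by (intro mhom_prod)
  also have "(\<lambda>j. \<Sum>k\<in>{..<p}. if j = i then 1 else 0) = (\<lambda>j. if j = i then p else 0)" by auto
  finally show ?thesis .
qed

lemma subalgebra_F_var: "i \<in> {1..m} \<Longrightarrow> xv i \<in> (F_mV2 m :: 'a::field mpoly set)"
    "i \<in> {1..m} \<Longrightarrow> yv i \<in> (F_mV2 m :: 'a::field mpoly set)"
  unfolding F_mV2_eq var_poly_in_polys_in by auto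

lemma N_in_F_mV2: "i \<in> {1..m} \<Longrightarrow> N p (yv i :: 'a::field mpoly) \<in> F_mV2 m"
  unfolding N_y_eq
  by (intro subalgebra_prod[OF subalgebra_F_mV2] subalgebra_add[OF subalgebra_F_mV2]
      subalgebra_mult[OF subalgebra_F_mV2] subalgebra_const[OF subalgebra_F_mV2] subalgebra_F_var)

lemma mon_eq_single_Y:
  assumes "mdeg t = (\<lambda>j. if j = i then p else 0)" "lookup t (Y i) = p"
  shows "t = single (Y i) p"
proof (rule poly_mapping_eqI)
  fix v
  have *: "lookup t (X j) + lookup t (Y j) = (if j = i then p else 0)" for j
    using fun_cong[OF assms(1), of j] by (simp add: mdeg_def)
  show "lookup t v = lookup (single (Y i) p) v"
  proof (cases v)
    case (X j)
    then show ?thesis using *[of j] assms(2) by (cases "j = i") (auto simp: lookup_single when_def)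
  next
    case (Y j)
    then show ?thesis using *[of j] assms(2) by (cases "j = i") (auto simp: lookup_single when_def)
  qed
qed

text \<open>The norm is monic of degree p in y_i; this makes the division terminate.\<close>

lemma keys_N_minus_power:
  assumes "t \<in> keys (N p (yv i) - single (single (Y i) p) 1 :: 'a::field mpoly)"
  shows "lookup t (Y i) < p" and "mdeg t = (\<lambda>j. if j = i then p else 0)"
proof -
  have t: "lookup (N p (yv i :: 'a mpoly)) t \<noteq> (if t = single (Y i) p then 1 else 0)"
    using assms by (auto simp: in_keys_iff lookup_minus lookup_single when_def split: if_splits)
  then have ne: "t \<noteq> single (Y i) p" using lookup_N_lead[where 'a = 'a, of p i] by auto
  then have "t \<in> keys (N p (yv i :: 'a mpoly))" using t by (simp add: in_keys_iff)
  then show mdeg: "mdeg t = (\<lambda>j. if j = i then p else 0)"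
    using mhom_N[of p i] by (auto simp: mhom_def)
  then have "lookup t (X i) + lookup t (Y i) = p" by (auto simp: mdeg_def fun_eq_iff)
  moreover have "lookup t (Y i) \<noteq> p" using mon_eq_single_Y[OF mdeg] ne by auto
  ultimately show "lookup t (Y i) < p" by simp
qed

lemma split_mon_power:
  assumes "n \<le> lookup t v" obtains t' where "t = t' + single v (n :: nat)"
proof
  show "t = (t - single v n) + single v n"
    using assms by (intro poly_mapping_eqI) (auto simp: lookup_add lookup_minus lookup_single when_def)
qed

text \<open>A monomial of multidegree \<open>E\<close> is divisible by \<open>x\<^sub>i\<^bsup>E i - p + 1\<^esup>\<close> iff its degree in \<open>y\<^sub>i\<close> is
  less than \<open>p\<close>, so this is division with remainder by \<open>N(y\<^sub>i)\<close>.\<close>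

lemma division_by_N:
  fixes f :: "'a::field mpoly"
  assumes p: "0 < p" and E: "p \<le> E i" and f: "f \<in> mhom E" "f \<in> F_mV2 m"
  obtains q r where "f = q * N p (yv i) + r * xv i ^ (E i - p + 1)"
    "q \<in> mhom (E(i := E i - p))" "q \<in> F_mV2 m" "r \<in> mhom (E(i := p - 1))" "r \<in> F_mV2 m"
proof -
  define d where "d = E i - p + 1"
  define Q where "Q = (mhom (E(i := E i - p)) \<inter> F_mV2 m :: 'a mpoly set)"
  define R where "R = (mhom (E(i := p - 1)) \<inter> F_mV2 m :: 'a mpoly set)"
  define P where "P f \<longleftrightarrow> (\<exists>q\<in>Q. \<exists>r\<in>R. f = q * N p (yv i) + r * xv i ^ d)" for f
  have add: "P (f + g)" if "P f" "P g" for f g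
  proof -
    from that obtain q r q' r' where *: "q \<in> Q" "r \<in> R" "f = q * N p (yv i) + r * xv i ^ d"
        "q' \<in> Q" "r' \<in> R" "g = q' * N p (yv i) + r' * xv i ^ d"
      unfolding P_def by blast
    have "q + q' \<in> Q" "r + r' \<in> R"
      using *(1,2,4,5) unfolding Q_def R_def
      by (auto intro: mhom_add subalgebra_add[OF subalgebra_F_mV2])
    moreover have "f + g = (q + q') * N p (yv i) + (r + r') * xv i ^ d"
      by (simp add: *(3,6) distrib_right)
    ultimately show ?thesis unfolding P_def by blast
  qed
  have "0 \<in> Q" "0 \<in> R" unfolding Q_def R_def by (auto intro: subalgebra_0[OF subalgebra_F_mV2])
  then have P0: "P 0" unfolding P_def by (intro bexI[of _ 0]) auto
  have sum: "P (\<Sum>t\<in>I. h t)" if "\<And>t. t \<in> I \<Longrightarrow> P (h t)" for I and h :: "mon \<Rightarrow> 'a mpoly"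
    using that by (induction I rule: infinite_finite_induct) (auto intro: add P0)
  have step: "P (single t c)" if "mdeg t = E" "keys t \<subseteq> vars m" for t c
    using that
  proof (induction "lookup t (Y i)" arbitrary: t c rule: less_induct)
    case less
    have ti: "lookup t (X i) + lookup t (Y i) = E i" using less.prems(1) by (auto simp: mdeg_def)
    have F: "single s c \<in> F_mV2 m" if "keys s \<subseteq> keys t" for s and c :: 'a
      using that less.prems(2) unfolding F_mV2_eq polys_in_def by auto
    show ?case
    proof (cases "lookup t (Y i) < p")
      case True
      then have "d \<le> lookup t (X i)" using ti E by (simp add: d_def)
      then obtain t' where t: "t = t' + single (X i) d" by (rule split_mon_power)
      have *: "mdeg t' j + (if j = i then d else 0) = E j" for j
        using fun_cong[OF less.prems(1), of j] by (simp add: t mdeg_add mdeg_single)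
      have "mdeg t' = E(i := p - 1)"
      proof
        show "mdeg t' j = (E(i := p - 1)) j" for j using *[of j] E p by (auto simp: d_def)
      qed
      moreover have "single t' c \<in> F_mV2 m" by (rule F) (simp add: t keys_add_eq)
      ultimately have "single t' c \<in> R"
        using mhom_single[of t' c] by (simp add: R_def)
      moreover have "single t c = 0 * N p (yv i) + single t' c * xv i ^ d"
        by (simp add: t var_poly_power mult_single)
      ultimately show ?thesis unfolding P_def using \<open>0 \<in> Q\<close> by blast
    next
      case False
      then have "p \<le> lookup t (Y i)" by simp
      then obtain t' where t: "t = t' + single (Y i) p" by (rule split_mon_power)
      have *: "mdeg t' j + (if j = i then p else 0) = E j" for j
        using fun_cong[OF less.prems(1), of j] by (simp add: t mdeg_add mdeg_single)
      have mt': "mdeg t' = E(i := E i - p)"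
      proof
        show "mdeg t' j = (E(i := E i - p)) j" for j using *[of j] by auto
      qed
      have "single t' a \<in> F_mV2 m" for a :: 'a by (rule F) (simp add: t keys_add_eq)
      then have q: "single t' a \<in> Q" for a :: 'a
        using mt' mhom_single[of t' a] by (simp add: Q_def)
      \<comment> \<open>Subtracting \<open>single t' c\<close> times the norm cancels y_i^p; the
        terms left have smaller degree in y_i and fall under the induction hypothesis.\<close>
      define h where "h = single t' (- c) * (N p (yv i) - single (single (Y i) p) 1 :: 'a mpoly)"
      have "i \<in> {1..m}"
        using lookup_not_vars(2)[OF less.prems(2), of i] False p by auto
      then have "N p (yv i) - single (single (Y i) p) 1 \<in> (F_mV2 m :: 'a mpoly set)"
        unfolding var_poly_power[symmetric]
        by (intro subalgebra_diff[OF subalgebra_F_mV2] N_in_F_mV2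
            subalgebra_power[OF subalgebra_F_mV2] subalgebra_F_var)
      then have hF: "h \<in> F_mV2 m"
        using q[of "- c"] unfolding h_def Q_def by (auto intro: subalgebra_mult[OF subalgebra_F_mV2])
      have "P h"
      proof (subst eq_sum_single, rule sum)
        fix s assume s: "s \<in> keys h"
        then obtain s' where s': "s = t' + s'" "s' \<in> keys (N p (yv i) - single (single (Y i) p) 1 :: 'a mpoly)"
          using keys_mult[of "single t' (- c)" "N p (yv i) - single (single (Y i) p) 1 :: 'a mpoly"]
          unfolding h_def by (auto split: if_splits)
        note k = keys_N_minus_power[OF s'(2)]
        show "P (single s (lookup h s))"
        proof (rule less.hyps)
          show "lookup s (Y i) < lookup t (Y i)" using k(1) by (simp add: s'(1) t lookup_add)
          show "mdeg s = E"
          proof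
            show "mdeg s j = E j" for j using *[of j] by (simp add: s'(1) mdeg_add k(2))
          qed
          show "keys s \<subseteq> vars m" using hF s by (auto simp: F_mV2_def)
        qed
      qed
      moreover have "P (single t' c * N p (yv i))"
        unfolding P_def using q[of c] \<open>0 \<in> R\<close> by (intro bexI[of _ "single t' c"] bexI[of _ 0]) auto
      ultimately have "P (single t' c * N p (yv i) + h)" using add by blast
      moreover have "single t' c * N p (yv i) + h = single t c"
        by (simp add: h_def t right_diff_distrib mult_single single_uminus)
      ultimately show ?thesis by simp
    qed
  qed
  have "P f"
  proof (subst eq_sum_single, rule sum)
    fix t assume "t \<in> keys f"
    then show "P (single t (lookup f t))"
      using f by (intro step) (auto simp: mhom_def F_mV2_def)
  qed
  then show ?thesis using that unfolding P_def Q_def R_def d_def by blast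
qed

text \<open>The lead monomial of q N(y_i) has y_i-exponent at least p, whereas in r no y_i-exponent
  exceeds p - 1, and multiplying by a power of x_i does not change that. Uniqueness is what passes
  invariance from f to quotient and remainder.\<close>

lemma division_by_N_unique:
  fixes q r :: "'a::field mpoly"
  assumes p: "0 < p" and E: "p \<le> E i" and q: "q \<in> mhom (E(i := E i - p))"
    and r: "r \<in> mhom (E(i := p - 1))" and eq: "q * N p (yv i) + r * xv i ^ (E i - p + 1) = 0"
  shows "q = 0" and "r = 0"
proof -
  define d where "d = E i - p + 1"
  have x: "xv i ^ d \<noteq> (0 :: 'a mpoly)"
    unfolding var_poly_power by (rule is_lead_neq_0[OF is_lead_single]) simp
  show "q = 0"
  proof (rule ccontr)
    assume "q \<noteq> 0"
    then obtain t where "is_lead t q" by (rule is_lead_exists)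
    then have "is_lead (t + single (Y i) p) (q * N p (yv i))"
      using is_lead_N by (rule is_lead_mult(1))
    moreover have "q * N p (yv i) = - (r * xv i ^ d)" using eq by (simp add: d_def eq_neg_iff_add_eq_0)
    ultimately have "t + single (Y i) p \<in> keys (r * xv i ^ d)" by (simp add: is_lead_def in_keys_iff)
    then obtain s where s: "s \<in> keys r" "t + single (Y i) p = s + single (X i) d"
      using keys_mult[of r "xv i ^ d"] unfolding var_poly_power by auto
    have "lookup s (X i) + lookup s (Y i) = p - 1"
      using r s(1) by (auto simp: mhom_def mdeg_def fun_eq_iff)
    moreover have "lookup s (Y i) = lookup t (Y i) + p"
      using arg_cong[OF s(2), of "\<lambda>t. lookup t (Y i)"] by (simp add: lookup_add lookup_single when_def)
    ultimately show False using p by simp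
  qed
  then show "r = 0" using eq x mpoly_mult_neq_0[of r "xv i ^ d"] by (auto simp: d_def)
qed

section \<open>Multihomogeneous components\<close>

definition mcomp :: "(nat \<Rightarrow> nat) \<Rightarrow> 'a::field mpoly \<Rightarrow> 'a mpoly" where
  "mcomp E f = (\<Sum>t\<in>{t\<in>keys f. mdeg t = E}. single t (lookup f t))"

lemma lookup_mcomp: "lookup (mcomp E f) t = (if mdeg t = E then lookup f t else 0)"
proof -
  have "lookup (mcomp E f) t = (\<Sum>s\<in>{s\<in>keys f. mdeg s = E}. if s = t then lookup f s else 0)"
    by (simp add: mcomp_def lookup_sum lookup_single when_def)
  then show ?thesis by (simp add: in_keys_iff)
qed

lemma mcomp_add: "mcomp E (f + g) = mcomp E f + mcomp E g"
  by (rule poly_mapping_eqI) (simp add: lookup_add lookup_mcomp)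

lemma mcomp_in_mhom: "mcomp E f \<in> mhom E"
  by (auto simp: mhom_def in_keys_iff lookup_mcomp split: if_splits)

lemma mcomp_mhom: "f \<in> mhom D \<Longrightarrow> mcomp E f = (if D = E then f else 0)"
  by (rule poly_mapping_eqI) (auto simp: lookup_mcomp mhom_def in_keys_iff)

lemma mcomp_shift: "mcomp E (shift c f) = shift c (mcomp E f)"
proof (induction f rule: mpoly_induct)
  case (single t a)
  then show ?case
    using mcomp_mhom[OF mhom_shift_single, of E c t a] mcomp_mhom[OF mhom_single, of E t a] by simp
qed (simp add: mcomp_add shift.add)

lemma is_lead_mcomp: "is_lead t f \<Longrightarrow> is_lead t (mcomp (mdeg t) f)"
proof (rule is_lead_sum_keys[of t f])
  assume t: "is_lead t f"
  then show "t \<in> keys (mcomp (mdeg t) f)" by (simp add: is_lead_def in_keys_iff lookup_mcomp)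
  show "keys (mcomp (mdeg t) f) \<subseteq> keys f"
    by (auto simp: in_keys_iff lookup_mcomp split: if_splits)
qed


section \<open>Lead monomials of invariants\<close>

text \<open>The definition tests the exponents k < p, and k = 1 is among them because p > 1.\<close>

lemma invariants_eq: "1 < p \<Longrightarrow> invariants p m = {f \<in> F_mV2 m. \<sigma> f = f}"
proof (intro set_eqI iffI)
  fix f :: "'a mpoly" assume p: "1 < p" and f: "f \<in> {f \<in> F_mV2 m. \<sigma> f = f}"
  then have "(\<sigma> ^^ k) f = f" for k by (induction k) auto
  then show "f \<in> invariants p m" using f by (simp add: invariants_def)
next
  fix f :: "'a mpoly" assume p: "1 < p" and f: "f \<in> invariants p m"
  then have "(\<sigma> ^^ 1) f = f" unfolding invariants_def by blast
  then show "f \<in> {f \<in> F_mV2 m. \<sigma> f = f}" using f by (simp add: invariants_def)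
qed

text \<open>The action of sigma permutes the summands cyclically, the last one returning to the
  first by \<open>\<sigma>_funpow_CHAR\<close>.\<close>

lemma \<sigma>_Tr: "\<sigma> (Tr CHAR('a) f) = Tr CHAR('a) (f :: 'a::field mpoly)"
proof (cases "CHAR('a)")
  case (Suc n)
  have "\<sigma> (Tr CHAR('a) f) = (\<Sum>k<Suc n. (\<sigma> ^^ Suc k) f)"
    by (simp add: Tr_def Suc \<sigma>.sum del: sum.lessThan_Suc)
  also have "\<dots> = (\<Sum>k<n. (\<sigma> ^^ Suc k) f) + (\<sigma> ^^ Suc n) f" by (rule sum.lessThan_Suc)
  also have "(\<sigma> ^^ Suc n) f = (\<sigma> ^^ 0) f" using \<sigma>_funpow_CHAR[of f] by (simp add: Suc)
  also have "(\<Sum>k<n. (\<sigma> ^^ Suc k) f) + (\<sigma> ^^ 0) f = (\<Sum>k<Suc n. (\<sigma> ^^ k) f)"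
    unfolding sum.lessThan_Suc_shift by (simp add: add.commute)
  finally show ?thesis by (simp add: Tr_def Suc)
qed (simp add: Tr_def)

lemma \<sigma>_N: "\<sigma> (N CHAR('a) f) = N CHAR('a) (f :: 'a::field mpoly)"
proof (cases "CHAR('a)")
  case (Suc n)
  have "\<sigma> (N CHAR('a) f) = (\<Prod>k<Suc n. (\<sigma> ^^ Suc k) f)"
    by (simp add: N_def Suc \<sigma>.prod del: prod.lessThan_Suc)
  also have "\<dots> = (\<Prod>k<n. (\<sigma> ^^ Suc k) f) * (\<sigma> ^^ Suc n) f" by (rule prod.lessThan_Suc)
  also have "(\<sigma> ^^ Suc n) f = (\<sigma> ^^ 0) f" using \<sigma>_funpow_CHAR[of f] by (simp add: Suc)
  also have "(\<Prod>k<n. (\<sigma> ^^ Suc k) f) * (\<sigma> ^^ 0) f = (\<Prod>k<Suc n. (\<sigma> ^^ k) f)"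
    unfolding prod.lessThan_Suc_shift by (simp add: mult.commute)
  finally show ?thesis by (simp add: N_def Suc)
qed (simp add: N_def)

lemma lead_small_multidegree:
  fixes f :: "'a::field mpoly"
  assumes p: "prime CHAR('a)" and f: "f \<in> mhom E" "f \<in> F_mV2 m" "\<sigma> f = f" "is_lead t f"
    and E: "\<And>i. E i \<le> CHAR('a) - 1"
  shows "t \<in> lead_monoid CHAR('a) m"
proof -
  have t: "keys t \<subseteq> vars m" "mdeg t = E"
    using f by (auto simp: is_lead_def mhom_def F_mV2_def)
  have below: "f \<in> mhom_below E (Suc m)"
  proof -
    have *: "vars m \<subseteq> range X \<union> Y ` {..<Suc m}" by auto
    show ?thesis
      using f(1,2) subset_trans[OF _ *] unfolding mhom_below_def F_mV2_def polys_in_def by blast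
  qed
  have "shift (\<lambda>i. if i < Suc m then 1 else 0) f = shift (\<lambda>_. 1) f"
  proof (rule shift_cong)
    fix t j assume *: "t \<in> keys f" "Y j \<in> keys t"
    have "j < Suc m"
    proof (rule ccontr)
      assume "\<not> j < Suc m"
      then have "lookup t (Y j) = 0" using below *(1) by (simp add: mhom_below_iff)
      then show False using *(2) by (simp add: in_keys_iff)
    qed
    then show "(if j < Suc m then 1 else 0) = (1 :: 'a)" by simp
  qed
  then have "delta (Suc m) f = 0" using f(3) by (simp add: delta_def \<sigma>_eq_shift)
  \<comment> \<open>Depth k = 0 with f as its own preimage: only the exponent bounds are wanted
    here.\<close>
  from lead_level_bound[OF p E below below f(4) this, of 0]
  have chain: "lookup t (Y j) \<le> lev CHAR('a) t j" if "j < Suc m" for j using that by simp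
  show ?thesis
  proof (rule level_chain_in_lead_monoid[OF t(1)])
    show "lookup t (Y j) \<le> lev CHAR('a) t j" for j
      using chain[of j] lookup_not_vars(2)[OF t(1), of j] by (cases "j < Suc m") auto
  qed (use t(2) E p prime_gt_0_nat in auto)
qed

text \<open>Quotient and remainder are invariants with lead monomials of smaller degree, and the
  lead monomials of q N(y_i) and r x_i^d cannot cancel.\<close>

lemma lead_multihomogeneous:
  fixes f :: "'a::field mpoly"
  assumes p: "prime CHAR('a)"
  shows "\<lbrakk>f \<in> mhom E; f \<in> F_mV2 m; \<sigma> f = f; is_lead t f\<rbrakk> \<Longrightarrow> t \<in> lead_monoid CHAR('a) m"
proof (induction "mon_degree t" arbitrary: t f E rule: less_induct)
  case less
  note f = less.prems
  define p where "p = CHAR('a)"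
  have p0: "p > 1" using p prime_gt_1_nat unfolding p_def by blast
  show ?case
  proof (cases "\<forall>i. E i \<le> p - 1")
    case True
    then show ?thesis using lead_small_multidegree[OF p f] by (simp add: p_def)
  next
    case False
    then obtain i where "\<not> E i \<le> p - 1" by blast
    then have i: "p \<le> E i" using p0 by simp
    have t: "keys t \<subseteq> vars m" "mdeg t = E"
      using f by (auto simp: is_lead_def mhom_def F_mV2_def)
    have im: "i \<in> {1..m}"
    proof (rule ccontr)
      assume "i \<notin> {1..m}"
      then have "mdeg t i = 0" using lookup_not_vars[OF t(1)] by (simp add: mdeg_def)
      then show False using t(2) i p0 by simp
    qed
    define d where "d = E i - p + 1"
    have "0 < p" using p0 by simp
    from division_by_N[of p E i, OF this i f(1,2)]
    obtain q r where qr: "f = q * N p (yv i) + r * xv i ^ d"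
      and q: "q \<in> mhom (E(i := E i - p))" "q \<in> F_mV2 m"
      and r: "r \<in> mhom (E(i := p - 1))" "r \<in> F_mV2 m"
      unfolding d_def by metis
    have "\<sigma> f = \<sigma> q * N p (yv i) + \<sigma> r * xv i ^ d"
      unfolding qr by (simp add: \<sigma>.add \<sigma>.mult \<sigma>.power \<sigma>_N p_def) (simp add: \<sigma>_eq_shift)
    then have eq: "(\<sigma> q - q) * N p (yv i) + (\<sigma> r - r) * xv i ^ d = 0"
      using f(3) qr by (simp add: algebra_simps)
    have mhom_inv: "\<sigma> q - q \<in> mhom (E(i := E i - p))" "\<sigma> r - r \<in> mhom (E(i := p - 1))"
      unfolding \<sigma>_eq_shift using q(1) r(1) by (auto intro: mhom_diff mhom_shift)
    \<comment> \<open>Applying sigma to the division of f and subtracting gives a division of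
      0.\<close>
    have inv: "\<sigma> q = q" "\<sigma> r = r"
      using division_by_N_unique[where E = E and i = i and p = p and q = "\<sigma> q - q" and r = "\<sigma> r - r"]
        \<open>0 < p\<close> i mhom_inv eq by (simp_all add: d_def)
    have qcase: "s + single (Y i) p = t \<Longrightarrow> is_lead s q \<Longrightarrow> t \<in> lead_monoid p m" for s
    proof -
      assume s: "s + single (Y i) p = t" "is_lead s q"
      have "mon_degree s < mon_degree t" using \<open>0 < p\<close> by (simp add: s(1)[symmetric] mon_degree_add)
      then have "s \<in> lead_monoid p m" unfolding p_def using less.hyps q inv s(2) by blast
      then show ?thesis unfolding s(1)[symmetric] using im by (rule lead_monoid.N)
    qed
    have rcase: "s + single (X i) d = t \<Longrightarrow> is_lead s r \<Longrightarrow> t \<in> lead_monoid p m" for s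
    proof -
      assume s: "s + single (X i) d = t" "is_lead s r"
      have "mon_degree s < mon_degree t" by (simp add: s(1)[symmetric] mon_degree_add d_def)
      then have "s \<in> lead_monoid p m" unfolding p_def using less.hyps r inv s(2) by blast
      then show ?thesis unfolding s(1)[symmetric] using im by (rule lead_monoid_x_power)
    qed
    have qlead: "is_lead (s + single (Y i) p) (q * N p (yv i))" if "is_lead s q" for s
      using that is_lead_N by (rule is_lead_mult(1))
    have rlead: "is_lead (s + single (X i) d) (r * xv i ^ d)" if "is_lead s r" for s
      using that is_lead_single[of 1 "single (X i) d"] unfolding var_poly_power
      by (intro is_lead_mult(1)) auto
    consider "q = 0" | "r = 0" | "q \<noteq> 0" "r \<noteq> 0" by blast
    then have "t \<in> lead_monoid p m"
    proof cases
      case 1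
      then have "r \<noteq> 0" using qr is_lead_neq_0[OF f(4)] by auto
      then obtain s where s: "is_lead s r" by (rule is_lead_exists)
      have "is_lead (s + single (X i) d) f" using rlead[OF s] qr 1 by simp
      then show ?thesis using rcase s is_lead_unique[OF _ f(4)] by blast
    next
      case 2
      then have "q \<noteq> 0" using qr is_lead_neq_0[OF f(4)] by auto
      then obtain s where s: "is_lead s q" by (rule is_lead_exists)
      have "is_lead (s + single (Y i) p) f" using qlead[OF s] qr 2 by simp
      then show ?thesis using qcase s is_lead_unique[OF _ f(4)] by blast
    next
      \<comment> \<open>The two lead monomials differ: one has y_i-exponent at least p, the other
        less than p.\<close>
      case 3
      obtain s where s: "is_lead s q" using 3(1) by (rule is_lead_exists)
      obtain s' where s': "is_lead s' r" using 3(2) by (rule is_lead_exists)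
      have "s' \<in> keys r" using s' by (simp add: is_lead_def)
      then have "lookup s' (X i) + lookup s' (Y i) = p - 1"
        using r(1) by (auto simp: mhom_def mdeg_def fun_eq_iff)
      then have "lookup (s + single (Y i) p) (Y i) \<noteq> lookup (s' + single (X i) d) (Y i)"
        using p0 by (simp add: lookup_add lookup_single when_def)
      then have "s + single (Y i) p \<noteq> s' + single (X i) d" by metis
      from is_lead_add[OF qlead[OF s] rlead[OF s'] this f(4)[unfolded qr]]
      show ?thesis using qcase[OF _ s] rcase[OF _ s'] by auto
    qed
    then show ?thesis by (simp add: p_def)
  qed
qed

text \<open>Shifts preserve multidegrees, so the component of f in the multidegree of t is again
  invariant, and t is still its lead monomial.\<close>

theorem lead_of_invariant:
  fixes f :: "'a::field mpoly"
  assumes p: "prime CHAR('a)" and f: "f \<in> F_mV2 m" "\<sigma> f = f" "is_lead t f"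
  shows "t \<in> lead_monoid CHAR('a) m"
proof (rule lead_multihomogeneous[OF p mcomp_in_mhom])
  show "mcomp (mdeg t) f \<in> F_mV2 m"
    using f(1) by (auto simp: F_mV2_def in_keys_iff lookup_mcomp split: if_splits)
  show "\<sigma> (mcomp (mdeg t) f) = mcomp (mdeg t) f"
    using f(2) mcomp_shift[of "mdeg t" "\<lambda>_. 1" f] by (simp add: \<sigma>_eq_shift)
qed (rule is_lead_mcomp[OF f(3)])


section \<open>The generators\<close>

definition generators :: "nat \<Rightarrow> nat \<Rightarrow> 'a::field mpoly set" where
  "generators p m =
      {xv i | i. 1 \<le> i \<and> i \<le> m} \<union> {N p (yv i) | i. 1 \<le> i \<and> i \<le> m}
    \<union> {u i j | i j. 1 \<le> i \<and> i < j \<and> j \<le> m}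
    \<union> {Tr p (y_pow m E) | E. (\<forall>i\<in>{1..m}. E i \<le> p - 1) \<and> (\<Sum>i = 1..m. E i) > 2 * (p - 1)}"

lemma subalgebra_invariants: "subalgebra (invariants p m :: 'a::field mpoly set)"
  unfolding subalgebra_def
proof (intro conjI ballI)
  show "range const \<subseteq> (invariants p m :: 'a mpoly set)"
    using subalgebra_const[OF subalgebra_F_mV2] by (auto simp: invariants_def \<sigma>_funpow)
  fix f g :: "'a mpoly" assume "f \<in> invariants p m" "g \<in> invariants p m"
  then show "f + g \<in> invariants p m" "f * g \<in> invariants p m"
    using subalgebra_add[OF subalgebra_F_mV2] subalgebra_mult[OF subalgebra_F_mV2]
    by (auto simp: invariants_def \<sigma>_funpow shift.add shift.mult)
qed

lemma generators_subset_invariants: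
  assumes p: "prime CHAR('a)"
  shows "generators CHAR('a) m \<subseteq> (invariants CHAR('a) m :: 'a::field mpoly set)"
proof -
  note sub = subalgebra_F_mV2
  have p1: "CHAR('a) > 1" using p prime_gt_1_nat by blast
  have y_pow: "y_pow m E \<in> (F_mV2 m :: 'a mpoly set)" for E
    unfolding y_pow_def by (intro subalgebra_prod[OF sub] subalgebra_power[OF sub] subalgebra_F_var)
  have "Tr CHAR('a) (y_pow m E) \<in> (F_mV2 m :: 'a mpoly set)" for E
    unfolding Tr_def \<sigma>_funpow by (intro subalgebra_sum[OF sub] shift_in_F_mV2 y_pow)
  moreover have "u i j \<in> (F_mV2 m :: 'a mpoly set)" if "1 \<le> i" "i < j" "j \<le> m" for i j
    unfolding u_def using that
    by (intro subalgebra_diff[OF sub] subalgebra_mult[OF sub] subalgebra_F_var) auto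
  moreover have "\<sigma> (u i j) = (u i j :: 'a mpoly)" for i j
    by (simp add: \<sigma>_eq_shift u_def shift.diff shift.mult algebra_simps)
  moreover have "\<sigma> (xv i) = (xv i :: 'a mpoly)" for i by (simp add: \<sigma>_eq_shift)
  ultimately show ?thesis
    unfolding generators_def invariants_eq[OF p1]
    by (auto simp: \<sigma>_N \<sigma>_Tr intro!: N_in_F_mV2 subalgebra_F_var)
qed

lemma monomial_in_generators:
  assumes p: "prime CHAR('a)" and t: "t \<in> lead_monoid CHAR('a) m"
  shows "\<exists>A e. finite A \<and> A \<subseteq> generators CHAR('a) m - {0} \<and> is_lead t (\<Prod>g\<in>A. (g :: 'a::field mpoly) ^ e g)"
proof -
  have step: "\<exists>A e. finite A \<and> A \<subseteq> generators CHAR('a) m - {0} \<and> is_lead (t + s) (\<Prod>g\<in>A. (g :: 'a mpoly) ^ e g)"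
    if IH: "\<exists>A e. finite A \<and> A \<subseteq> generators CHAR('a) m - {0} \<and> is_lead t (\<Prod>g\<in>A. (g :: 'a mpoly) ^ e g)"
      and b: "b \<in> generators CHAR('a) m" "is_lead s (b :: 'a mpoly)" for t s b
  proof -
    from IH obtain A e where A: "finite A" "A \<subseteq> generators CHAR('a) m - {0}"
        "is_lead t (\<Prod>g\<in>A. (g :: 'a mpoly) ^ e g)" by blast
    \<comment> \<open>One more factor b, whether or not b already lies in A.\<close>
    define e' where "e' g = (if g \<in> A then e g else 0) + (if g = b then 1 else 0)" for g
    have "(\<Prod>g\<in>insert b A. g ^ e' g)
        = (\<Prod>g\<in>insert b A. g ^ (if g \<in> A then e g else 0)) * (\<Prod>g\<in>insert b A. g ^ (if g = b then 1 else 0))"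
      by (simp only: e'_def power_add prod.distrib)
    also have "(\<Prod>g\<in>insert b A. g ^ (if g \<in> A then e g else 0)) = (\<Prod>g\<in>A. g ^ e g)"
      using A(1) by (intro prod.mono_neutral_cong_right) auto
    also have "(\<Prod>g\<in>insert b A. g ^ (if g = b then 1 else 0)) = (\<Prod>g\<in>{b}. g)"
      using A(1) by (intro prod.mono_neutral_cong_right) auto
    finally have "is_lead (t + s) (\<Prod>g\<in>insert b A. g ^ e' g)"
      using is_lead_mult(1)[OF A(3) b(2)] by simp
    then show ?thesis
      using A b is_lead_neq_0[OF b(2)] by (intro exI[of _ "insert b A"] exI[of _ e']) auto
  qed
  from t show ?thesis
  proof induction
    case zero
    show ?case by (intro exI[of _ "{}"]) (simp add: is_lead_1)
  next
    case (x t i)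
    show ?case
      by (rule step[OF x.IH _ is_lead_var]) (use x in \<open>auto simp: generators_def\<close>)
  next
    case (u t i j)
    show ?case
      by (rule step[OF u.IH _ is_lead_u]) (use u in \<open>auto simp: generators_def\<close>)
  next
    case (N t i)
    show ?case
      by (rule step[OF N.IH _ is_lead_N]) (use N in \<open>auto simp: generators_def\<close>)
  next
    case (Tr t s)
    have "(\<Sum>i=1..m. mdeg s i) > 2 * (CHAR('a) - 1)"
      using Tr.hyps(2) mon_degree_eq_sum_mdeg[of s "{1..m}"] by (simp add: Tr_lead_def)
    then show ?case
      using Tr.hyps(2)
      by (intro step[OF Tr.IH _ is_lead_Tr[OF p]]) (auto simp: generators_def Tr_lead_def)
  qed
qed

lemma LM_mult: "f \<noteq> 0 \<Longrightarrow> g \<noteq> 0 \<Longrightarrow> LM (f * g) = LM f * LM g" for f g :: "'a::field mpoly"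
proof -
  assume "f \<noteq> 0" "g \<noteq> 0"
  then obtain s t where "is_lead s f" "is_lead t g" by (metis is_lead_exists)
  then show ?thesis by (simp add: LM_eq[of "s + t" "f * g"] LM_eq is_lead_mult(1) mult_single)
qed

lemma LM_prod_power:
  assumes "finite A" "0 \<notin> A"
  shows "LM (\<Prod>g\<in>A. g ^ e g) = (\<Prod>g\<in>A. LM (g :: 'a::field mpoly) ^ e g)"
proof -
  have LM1: "LM 1 = (1 :: 'a mpoly)" by (simp add: LM_eq[OF is_lead_1])
  have pow: "g ^ n \<noteq> 0 \<and> LM (g ^ n) = LM g ^ n" if "g \<noteq> 0" for g :: "'a mpoly" and n
    using that by (induction n) (simp_all add: LM1 LM_mult mpoly_mult_neq_0)
  have "(\<Prod>g\<in>A. g ^ e g) \<noteq> 0 \<and> LM (\<Prod>g\<in>A. g ^ e g) = (\<Prod>g\<in>A. LM g ^ e g)"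
    using assms
  proof (induction rule: finite_induct)
    case (insert g A)
    then show ?case using pow[of g "e g"] by (simp add: LM_mult mpoly_mult_neq_0)
  qed (simp add: LM1)
  then show ?thesis by simp
qed

lemma SAGBI_basis_generators:
  assumes p: "prime CHAR('a::field)"
  shows "SAGBI_basis (generators CHAR('a) m) (invariants CHAR('a) m :: 'a mpoly set)"
  unfolding SAGBI_basis_def
proof (intro conjI ballI impI)
  show "generators CHAR('a) m \<subseteq> (invariants CHAR('a) m :: 'a mpoly set)"
    using p by (rule generators_subset_invariants)
  fix f :: "'a mpoly" assume f: "f \<in> invariants CHAR('a) m" "f \<noteq> 0 \<and> homogeneous f"
  then obtain t where t: "is_lead t f" using is_lead_exists by blast
  have "CHAR('a) > 1" using p prime_gt_1_nat by blast
  then have "t \<in> lead_monoid CHAR('a) m"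
    using f(1) t by (intro lead_of_invariant[OF p]) (auto simp: invariants_eq)
  from monomial_in_generators[OF p this] obtain A e where
    A: "finite A" "A \<subseteq> generators CHAR('a) m - {0}" "is_lead t (\<Prod>g\<in>A. (g :: 'a mpoly) ^ e g)" by blast
  have "LM f = LM (\<Prod>g\<in>A. g ^ e g)" using LM_eq[OF t] LM_eq[OF A(3)] by simp
  also have "\<dots> = (\<Prod>g\<in>A. LM g ^ e g)" using A by (intro LM_prod_power) auto
  finally show "\<exists>A e. finite A \<and> A \<subseteq> generators CHAR('a) m - {0} \<and> LM f = (\<Prod>g\<in>A. LM g ^ e g)"
    using A by blast
qed


section \<open>Generation\<close>

lemma subalgebra_generated: "subalgebra (generated_algebra B)"
  unfolding generated_algebra_def by (rule hull_in) (auto simp: subalgebra_def)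

lemma generated_algebra_superset: "B \<subseteq> generated_algebra B"
  unfolding generated_algebra_def by (rule hull_subset)

lemma generated_algebra_minimal: "B \<subseteq> A \<Longrightarrow> subalgebra A \<Longrightarrow> generated_algebra B \<subseteq> A"
  unfolding generated_algebra_def by (rule hull_minimal)

text \<open>Makes subduction terminate: the order is graded, so monomials below a given one have
  bounded degree.\<close>

lemma finite_mons: "finite {s. keys s \<subseteq> vars m \<and> mon_degree s \<le> d}"
proof -
  let ?F = "{f :: var \<Rightarrow> nat. \<forall>v. (v \<in> vars m \<longrightarrow> f v \<in> {..d}) \<and> (v \<notin> vars m \<longrightarrow> f v = 0)}"
  have "finite ?F" by (intro finite_set_of_finite_funs) auto
  moreover have "lookup ` {s. keys s \<subseteq> vars m \<and> mon_degree s \<le> d} \<subseteq> ?F"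
  proof
    fix f assume "f \<in> lookup ` {s. keys s \<subseteq> vars m \<and> mon_degree s \<le> d}"
    then obtain s where s: "f = lookup s" "keys s \<subseteq> vars m" "mon_degree s \<le> d" by auto
    have "lookup s v \<le> mon_degree s" for v
    proof (cases "v \<in> keys s")
      case True
      then show ?thesis unfolding mon_degree_def by (intro member_le_sum) auto
    qed (simp add: in_keys_iff)
    then have "lookup s v \<le> d" for v using s(3) le_trans by blast
    moreover have "lookup s v = 0" if "v \<notin> vars m" for v
      using that s(2) unfolding in_keys_iff[symmetric] not_in_keys_iff_lookup_eq_zero[symmetric] by blast
    ultimately show "f \<in> ?F" unfolding s(1) by blast
  qed
  ultimately have "finite (lookup ` {s. keys s \<subseteq> vars m \<and> mon_degree s \<le> d})"
    by (rule finite_subset[rotated])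
  then show ?thesis by (rule finite_imageD) (auto simp: inj_on_def)
qed

lemma invariants_generated:
  assumes p: "prime CHAR('a::field)"
  shows "generated_algebra (generators CHAR('a) m) = (invariants CHAR('a) m :: 'a mpoly set)"
proof
  let ?I = "invariants CHAR('a) m :: 'a mpoly set"
  let ?G = "generated_algebra (generators CHAR('a) m) :: 'a mpoly set"
  have p1: "CHAR('a) > 1" using p prime_gt_1_nat by blast
  show GI: "?G \<subseteq> ?I"
    using generators_subset_invariants[OF p] subalgebra_invariants by (rule generated_algebra_minimal)
  have lead: "f \<in> ?G" if "f \<in> ?I" "is_lead t f" for f t
    using that
  proof (induction "card {s. keys s \<subseteq> vars m \<and> grevlex_less s t}" arbitrary: f t rule: less_induct)
    case less
    have "t \<in> lead_monoid CHAR('a) m"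
      using less.prems by (intro lead_of_invariant[OF p]) (auto simp: invariants_eq[OF p1])
    from monomial_in_generators[OF p this] obtain A e where
      A: "A \<subseteq> generators CHAR('a) m - {0}" "is_lead t (\<Prod>g\<in>A. (g :: 'a mpoly) ^ e g)" by blast
    define g where "g = (\<Prod>g\<in>A. g ^ e g)"
    have gG: "g \<in> ?G"
      unfolding g_def using A(1) generated_algebra_superset[of "generators CHAR('a) m"]
      by (intro subalgebra_prod subalgebra_power subalgebra_generated) auto
    define c where "c = lookup f t / lookup g t"
    have gt: "is_lead t g" using A(2) by (simp add: g_def)
    then have "lookup g t \<noteq> 0" by (simp add: is_lead_def in_keys_iff)
    \<comment> \<open>Subtracting the multiple of g with the same lead term removes t, so the lead
      monomial of h is smaller.\<close>
    define h where "h = f - const c * g"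
    have ht: "lookup h t = 0" using \<open>lookup g t \<noteq> 0\<close> by (simp add: h_def lookup_minus c_def)
    have "h \<in> ?I"
      unfolding h_def using less.prems(1) gG GI
      by (intro subalgebra_diff[OF subalgebra_invariants] subalgebra_mult[OF subalgebra_invariants]
          subalgebra_const[OF subalgebra_invariants]) auto
    have "h \<in> ?G"
    proof (cases "h = 0")
      case True
      then show ?thesis using subalgebra_0[OF subalgebra_generated] by simp
    next
      case False
      then obtain s where s: "is_lead s h" by (rule is_lead_exists)
      then have sk: "s \<in> keys h" by (simp add: is_lead_def)
      have "s \<noteq> t" using sk ht by (auto simp: in_keys_iff)
      have "s \<in> keys f \<or> s \<in> keys g"
        using sk by (auto simp: h_def in_keys_iff lookup_minus)
      then have st: "grevlex_less s t"
        using less.prems(2) gt \<open>s \<noteq> t\<close> by (auto simp: is_lead_def)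
      have sv: "keys s \<subseteq> vars m"
        using \<open>h \<in> ?I\<close> sk by (auto simp: invariants_def F_mV2_def)
      have "{q. keys q \<subseteq> vars m \<and> grevlex_less q s} \<subset> {q. keys q \<subseteq> vars m \<and> grevlex_less q t}"
      proof (rule psubsetI)
        show "{q. keys q \<subseteq> vars m \<and> grevlex_less q s} \<subseteq> {q. keys q \<subseteq> vars m \<and> grevlex_less q t}"
        proof
          fix q assume "q \<in> {q. keys q \<subseteq> vars m \<and> grevlex_less q s}"
          then show "q \<in> {q. keys q \<subseteq> vars m \<and> grevlex_less q t}"
            using grevlex_less_trans[OF _ st] by simp
        qed
        have "s \<notin> {q. keys q \<subseteq> vars m \<and> grevlex_less q s}"
          "s \<in> {q. keys q \<subseteq> vars m \<and> grevlex_less q t}" using st sv by simp_all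
        then show "{q. keys q \<subseteq> vars m \<and> grevlex_less q s} \<noteq> {q. keys q \<subseteq> vars m \<and> grevlex_less q t}"
          by metis
      qed
      moreover have "finite {q. keys q \<subseteq> vars m \<and> grevlex_less q t}"
        by (rule finite_subset[OF _ finite_mons[of m "mon_degree t"]]) (auto simp: grevlex_less_def)
      ultimately have "card {q. keys q \<subseteq> vars m \<and> grevlex_less q s}
          < card {q. keys q \<subseteq> vars m \<and> grevlex_less q t}"
        by (intro psubset_card_mono)
      from less.hyps[OF this \<open>h \<in> ?I\<close> s] show ?thesis .
    qed
    moreover have "f = h + const c * g" by (simp add: h_def)
    ultimately show ?case
      using gG by (auto intro!: subalgebra_add subalgebra_mult subalgebra_const subalgebra_generated)
  qed
  show "?I \<subseteq> ?G"
  proof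
    fix f assume f: "f \<in> ?I"
    show "f \<in> ?G"
    proof (cases "f = 0")
      case True
      then show ?thesis using subalgebra_0[OF subalgebra_generated] by simp
    next
      case False
      then obtain t where "is_lead t f" by (rule is_lead_exists)
      then show ?thesis using lead f by blast
    qed
  qed
qed

section \<open>Minimality\<close>

lemma keys_var_poly: "keys (var_poly v :: 'a::field mpoly) = {single v 1}"
  by (simp add: var_poly_def)

lemma keys_N_mdeg:
  "t \<in> keys (N p (yv i :: 'a::field mpoly)) \<Longrightarrow> mdeg t = (\<lambda>j. if j = i then p else 0)"
  using mhom_N[of p i] by (auto simp: mhom_def)

lemma keys_N_degree:
  assumes "t \<in> keys (N p (yv i :: 'a::field mpoly))" shows "mon_degree t = p"
proof -
  have "mdeg t = mdeg (single (Y i) p)" using keys_N_mdeg[OF assms] by (simp add: mdeg_single)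
  then show ?thesis using mon_degree_cong_mdeg[of t "single (Y i) p"] by simp
qed

lemma keys_u:
  assumes "t \<in> keys (u i j :: 'a::field mpoly)"
  shows "t = single (X i) 1 + single (Y j) 1 \<or> t = single (X j) 1 + single (Y i) 1"
proof -
  have "u i j = single (single (X i) 1 + single (Y j) 1) 1 - (single (single (X j) 1 + single (Y i) 1) 1 :: 'a mpoly)"
    by (simp add: u_def var_poly_def mult_single)
  then show ?thesis using assms by (auto simp: in_keys_iff lookup_minus lookup_single when_def split: if_splits)
qed

lemma keys_Tr_degree:
  assumes p: "prime CHAR('a)" and t: "t \<in> keys (Tr CHAR('a) (y_pow m E :: 'a::field mpoly))"
  shows "mon_degree t = (\<Sum>i=1..m. E i)"
  using keys_Tr_y_pow[OF assms] by (subst mon_degree_eq_sum_mdeg[of _ "{1..m}"]) auto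

lemma mon_degree_1_eq:
  assumes "mon_degree s = 1" "lookup s v > 0" shows "s = single v 1"
proof -
  obtain s' where s: "s = s' + single v 1" using assms(2) by (rule split_mon)
  then have "mon_degree s' = 0" using assms(1) by (simp add: mon_degree_add)
  then show ?thesis using s by (simp add: mon_degree_eq_0_iff)
qed

lemma add_eq_single_1: "s + t = single v 1 \<Longrightarrow> s = single v 1 \<or> t = (single v 1 :: mon)"
proof -
  assume st: "s + t = single v 1"
  then have "mon_degree s + mon_degree t = 1" by (simp flip: mon_degree_add)
  then have "mon_degree s = 0 \<or> mon_degree t = 0" by linarith
  then show ?thesis using st by (auto simp: mon_degree_eq_0_iff)
qed

lemma X_plus_Y_inject:
  assumes "single (X a) 1 + single (Y b) 1 = (single (X c) 1 + single (Y d) 1 :: mon)"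
  shows "a = c" "b = d"
proof -
  show "a = c"
    using arg_cong[OF assms, of "\<lambda>t. lookup t (X a)"]
    by (simp add: lookup_add lookup_single when_def split: if_splits)
  show "b = d"
    using arg_cong[OF assms, of "\<lambda>t. lookup t (Y b)"]
    by (simp add: lookup_add lookup_single when_def split: if_splits)
qed

lemma not_in_generated:
  fixes B :: "'a::field mpoly set"
  assumes G: "0 \<in> G" "\<And>s t. s \<in> G \<Longrightarrow> t \<in> G \<Longrightarrow> s + t \<in> G"
    and b: "t \<in> keys b" "t \<notin> G" and B: "\<And>g s. g \<in> B \<Longrightarrow> g \<noteq> b \<Longrightarrow> s \<in> keys g \<Longrightarrow> s \<in> G"
  shows "b \<notin> generated_algebra (B - {b})"
proof -
  have "generated_algebra (B - {b}) \<subseteq> {f. keys f \<subseteq> G}"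
    using G B by (intro generated_algebra_minimal subalgebra_keys) auto
  then show ?thesis using b by auto
qed

lemma generators_cases [consumes 1, case_names x N u Tr]:
  assumes "g \<in> generators p m"
  obtains i where "i \<in> {1..m}" "g = xv i"
  | i where "i \<in> {1..m}" "g = N p (yv i)"
  | i j where "1 \<le> i" "i < j" "j \<le> m" "g = u i j"
  | E where "\<And>i. i \<in> {1..m} \<Longrightarrow> E i \<le> p - 1" "(\<Sum>i=1..m. E i) > 2 * (p - 1)" "g = Tr p (y_pow m E)"
proof -
  from assms consider "\<exists>i. g = xv i \<and> 1 \<le> i \<and> i \<le> m" | "\<exists>i. g = N p (yv i) \<and> 1 \<le> i \<and> i \<le> m"
    | "\<exists>i j. g = u i j \<and> 1 \<le> i \<and> i < j \<and> j \<le> m"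
    | "\<exists>E. g = Tr p (y_pow m E) \<and> (\<forall>i\<in>{1..m}. E i \<le> p - 1) \<and> (\<Sum>i=1..m. E i) > 2 * (p - 1)"
    unfolding generators_def by blast
  then show ?thesis
  proof cases
    case 1
    then show ?thesis using that(1) by auto
  next
    case 2
    then show ?thesis using that(2) by auto
  next
    case 3
    then show ?thesis using that(3) by auto
  next
    case 4
    then obtain E where "g = Tr p (y_pow m E)" "\<forall>i\<in>{1..m}. E i \<le> p - 1"
        "(\<Sum>i=1..m. E i) > 2 * (p - 1)" by blast
    then show ?thesis using that(4)[of E] by blast
  qed
qed

text \<open>Supplies x-exponents of total p - 1 for a monomial of a trace with prescribed
  multidegree.\<close>

lemma exists_smaller_sum:
  fixes E :: "nat \<Rightarrow> nat"
  shows "n \<le> (\<Sum>i=1..k. E i) \<Longrightarrow> \<exists>a. (\<forall>i. a i \<le> E i) \<and> (\<Sum>i=1..k. a i) = n"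
proof (induction k arbitrary: n)
  case (Suc k)
  define c where "c = min n (E (Suc k))"
  have "n - c \<le> (\<Sum>i=1..k. E i)" using Suc.prems by (simp add: c_def)
  then obtain a where a: "\<And>i. a i \<le> E i" "(\<Sum>i=1..k. a i) = n - c" using Suc.IH by blast
  have "(\<Sum>i=1..Suc k. (a(Suc k := c)) i) = n"
    using a(2) by (simp add: c_def)
  then show ?case using a(1) by (intro exI[of _ "a(Suc k := c)"]) (simp add: c_def)
qed (auto intro: exI[of _ "\<lambda>_. 0"])

section \<open>Separating monomials for the four kinds of generators\<close>

context
  fixes p m :: nat and B :: "'a::field mpoly set"
  assumes p: "prime CHAR('a)" and p_def: "p = CHAR('a)" and B_def: "B = generators p m"
begin

lemma p_ge_2: "p \<ge> 2"
  using p prime_ge_2_nat unfolding p_def by blast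

text \<open>A variable is not a product of other monomials, so its complement is a submonoid. All
  generators other than the x_k have only terms of degree at least 2.\<close>

lemma x_not_generated: "xv i \<notin> generated_algebra (B - {xv i})"
proof (rule not_in_generated[where G = "{t. t \<noteq> single (X i) 1}"])
  show "(0 :: mon) \<in> {t. t \<noteq> single (X i) 1}"
    by (auto dest: arg_cong[of _ _ mon_degree])
  show "s + t \<in> {t. t \<noteq> single (X i) 1}"
    if "s \<in> {t. t \<noteq> single (X i) 1}" "t \<in> {t. t \<noteq> single (X i) 1}" for s t :: mon
    using that add_eq_single_1[of s t "X i"] by auto
  show "single (X i) 1 \<in> keys (xv i :: 'a mpoly)" by (simp add: keys_var_poly)
  fix g s assume g: "g \<in> B" "g \<noteq> xv i" and s: "s \<in> keys g"
  have "s \<noteq> single (X i) 1"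
    using g(1) unfolding B_def
  proof (cases rule: generators_cases)
    case (x k)
    then show ?thesis using s g(2) by (auto simp: keys_var_poly var_poly_def)
  next
    case (N k)
    then show ?thesis using s keys_N_degree[where 'a = 'a, of s p k] p_ge_2 by auto
  next
    case (u k l)
    then have "mon_degree s = 2"
      using s keys_u[where 'a = 'a, of s k l] by (auto simp: mon_degree_add)
    then show ?thesis by auto
  next
    case (Tr E)
    then show ?thesis using s keys_Tr_degree[OF p, of s m E] p_ge_2 by (auto simp: p_def)
  qed
  then show "s \<in> {t. t \<noteq> single (X i) 1}" by simp
qed simp

text \<open>A product that is a nontrivial power of y_i has such a power among its factors. In the
  x_k, the u_kl and the traces every term contains some x, and the other norms have the wrong
  multidegree.\<close>

lemma N_not_generated: "N p (yv i) \<notin> generated_algebra (B - {N p (yv i)})"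
proof (rule not_in_generated[where G = "{t. \<forall>n>0. t \<noteq> single (Y i) n}"])
  show "(0 :: mon) \<in> {t. \<forall>n>0. t \<noteq> single (Y i) n}"
    by (auto dest: arg_cong[of _ _ mon_degree])
  show "s + t \<in> {t. \<forall>n>0. t \<noteq> single (Y i) n}"
    if st: "s \<in> {t. \<forall>n>0. t \<noteq> single (Y i) n}" "t \<in> {t. \<forall>n>0. t \<noteq> single (Y i) n}" for s t :: mon
  proof (rule CollectI, intro allI impI notI)
    fix n assume n: "0 < n" "s + t = single (Y i) n"
    have *: "q = single (Y i) (lookup q (Y i))" if q: "q = s \<or> q = t" for q
    proof (rule poly_mapping_eqI)
      fix v
      have "lookup q v = 0" if "v \<noteq> Y i"
        using arg_cong[OF n(2), of "\<lambda>t. lookup t v"] that q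
        by (auto simp: lookup_add lookup_single when_def)
      then show "lookup q v = lookup (single (Y i) (lookup q (Y i))) v"
        by (auto simp: lookup_single when_def)
    qed
    have "lookup s (Y i) + lookup t (Y i) = n"
      using arg_cong[OF n(2), of "\<lambda>t. lookup t (Y i)"] by (simp add: lookup_add)
    then have "lookup s (Y i) > 0 \<or> lookup t (Y i) > 0" using n(1) by linarith
    then show False using st * by blast
  qed
  show "single (Y i) p \<in> keys (N p (yv i) :: 'a mpoly)" using is_lead_N[where 'a = 'a, of i p] by (simp add: is_lead_def)
  show "single (Y i) p \<notin> {t. \<forall>n>0. t \<noteq> single (Y i) n}" using p_ge_2 by (auto intro!: exI[of _ p])
  fix g s assume g: "g \<in> B" "g \<noteq> N p (yv i)" and s: "s \<in> keys g"
  have "s \<noteq> single (Y i) n" if n: "n > 0" for n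
  proof
    assume sn: "s = single (Y i) n"
    show False
      using g(1) unfolding B_def
    proof (cases rule: generators_cases)
      case (x k)
      then have "s = single (X k) 1" using s by (simp add: keys_var_poly)
      then show False
        using arg_cong[OF sn, of "\<lambda>t. lookup t (X k)"] by (simp add: lookup_single when_def)
    next
      case (N k)
      then have "mdeg s i = (if i = k then p else 0)" using s keys_N_mdeg[where 'a = 'a, of s p k] by simp
      then have "i = k" using n by (auto simp: sn mdeg_single split: if_splits)
      then show False using g(2) N by simp
    next
      case (u k l)
      then obtain a b where "s = single (X a) 1 + single (Y b) 1" using s keys_u[where 'a = 'a, of s k l] by blast
      then have "lookup s (X a) > 0" by (simp add: lookup_add)
      then show False by (simp add: sn lookup_single when_def)
    next
      case (Tr E)
      then show False
        using s keys_Tr_y_pow(3)[OF p, of s m E] p_ge_2 by (simp add: p_def sn xsum_single)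
    qed
  qed
  then show "s \<in> {t. \<forall>n>0. t \<noteq> single (Y i) n}" by simp
qed

text \<open>The only nontrivial factorization of x_i y_j is into x_i and y_j, so the complement
  becomes a submonoid once the single y_k are removed too; none of them is a term of a
  generator.\<close>

lemma u_not_generated:
  assumes ij: "i < j" shows "u i j \<notin> generated_algebra (B - {u i j})"
proof (rule not_in_generated[where
      G = "{t. t \<noteq> single (X i) 1 + single (Y j) 1 \<and> (\<forall>k. t \<noteq> single (Y k) 1)}"])
  let ?t = "single (X i) 1 + single (Y j) 1 :: mon"
  let ?G = "{t. t \<noteq> ?t \<and> (\<forall>k. t \<noteq> single (Y k) 1)}"
  show "(0 :: mon) \<in> ?G"
    by (auto dest!: arg_cong[of _ _ mon_degree] simp: mon_degree_add)
  show "s + t \<in> ?G" if s: "s \<in> ?G" and t: "t \<in> ?G" for s t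
  proof (rule CollectI, intro conjI allI)
    show "s + t \<noteq> single (Y k) 1" for k
      using s t add_eq_single_1[of s t "Y k"] by auto
    show "s + t \<noteq> ?t"
    proof
      assume st: "s + t = ?t"
      then have deg: "mon_degree s + mon_degree t = 2" by (simp add: mon_degree_add flip: mon_degree_add[of s])
      have "lookup s (Y j) + lookup t (Y j) > 0"
        using arg_cong[OF st, of "\<lambda>t. lookup t (Y j)"] by (simp add: lookup_add)
      moreover have "mon_degree s \<noteq> 0" "mon_degree t \<noteq> 0"
        using st s t by (auto simp: mon_degree_eq_0_iff)
      ultimately have "mon_degree s = 1" "mon_degree t = 1"
          "lookup s (Y j) > 0 \<or> lookup t (Y j) > 0" using deg by linarith+
      then show False using mon_degree_1_eq[of s "Y j"] mon_degree_1_eq[of t "Y j"] s t by auto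
    qed
  qed
  show "?t \<in> keys (u i j :: 'a mpoly)" using is_lead_u[OF ij, where 'a = 'a] by (simp add: is_lead_def)
  show "?t \<notin> ?G" by simp
  fix g s assume g: "g \<in> B" "g \<noteq> u i j" and s: "s \<in> keys g"
  have deg: "mon_degree s \<noteq> 2 \<Longrightarrow> s \<noteq> ?t" "mon_degree s \<noteq> 1 \<Longrightarrow> s \<noteq> single (Y k) 1" for k
    by (auto simp: mon_degree_add)
  show "s \<in> ?G"
    using g(1) unfolding B_def
  proof (cases rule: generators_cases)
    case (x k)
    then have sk: "s = single (X k) 1" using s by (simp add: keys_var_poly)
    have "s \<noteq> single (Y l) 1" for l
    proof
      assume "s = single (Y l) 1"
      then have "lookup (single (X k) 1 :: mon) (X k) = lookup (single (Y l) 1) (X k)" by (simp add: sk)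
      then show False by (simp add: lookup_single when_def)
    qed
    then show ?thesis using deg(1) by (simp add: sk)
  next
    \<comment> \<open>For p = 2 the degree does not exclude x_i y_j, but its multidegree, spread
      over two indices, does.\<close>
    case (N k)
    then have m: "mdeg s = (\<lambda>l. if l = k then p else 0)" and d: "mon_degree s = p"
      using s keys_N_mdeg[where 'a = 'a, of s p k] keys_N_degree[where 'a = 'a, of s p k] by auto
    have "s \<noteq> ?t"
    proof
      assume "s = ?t"
      then have "mdeg s i = 1" "mdeg s j = 1" using ij by (simp_all add: mdeg_add mdeg_single)
      then show False using ij m by (auto split: if_splits)
    qed
    then show ?thesis using deg(2) d p_ge_2 by auto
  next
    case (u k l)
    have "s \<noteq> ?t"
    proof
      assume st: "s = ?t"
      have "s = single (X k) 1 + single (Y l) 1 \<or> s = single (X l) 1 + single (Y k) 1"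
        using s keys_u[where 'a = 'a, of s k l] u by blast
      then show False
      proof
        assume "s = single (X k) 1 + single (Y l) 1"
        then show False using X_plus_Y_inject[of i j k l] st u(4) g(2) by auto
      next
        assume "s = single (X l) 1 + single (Y k) 1"
        then show False using X_plus_Y_inject[of i j l k] st u(2) ij by auto
      qed
    qed
    moreover have "mon_degree s = 2" using s keys_u[where 'a = 'a, of s k l] u by (auto simp: mon_degree_add)
    ultimately show ?thesis using deg(2) by auto
  next
    case (Tr E)
    then have "mon_degree s > 2" using s keys_Tr_degree[OF p, of s m E] p_ge_2 by (simp add: p_def)
    then show ?thesis using deg by auto
  qed
qed

text \<open>The separating monomial \<open>t0\<close> is a term of the trace with x-degree exactly p
  - 1, hence with y-degree above p - 1. If it were a product of two members of \<open>G\<close>,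
  either both factors would have at least as many x's as y's, and so would \<open>t0\<close>, or one
  factor would use all the x's and the other would be trivial.\<close>

lemma Tr_not_generated:
  assumes E: "\<And>i. i \<in> {1..m} \<Longrightarrow> E i \<le> p - 1" "(\<Sum>i=1..m. E i) > 2 * (p - 1)"
  shows "Tr p (y_pow m E) \<notin> generated_algebra (B - {Tr p (y_pow m E)})"
proof -
  have "p - 1 \<le> (\<Sum>i=1..m. E i)" using E(2) by simp
  then obtain a where a: "\<And>i. a i \<le> E i" "(\<Sum>i=1..m. a i) = p - 1" using exists_smaller_sum by blast
  define t0 where "t0 = xy_mon m E a"
  have v0: "keys t0 \<subseteq> vars m"
  proof
    fix v assume "v \<in> keys t0"
    then show "v \<in> vars m"
      by (cases v) (auto simp: t0_def in_keys_iff lookup_xy_mon split: if_splits)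
  qed
  have mdeg0: "mdeg t0 i = E i" if "i \<in> {1..m}" for i
    using that a(1)[of i] by (simp add: mdeg_def t0_def lookup_xy_mon)
  have x0: "xsum t0 (Suc m) = p - 1"
    using a(2) unfolding xsum_eq[OF v0] by (simp add: t0_def lookup_xy_mon)
  have deg0: "mon_degree t0 > 2 * (p - 1)"
    using E(2) mdeg0 v0 by (subst mon_degree_eq_sum_mdeg[of _ "{1..m}"]) auto
  then have y0: "ysum t0 (Suc m) > p - 1" using x0 by (simp add: mon_degree_eq[OF v0])
  \<comment> \<open>\<open>H\<close> is demanded only of monomials whose multidegree is bounded by
    that of \<open>t0\<close>. The terms of N(y_k) have degree p > E k in index k and so are
    exempt.\<close>
  define L where "L t \<longleftrightarrow> (\<forall>i. mdeg t i \<le> mdeg t0 i)" for t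
  define H where "H t \<longleftrightarrow> ysum t (Suc m) \<le> xsum t (Suc m) \<or> p - 1 \<le> xsum t (Suc m)" for t
  define G where "G = {t. (L t \<longrightarrow> H t) \<and> t \<noteq> t0}"
  have L_add: "L (s + t) \<Longrightarrow> L s \<and> L t" for s t
    unfolding L_def mdeg_add by (meson add_leD1 add_leD2)
  \<comment> \<open>A factor with p - 1 of the x's leaves none for the other, which by
    \<open>H\<close> then has no y either.\<close>
  have half: False if st: "s + t = t0" "s \<noteq> t0" "L t \<longrightarrow> H t" "p - 1 \<le> xsum s (Suc m)" for s t
  proof -
    have t0t: "xsum t (Suc m) = 0"
      using x0 st(4) xsum_add[of s t "Suc m"] st(1) by simp
    moreover have "L t" using L_add[of s t] st(1) by (simp add: L_def)
    ultimately have "ysum t (Suc m) = 0" using st(3) p_ge_2 by (simp add: H_def)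
    moreover have "keys t \<subseteq> vars m" using v0 unfolding st(1)[symmetric] keys_add_eq by simp
    ultimately have "mon_degree t = 0" using t0t by (simp add: mon_degree_eq)
    then show False using st(1,2) by (simp add: mon_degree_eq_0_iff)
  qed
  show ?thesis
  proof (rule not_in_generated[where G = G])
    show "0 \<in> G" using x0 p_ge_2 by (auto simp: G_def H_def xsum_def ysum_def)
    show "s + t \<in> G" if s: "s \<in> G" and t: "t \<in> G" for s t
      unfolding G_def
    proof (rule CollectI, intro conjI impI notI)
      assume "L (s + t)"
      then have "H s" "H t" using s t L_add[of s t] by (auto simp: G_def)
      then show "H (s + t)" unfolding H_def xsum_add ysum_add by linarith
    next
      assume st: "s + t = t0"
      then have "L (s + t)" by (simp add: L_def)
      then have "H s" "H t" using s t L_add[of s t] by (auto simp: G_def)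
      moreover have "\<not> p - 1 \<le> xsum s (Suc m)" using half[OF st] s t by (auto simp: G_def)
      moreover have "\<not> p - 1 \<le> xsum t (Suc m)"
        using half[of t s] st s t by (auto simp: G_def add.commute)
      ultimately have "ysum (s + t) (Suc m) \<le> xsum (s + t) (Suc m)"
        by (auto simp: H_def xsum_add ysum_add)
      then show False using st x0 y0 by simp
    qed
    show "t0 \<in> keys (Tr p (y_pow m E) :: 'a mpoly)"
      unfolding p_def using E(1) v0 mdeg0 x0 by (intro in_keys_Tr_y_pow[OF p]) (auto simp: p_def)
    show "t0 \<notin> G" by (simp add: G_def)
    fix g s assume g: "g \<in> B" "g \<noteq> Tr p (y_pow m E)" and s: "s \<in> keys g"
    have deg: "mon_degree s \<le> 2 \<Longrightarrow> s \<noteq> t0" using deg0 p_ge_2 by auto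
    show "s \<in> G"
      using g(1) unfolding B_def
    proof (cases rule: generators_cases)
      case (x k)
      then have "s = single (X k) 1" using s by (simp add: keys_var_poly)
      then show ?thesis using deg by (simp add: G_def H_def ysum_single)
    next
      case (N k)
      then have "mdeg s k = p" using s keys_N_mdeg[where 'a = 'a, of s p k] by simp
      then have "\<not> mdeg s k \<le> mdeg t0 k" using mdeg0[OF N(1)] E(1)[OF N(1)] p_ge_2 by simp
      then show ?thesis by (auto simp: G_def L_def)
    next
      case (u k l)
      then have "xsum s (Suc m) = 1 \<and> ysum s (Suc m) = 1 \<and> mon_degree s = 2"
        using s keys_u[where 'a = 'a, of s k l]
        by (auto simp: xsum_add ysum_add xsum_single ysum_single mon_degree_add)
      then show ?thesis using deg by (simp add: G_def H_def)
    next
      case (Tr E')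
      note t = keys_Tr_y_pow[OF p, of s m E', folded p_def]
      have sk: "s \<in> keys (Tr p (y_pow m E' :: 'a mpoly))" using s Tr(3) by simp
      have "s \<noteq> t0"
      proof
        assume "s = t0"
        then have "E' i = E i" if "i \<in> {1..m}" for i using t(2)[OF sk that] mdeg0[OF that] by simp
        then have "y_pow m E' = (y_pow m E :: 'a mpoly)" unfolding y_pow_def by (intro prod.cong) auto
        then show False using g(2) Tr(3) by simp
      qed
      then show ?thesis using t(3)[OF sk] by (simp add: G_def H_def)
    qed
  qed
qed

lemma minimal_generating_set_generators: "minimal_generating_set B (invariants p m)"
  unfolding minimal_generating_set_def
proof (intro conjI allI impI)
  show gen: "generated_algebra B = invariants p m"
    unfolding B_def p_def by (rule invariants_generated[OF p])
  fix C assume "C \<subset> B"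
  then obtain b where b: "b \<in> B" "C \<subseteq> B - {b}" by blast
  have "b \<notin> generated_algebra (B - {b})"
    using b(1) unfolding B_def
  proof (cases rule: generators_cases)
    case (x i)
    then show "b \<notin> generated_algebra (generators p m - {b})"
      using x_not_generated by (simp add: B_def)
  next
    case (N i)
    then show "b \<notin> generated_algebra (generators p m - {b})"
      using N_not_generated by (simp add: B_def)
  next
    case (u i j)
    then show "b \<notin> generated_algebra (generators p m - {b})"
      using u_not_generated by (simp add: B_def)
  next
    case (Tr E)
    then show "b \<notin> generated_algebra (generators p m - {b})"
      using Tr_not_generated[of E] by (simp add: B_def)
  qed
  moreover have "generated_algebra C \<subseteq> generated_algebra (B - {b})"
    using b(2) generated_algebra_superset[of "B - {b}"]
    by (intro generated_algebra_minimal subalgebra_generated) blast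
  moreover have "b \<in> invariants p m" using b(1) generated_algebra_superset gen by blast
  ultimately show "generated_algebra C \<noteq> invariants p m" by blast
qed

end

theorem theorem6p3:
  fixes p m :: nat and B' :: "'a::field mpoly set"
  assumes "prime p" and "CHAR('a) = p" and "m \<ge> 1"
  defines "B' \<equiv>
      {xv i | i. 1 \<le> i \<and> i \<le> m} \<union> {N p (yv i) | i. 1 \<le> i \<and> i \<le> m}
    \<union> {u i j | i j. 1 \<le> i \<and> i < j \<and> j \<le> m}
    \<union> {Tr p (y_pow m E) | E. (\<forall>i\<in>{1..m}. E i \<le> p - 1) \<and> (\<Sum>i = 1..m. E i) > 2 * (p - 1)}"
  shows "minimal_generating_set B' (invariants p m) \<and> SAGBI_basis B' (invariants p m)"
proof -
  have B': "B' = generators p m" unfolding B'_def generators_def ..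
  have p: "prime CHAR('a)" using assms(1,2) by simp
  show ?thesis
    unfolding B' using minimal_generating_set_generators[OF p] SAGBI_basis_generators[OF p] assms(2)
    by simp
qed

end
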